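(* Let $G$ be a connected Lie group. (i) Let $(X,\omega,\Phi)$ be a Hamiltonian $G$-space, and suppose the $G$-action on $C=\Phi^{-1}(0)$ is locally free. Then $X/\!\!/G$ carries a reduced $2$-form. (ii) Let $(\tilde X,\varpi)$ be a prequantum $G$-space with moment map $\Phi$, and suppose the $G$-action on $C=\Phi^{-1}(0)$ is locally free. Then $\tilde X/\!\!/G$ carries a reduced $1$-form.
   Context: Diffeology: notions (plot, smooth map, subset and quotient diffeology) are those of Souriau and Iglesias-Zemmour. A differential form $\alpha$ on a diffeological space assigns to each plot $P:U\to X$ an ordinary form $P^*\alpha$ on $U$, with $(P\circ f)^*\alpha=f^*(P^*\alpha)$ for all smooth $f:V\to U$ between open subsets of Euclidean spaces; forms are pulled back by smooth maps in the obvious way. Locally free: all infinitesimal stabilizers $\mathfrak g_x$ (the Lie algebras of the stabilizers $G_x$), $x\in C$, are zero. Hamiltonian $G$-space: a triple $(X,\omega,\Phi)$ with $X$ a manifold on which $G$ acts smoothly, $\omega$ a $G$-invariant symplectic form, and $\Phi:X\to\mathfrak g^*$ an $\mathrm{Ad}^*$-equivariant moment map: $\mathrm i_{Z_X}\omega=-d\langle\Phi(\cdot),Z\rangle$, where $Z_X(x)=\frac{d}{dt}e^{tZ}(x)|_{t=0}$ for $Z\in\mathfrak g$. Prequantum $G$-space: a pair $(\tilde X,\varpi)$ of a manifold $\tilde X$ on which $G$ acts smoothly and a $G$-invariant contact $1$-form $\varpi$ whose Reeb vector field generates a free action of the circle group $\mathbf T=\mathrm U_1$. Its moment map $\Phi:\tilde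 X\to\mathfrak g^*$ is $\langle\Phi(\tilde x),Z\rangle=\varpi(Z_{\tilde X}(\tilde x))$. Reduced space: $X/\!\!/G:=\Phi^{-1}(0)/G$ (resp. $\tilde X/\!\!/G:=\Phi^{-1}(0)/G$) with the subquotient diffeology (subset diffeology on $\Phi^{-1}(0)$, then quotient diffeology). Let $j$ be the inclusion of $\Phi^{-1}(0)$ and $\pi$ its projection onto the reduced space. $X/\!\!/G$ carries a reduced $2$-form if there is a diffeological $2$-form $\omega_{X/\!\!/G}$ on it with $j^*\omega=\pi^*\omega_{X/\!\!/G}$; $\tilde X/\!\!/G$ carries a reduced $1$-form if there is a diffeological $1$-form $\varpi_{\tilde X/\!\!/G}$ on it with $j^*\varpi=\pi^*\varpi_{\tilde X/\!\!/G}$. *)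

theory Defs
  imports "HOL-Analysis.Analysis" "HOL-Algebra.Group_Action"
begin

section \<open>Calculus on open subsets of Euclidean spaces\<close>

text \<open>
  Dimensions vary inside the statement and may be 0, so R^n is the topological space
  \<^const>\<open>Euclidean_space\<close> \<open>n\<close>: the sequences that vanish from index \<open>n\<close> on.
\<close>

type_synonym vec = "nat \<Rightarrow> real"

abbreviation Rn :: "nat \<Rightarrow> vec set" where
  "Rn n \<equiv> topspace (Euclidean_space n)"

definition basis_vec :: "nat \<Rightarrow> vec" where
  "basis_vec i = (\<lambda>j. if j = i then 1 else 0)"

definition dderiv :: "(vec \<Rightarrow> real) \<Rightarrow> vec \<Rightarrow> vec \<Rightarrow> real" where
  "dderiv f x v = deriv (\<lambda>t. f (\<lambda>i. x i + t * v i)) 0"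

definition vderiv :: "(vec \<Rightarrow> vec) \<Rightarrow> vec \<Rightarrow> vec \<Rightarrow> vec" where
  "vderiv f x v = (\<lambda>i. dderiv (\<lambda>y. f y i) x v)"

primrec Ck :: "nat \<Rightarrow> nat \<Rightarrow> vec set \<Rightarrow> (vec \<Rightarrow> real) \<Rightarrow> bool" where
  "Ck 0 n U f \<longleftrightarrow> continuous_on U f"
| "Ck (Suc k) n U f \<longleftrightarrow> continuous_on U f \<and>
     (\<forall>i<n. (\<forall>x\<in>U. (\<lambda>t. f (\<lambda>j. x j + t * basis_vec i j)) differentiable (at 0)) \<and>
            Ck k n U (\<lambda>x. dderiv f x (basis_vec i)))"

definition smooth_fun :: "nat \<Rightarrow> vec set \<Rightarrow> (vec \<Rightarrow> real) \<Rightarrow> bool" where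
  "smooth_fun n U f \<longleftrightarrow> (\<forall>k. Ck k n U f)"

definition euclid_smooth_map :: "nat \<Rightarrow> vec set \<Rightarrow> nat \<Rightarrow> vec set \<Rightarrow> (vec \<Rightarrow> vec) \<Rightarrow> bool" where
  "euclid_smooth_map m V n U f \<longleftrightarrow>
     openin (Euclidean_space m) V \<and> openin (Euclidean_space n) U \<and> f ` V \<subseteq> U \<and>
     (\<forall>i<n. smooth_fun m V (\<lambda>v. f v i))"

text \<open>
  A \<open>k\<close>-form takes a point and the list of its \<open>k\<close> vector arguments. Its values off its
  domain, or on lists that are not \<open>k\<close> tangent vectors, carry no meaning.
\<close>

definition vecs :: "nat \<Rightarrow> nat \<Rightarrow> vec list set" where
  "vecs n k = {vs. length vs = k \<and> set vs \<subseteq> Rn n}"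

definition alternating_form :: "nat \<Rightarrow> nat \<Rightarrow> (vec list \<Rightarrow> real) \<Rightarrow> bool" where
  "alternating_form n k A \<longleftrightarrow>
     (\<forall>vs\<in>vecs n k. \<forall>i<k. \<forall>v\<in>Rn n. \<forall>w\<in>Rn n. \<forall>s t.
        A (vs[i := (\<lambda>j. s * v j + t * w j)]) = s * A (vs[i := v]) + t * A (vs[i := w])) \<and>
     (\<forall>vs\<in>vecs n k. \<forall>i j. i < j \<and> j < k \<and> vs ! i = vs ! j \<longrightarrow> A vs = 0)"

definition euclid_form :: "nat \<Rightarrow> nat \<Rightarrow> vec set \<Rightarrow> (vec \<Rightarrow> vec list \<Rightarrow> real) \<Rightarrow> bool" where
  "euclid_form n k U a \<longleftrightarrow>
     (\<forall>u\<in>U. alternating_form n k (a u)) \<and> (\<forall>vs\<in>vecs n k. smooth_fun n U (\<lambda>u. a u vs))"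

definition euclid_pullback ::
    "(vec \<Rightarrow> vec) \<Rightarrow> (vec \<Rightarrow> vec list \<Rightarrow> real) \<Rightarrow> vec \<Rightarrow> vec list \<Rightarrow> real" where
  "euclid_pullback f a v vs = a (f v) (map (vderiv f v) vs)"

text \<open>Cartan's formula for constant vector fields, whose brackets vanish.\<close>

definition ext_deriv :: "(vec \<Rightarrow> vec list \<Rightarrow> real) \<Rightarrow> vec \<Rightarrow> vec list \<Rightarrow> real" where
  "ext_deriv a u vs =
     (\<Sum>i<length vs. (-1) ^ i * dderiv (\<lambda>y. a y (take i vs @ drop (Suc i) vs)) u (vs ! i))"

section \<open>Manifolds\<close>

type_synonym 'a mchart = "'a set \<times> ('a \<Rightarrow> vec)"

record 'a mfd =
  mtop :: "'a topology"
  mdim :: nat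
  matlas :: "'a mchart set"

abbreviation mpoints :: "'a mfd \<Rightarrow> 'a set" where
  "mpoints M \<equiv> topspace (mtop M)"

abbreviation param :: "'a mchart \<Rightarrow> vec \<Rightarrow> 'a" where
  "param c \<equiv> inv_into (fst c) (snd c)"

definition smooth_manifold :: "'a mfd \<Rightarrow> bool" where
  "smooth_manifold M \<longleftrightarrow>
     Hausdorff_space (mtop M) \<and>
     (\<exists>\<B>. countable \<B> \<and> (\<forall>B\<in>\<B>. openin (mtop M) B) \<and>
          (\<forall>U x. openin (mtop M) U \<and> x \<in> U \<longrightarrow> (\<exists>B\<in>\<B>. x \<in> B \<and> B \<subseteq> U))) \<and>
     (\<Union>c\<in>matlas M. fst c) = mpoints M \<and>
     (\<forall>c\<in>matlas M. openin (mtop M) (fst c) \<and>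
        openin (Euclidean_space (mdim M)) (snd c ` fst c) \<and>
        homeomorphic_map (subtopology (mtop M) (fst c))
          (subtopology (Euclidean_space (mdim M)) (snd c ` fst c)) (snd c)) \<and>
     (\<forall>c\<in>matlas M. \<forall>c'\<in>matlas M. \<forall>i.
        smooth_fun (mdim M) (snd c ` (fst c \<inter> fst c')) (\<lambda>y. snd c' (param c y) i))"

definition smooth_plot :: "'a mfd \<Rightarrow> nat \<Rightarrow> vec set \<Rightarrow> (vec \<Rightarrow> 'a) \<Rightarrow> bool" where
  "smooth_plot M n U P \<longleftrightarrow>
     openin (Euclidean_space n) U \<and> P ` U \<subseteq> mpoints M \<and>
     (\<forall>c\<in>matlas M. openin (Euclidean_space n) {u\<in>U. P u \<in> fst c} \<and>
        (\<forall>i. smooth_fun n {u\<in>U. P u \<in> fst c} (\<lambda>u. snd c (P u) i)))"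

definition smooth_map :: "'a mfd \<Rightarrow> 'b mfd \<Rightarrow> ('a \<Rightarrow> 'b) \<Rightarrow> bool" where
  "smooth_map M N F \<longleftrightarrow>
     (\<forall>c\<in>matlas M. smooth_plot N (mdim M) (snd c ` fst c) (\<lambda>y. F (param c y)))"

definition prod_mfd :: "'a mfd \<Rightarrow> 'b mfd \<Rightarrow> ('a \<times> 'b) mfd" where
  "prod_mfd M N =
     \<lparr>mtop = prod_topology (mtop M) (mtop N), mdim = mdim M + mdim N,
      matlas = {(fst c \<times> fst c',
                 (\<lambda>p i. if i < mdim M then snd c (fst p) i else snd c' (snd p) (i - mdim M)))
                | c c'. c \<in> matlas M \<and> c' \<in> matlas N}\<rparr>"

definition real_mfd :: "real mfd" where
  "real_mfd = \<lparr>mtop = euclideanreal, mdim = 1,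
     matlas = {(UNIV, (\<lambda>t i. if i = 0 then t else 0))}\<rparr>"

text \<open>
  A tangent vector at \<open>x\<close> is the family of its coordinates in the charts at \<open>x\<close>, compatible
  under the differentials of the coordinate changes. It is 0 at all other charts, so that
  equality of tangent vectors is equality of functions.
\<close>

type_synonym 'a tangent = "'a mchart \<Rightarrow> vec"

definition charts_at :: "'a mfd \<Rightarrow> 'a \<Rightarrow> 'a mchart set" where
  "charts_at M x = {c \<in> matlas M. x \<in> fst c}"

definition some_chart :: "'a mfd \<Rightarrow> 'a \<Rightarrow> 'a mchart" where
  "some_chart M x = (SOME c. c \<in> charts_at M x)"

definition tangent_space :: "'a mfd \<Rightarrow> 'a \<Rightarrow> 'a tangent set" where
  "tangent_space M x =
     {v. (\<forall>c. c \<notin> charts_at M x \<longrightarrow> v c = (\<lambda>i. 0)) \<and>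
         (\<forall>c\<in>charts_at M x. v c \<in> Rn (mdim M)) \<and>
         (\<forall>c\<in>charts_at M x. \<forall>c'\<in>charts_at M x.
            v c' = vderiv (\<lambda>y. snd c' (param c y)) (snd c x) (v c))}"

definition tzero :: "'a tangent" where
  "tzero = (\<lambda>c i. 0)"

definition tadd :: "'a tangent \<Rightarrow> 'a tangent \<Rightarrow> 'a tangent" where
  "tadd v w = (\<lambda>c i. v c i + w c i)"

definition tscale :: "real \<Rightarrow> 'a tangent \<Rightarrow> 'a tangent" where
  "tscale s v = (\<lambda>c i. s * v c i)"

definition plot_deriv :: "'a mfd \<Rightarrow> (vec \<Rightarrow> 'a) \<Rightarrow> vec \<Rightarrow> vec \<Rightarrow> 'a tangent" where
  "plot_deriv M P u \<xi> =
     (\<lambda>c. if c \<in> charts_at M (P u) then vderiv (\<lambda>y. snd c (P y)) u \<xi> else (\<lambda>i. 0))"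

definition velocity :: "'a mfd \<Rightarrow> (real \<Rightarrow> 'a) \<Rightarrow> 'a tangent" where
  "velocity M \<gamma> =
     (\<lambda>c. if c \<in> charts_at M (\<gamma> 0) then (\<lambda>i. deriv (\<lambda>t. snd c (\<gamma> t) i) 0) else (\<lambda>i. 0))"

definition tangent_map :: "'a mfd \<Rightarrow> 'b mfd \<Rightarrow> ('a \<Rightarrow> 'b) \<Rightarrow> 'a \<Rightarrow> 'a tangent \<Rightarrow> 'b tangent" where
  "tangent_map M N F x v =
     (let c = some_chart M x in plot_deriv N (\<lambda>y. F (param c y)) (snd c x) (v c))"

subsection \<open>Differential forms on manifolds\<close>

type_synonym 'a mform = "'a \<Rightarrow> 'a tangent list \<Rightarrow> real"

definition plot_pullback :: "'a mfd \<Rightarrow> (vec \<Rightarrow> 'a) \<Rightarrow> 'a mform \<Rightarrow> vec \<Rightarrow> vec list \<Rightarrow> real" where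
  "plot_pullback M P \<omega> u vs = \<omega> (P u) (map (plot_deriv M P u) vs)"

text \<open>
  \<open>plot_pullback M (param c) \<omega>\<close> is the expression of \<open>\<omega>\<close> in the chart \<open>c\<close>. Since \<open>c\<close>
  identifies the tangent spaces over its domain with R^n, requiring it to be a smooth form
  also makes \<open>\<omega>\<close> multilinear and alternating on each tangent space.
\<close>

definition mform :: "'a mfd \<Rightarrow> nat \<Rightarrow> 'a mform \<Rightarrow> bool" where
  "mform M k \<omega> \<longleftrightarrow>
     (\<forall>c\<in>matlas M. euclid_form (mdim M) k (snd c ` fst c) (plot_pullback M (param c) \<omega>))"

definition mext :: "'a mfd \<Rightarrow> 'a mform \<Rightarrow> 'a mform" where
  "mext M \<omega> x vs =
     (let c = some_chart M x
      in ext_deriv (plot_pullback M (param c) \<omega>) (snd c x) (map (\<lambda>v. v c) vs))"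

definition closed_mform :: "'a mfd \<Rightarrow> nat \<Rightarrow> 'a mform \<Rightarrow> bool" where
  "closed_mform M k \<omega> \<longleftrightarrow>
     (\<forall>x\<in>mpoints M. \<forall>vs. length vs = Suc k \<and> set vs \<subseteq> tangent_space M x \<longrightarrow> mext M \<omega> x vs = 0)"

definition symplectic_form :: "'a mfd \<Rightarrow> 'a mform \<Rightarrow> bool" where
  "symplectic_form M \<omega> \<longleftrightarrow>
     mform M 2 \<omega> \<and> closed_mform M 2 \<omega> \<and>
     (\<forall>x\<in>mpoints M. \<forall>v\<in>tangent_space M x.
        (\<forall>w\<in>tangent_space M x. \<omega> x [v, w] = 0) \<longrightarrow> v = tzero)"

text \<open>
  Contact form: \<open>\<theta>\<close> vanishes nowhere and \<open>d\<theta>\<close> is nondegenerate on the hyperplanes \<open>ker \<theta>\<close>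
  (so the dimension is odd).
\<close>

definition contact_form :: "'a mfd \<Rightarrow> 'a mform \<Rightarrow> bool" where
  "contact_form M \<theta> \<longleftrightarrow>
     mform M 1 \<theta> \<and>
     (\<forall>x\<in>mpoints M.
        (\<exists>v\<in>tangent_space M x. \<theta> x [v] \<noteq> 0) \<and>
        (\<forall>v\<in>tangent_space M x. \<theta> x [v] = 0 \<and>
           (\<forall>w\<in>tangent_space M x. \<theta> x [w] = 0 \<longrightarrow> mext M \<theta> x [v, w] = 0) \<longrightarrow> v = tzero))"

definition is_reeb_field :: "'a mfd \<Rightarrow> 'a mform \<Rightarrow> ('a \<Rightarrow> 'a tangent) \<Rightarrow> bool" where
  "is_reeb_field M \<theta> R \<longleftrightarrow>
     (\<forall>x\<in>mpoints M. R x \<in> tangent_space M x \<and> \<theta> x [R x] = 1 \<and>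
        (\<forall>w\<in>tangent_space M x. mext M \<theta> x [R x, w] = 0))"

section \<open>Lie groups and their actions\<close>

definition lie_group :: "'g monoid \<Rightarrow> 'g mfd \<Rightarrow> bool" where
  "lie_group G M \<longleftrightarrow>
     group G \<and> carrier G = mpoints M \<and> smooth_manifold M \<and>
     smooth_map (prod_mfd M M) M (\<lambda>p. fst p \<otimes>\<^bsub>G\<^esub> snd p) \<and>
     smooth_map M M (\<lambda>g. inv\<^bsub>G\<^esub> g)"

definition lie_algebra :: "'g monoid \<Rightarrow> 'g mfd \<Rightarrow> 'g tangent set" where
  "lie_algebra G M = tangent_space M \<one>\<^bsub>G\<^esub>"

definition one_param_subgroup :: "'g monoid \<Rightarrow> 'g mfd \<Rightarrow> (real \<Rightarrow> 'g) \<Rightarrow> bool" where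
  "one_param_subgroup G M \<gamma> \<longleftrightarrow>
     smooth_map real_mfd M \<gamma> \<and> (\<forall>s t. \<gamma> (s + t) = \<gamma> s \<otimes>\<^bsub>G\<^esub> \<gamma> t)"

definition lie_exp :: "'g monoid \<Rightarrow> 'g mfd \<Rightarrow> 'g tangent \<Rightarrow> 'g" where
  "lie_exp G M Z = (THE \<gamma>. one_param_subgroup G M \<gamma> \<and> velocity M \<gamma> = Z) 1"

definition Ad :: "'g monoid \<Rightarrow> 'g mfd \<Rightarrow> 'g \<Rightarrow> 'g tangent \<Rightarrow> 'g tangent" where
  "Ad G M g Z = tangent_map M M (\<lambda>h. g \<otimes>\<^bsub>G\<^esub> h \<otimes>\<^bsub>G\<^esub> inv\<^bsub>G\<^esub> g) \<one>\<^bsub>G\<^esub> Z"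

text \<open>The dual of the Lie algebra: equality of two elements means equality on the Lie algebra.\<close>

definition lie_dual :: "'g monoid \<Rightarrow> 'g mfd \<Rightarrow> ('g tangent \<Rightarrow> real) set" where
  "lie_dual G M =
     {\<mu>. (\<forall>Z\<in>lie_algebra G M. \<forall>W\<in>lie_algebra G M. \<mu> (tadd Z W) = \<mu> Z + \<mu> W) \<and>
         (\<forall>s. \<forall>Z\<in>lie_algebra G M. \<mu> (tscale s Z) = s * \<mu> Z)}"

definition Ad_star :: "'g monoid \<Rightarrow> 'g mfd \<Rightarrow> 'g \<Rightarrow> ('g tangent \<Rightarrow> real) \<Rightarrow> 'g tangent \<Rightarrow> real" where
  "Ad_star G M g \<mu> Z = \<mu> (Ad G M (inv\<^bsub>G\<^esub> g) Z)"

definition smooth_action ::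
    "'g monoid \<Rightarrow> 'g mfd \<Rightarrow> 'x mfd \<Rightarrow> ('g \<Rightarrow> 'x \<Rightarrow> 'x) \<Rightarrow> bool" where
  "smooth_action G M X a \<longleftrightarrow>
     group_action G (mpoints X) a \<and> smooth_map (prod_mfd M X) X (\<lambda>p. a (fst p) (snd p))"

definition inf_gen ::
    "'g monoid \<Rightarrow> 'g mfd \<Rightarrow> 'x mfd \<Rightarrow> ('g \<Rightarrow> 'x \<Rightarrow> 'x) \<Rightarrow> 'g tangent \<Rightarrow> 'x \<Rightarrow> 'x tangent" where
  "inf_gen G M X a Z x = velocity X (\<lambda>t. a (lie_exp G M (tscale t Z)) x)"

definition stabilizer_algebra ::
    "'g monoid \<Rightarrow> 'g mfd \<Rightarrow> ('g \<Rightarrow> 'x \<Rightarrow> 'x) \<Rightarrow> 'x \<Rightarrow> 'g tangent set" where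
  "stabilizer_algebra G M a x =
     {Z \<in> lie_algebra G M. \<forall>t. lie_exp G M (tscale t Z) \<in> stabilizer G a x}"

definition locally_free_on ::
    "'g monoid \<Rightarrow> 'g mfd \<Rightarrow> ('g \<Rightarrow> 'x \<Rightarrow> 'x) \<Rightarrow> 'x set \<Rightarrow> bool" where
  "locally_free_on G M a C \<longleftrightarrow> (\<forall>x\<in>C. stabilizer_algebra G M a x = {tzero})"

definition invariant_form ::
    "'g monoid \<Rightarrow> 'x mfd \<Rightarrow> ('g \<Rightarrow> 'x \<Rightarrow> 'x) \<Rightarrow> nat \<Rightarrow> 'x mform \<Rightarrow> bool" where
  "invariant_form G X a k \<omega> \<longleftrightarrow>
     (\<forall>g\<in>carrier G. \<forall>x\<in>mpoints X. \<forall>vs. length vs = k \<and> set vs \<subseteq> tangent_space X x \<longrightarrow>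
        \<omega> (a g x) (map (tangent_map X X (a g) x) vs) = \<omega> x vs)"

definition zero_level ::
    "'g monoid \<Rightarrow> 'g mfd \<Rightarrow> 'x mfd \<Rightarrow> ('x \<Rightarrow> 'g tangent \<Rightarrow> real) \<Rightarrow> 'x set" where
  "zero_level G M X \<Phi> = {x \<in> mpoints X. \<forall>Z\<in>lie_algebra G M. \<Phi> x Z = 0}"

subsection \<open>Hamiltonian and prequantum spaces\<close>

text \<open>
  The functions \<open>\<Phi>(\<cdot>) Z\<close> are fed to \<^const>\<open>mform\<close> and \<^const>\<open>mext\<close> as 0-forms.
\<close>

definition moment_map ::
    "'g monoid \<Rightarrow> 'g mfd \<Rightarrow> 'x mfd \<Rightarrow> ('g \<Rightarrow> 'x \<Rightarrow> 'x) \<Rightarrow> 'x mform \<Rightarrow>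
     ('x \<Rightarrow> 'g tangent \<Rightarrow> real) \<Rightarrow> bool" where
  "moment_map G M X a \<omega> \<Phi> \<longleftrightarrow>
     (\<forall>x\<in>mpoints X. \<Phi> x \<in> lie_dual G M) \<and>
     (\<forall>Z\<in>lie_algebra G M. mform X 0 (\<lambda>x _. \<Phi> x Z)) \<and>
     (\<forall>g\<in>carrier G. \<forall>x\<in>mpoints X. \<forall>Z\<in>lie_algebra G M.
        \<Phi> (a g x) Z = Ad_star G M g (\<Phi> x) Z) \<and>
     (\<forall>Z\<in>lie_algebra G M. \<forall>x\<in>mpoints X. \<forall>w\<in>tangent_space X x.
        \<omega> x [inf_gen G M X a Z x, w] = - mext X (\<lambda>y _. \<Phi> y Z) x [w])"

definition hamiltonian_space ::
    "'g monoid \<Rightarrow> 'g mfd \<Rightarrow> 'x mfd \<Rightarrow> ('g \<Rightarrow> 'x \<Rightarrow> 'x) \<Rightarrow> 'x mform \<Rightarrow>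
     ('x \<Rightarrow> 'g tangent \<Rightarrow> real) \<Rightarrow> bool" where
  "hamiltonian_space G M X a \<omega> \<Phi> \<longleftrightarrow>
     smooth_manifold X \<and> smooth_action G M X a \<and>
     symplectic_form X \<omega> \<and> invariant_form G X a 2 \<omega> \<and> moment_map G M X a \<omega> \<Phi>"

definition circle_group :: "complex monoid" where
  "circle_group = \<lparr>carrier = sphere 0 1, mult = (*), one = 1\<rparr>"

definition circle_mfd :: "complex mfd" where
  "circle_mfd = \<lparr>mtop = top_of_set (sphere 0 1), mdim = 1,
     matlas = {(sphere 0 1 - {- w}, (\<lambda>z i. if i = 0 then Arg (z / w) else 0)) | w.
               w \<in> sphere 0 1}\<rparr>"

definition free_action :: "'g monoid \<Rightarrow> 'x set \<Rightarrow> ('g \<Rightarrow> 'x \<Rightarrow> 'x) \<Rightarrow> bool" where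
  "free_action G E a \<longleftrightarrow> (\<forall>x\<in>E. stabilizer G a x = {\<one>\<^bsub>G\<^esub>})"

text \<open>
  The Reeb field generates the circle action with the normalization that \<open>cis t\<close> acts as its
  flow at time \<open>t\<close>, i.e. with period \<open>2 * pi\<close>.
\<close>

definition prequantum_space ::
    "'g monoid \<Rightarrow> 'g mfd \<Rightarrow> 'x mfd \<Rightarrow> ('g \<Rightarrow> 'x \<Rightarrow> 'x) \<Rightarrow> 'x mform \<Rightarrow> bool" where
  "prequantum_space G M X a \<theta> \<longleftrightarrow>
     smooth_manifold X \<and> smooth_action G M X a \<and>
     contact_form X \<theta> \<and> invariant_form G X a 1 \<theta> \<and>
     (\<exists>\<rho>. smooth_action circle_group circle_mfd X \<rho> \<and>
          free_action circle_group (mpoints X) \<rho> \<and>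
          is_reeb_field X \<theta> (\<lambda>x. velocity X (\<lambda>t. \<rho> (cis t) x)))"

definition contact_moment ::
    "'g monoid \<Rightarrow> 'g mfd \<Rightarrow> 'x mfd \<Rightarrow> ('g \<Rightarrow> 'x \<Rightarrow> 'x) \<Rightarrow> 'x mform \<Rightarrow> 'x \<Rightarrow> 'g tangent \<Rightarrow> real" where
  "contact_moment G M X a \<theta> x Z = \<theta> x [inf_gen G M X a Z x]"

section \<open>Diffeology\<close>

text \<open>
  A diffeology is given by its plots: \<open>D n U P\<close> says that \<open>P\<close>, restricted to the open set
  \<open>U\<close> of R^n, is a plot. Values of \<open>P\<close> outside \<open>U\<close> are irrelevant.
\<close>

type_synonym 'a diffeology = "nat \<Rightarrow> vec set \<Rightarrow> (vec \<Rightarrow> 'a) \<Rightarrow> bool"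

type_synonym 'a diff_form = "nat \<Rightarrow> vec set \<Rightarrow> (vec \<Rightarrow> 'a) \<Rightarrow> vec \<Rightarrow> vec list \<Rightarrow> real"

text \<open>The diffeology of a manifold \<open>M\<close> is \<^const>\<open>smooth_plot\<close> \<open>M\<close>.\<close>

definition subset_diffeology :: "'a diffeology \<Rightarrow> 'a set \<Rightarrow> 'a diffeology" where
  "subset_diffeology D C n U P \<longleftrightarrow> D n U P \<and> P ` U \<subseteq> C"

text \<open>Pushforward along \<open>\<pi>\<close>: plots are the maps that lift locally to plots upstairs.\<close>

definition quotient_diffeology :: "'a diffeology \<Rightarrow> ('a \<Rightarrow> 'b) \<Rightarrow> 'b diffeology" where
  "quotient_diffeology D \<pi> n U P \<longleftrightarrow>
     openin (Euclidean_space n) U \<and>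
     (\<forall>u\<in>U. \<exists>V Q. openin (Euclidean_space n) V \<and> u \<in> V \<and> V \<subseteq> U \<and> D n V Q \<and>
        (\<forall>v\<in>V. P v = \<pi> (Q v)))"

text \<open>
  In the compatibility condition \<open>Q\<close> is \<open>P \<circ> f\<close> up to irrelevant values outside \<open>V\<close>.
\<close>

definition diffeological_form :: "'a diffeology \<Rightarrow> nat \<Rightarrow> 'a diff_form \<Rightarrow> bool" where
  "diffeological_form D k \<alpha> \<longleftrightarrow>
     (\<forall>n U P. D n U P \<longrightarrow> euclid_form n k U (\<alpha> n U P)) \<and>
     (\<forall>n U P m V f Q. D n U P \<and> euclid_smooth_map m V n U f \<and> (\<forall>v\<in>V. Q v = P (f v)) \<longrightarrow>
        (\<forall>v\<in>V. \<forall>vs\<in>vecs m k. \<alpha> m V Q v vs = euclid_pullback f (\<alpha> n U P) v vs))"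

definition eq_diff_form :: "'a diffeology \<Rightarrow> nat \<Rightarrow> 'a diff_form \<Rightarrow> 'a diff_form \<Rightarrow> bool" where
  "eq_diff_form D k \<alpha> \<beta> \<longleftrightarrow>
     (\<forall>n U P. D n U P \<longrightarrow> (\<forall>u\<in>U. \<forall>vs\<in>vecs n k. \<alpha> n U P u vs = \<beta> n U P u vs))"

definition diff_pullback :: "('a \<Rightarrow> 'b) \<Rightarrow> 'b diff_form \<Rightarrow> 'a diff_form" where
  "diff_pullback h \<alpha> n U P = \<alpha> n U (h \<circ> P)"

definition diff_form_of :: "'a mfd \<Rightarrow> 'a mform \<Rightarrow> 'a diff_form" where
  "diff_form_of M \<omega> n U P = plot_pullback M P \<omega>"

text \<open>
  The reduced space is \<open>C/G\<close>, a set of orbits. The inclusion \<open>j\<close> of \<open>C\<close> is the identity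
  on \<open>C\<close>, hence \<^const>\<open>id\<close>.
\<close>

definition reduced_diffeology ::
    "'g monoid \<Rightarrow> 'x mfd \<Rightarrow> ('g \<Rightarrow> 'x \<Rightarrow> 'x) \<Rightarrow> 'x set \<Rightarrow> 'x set diffeology" where
  "reduced_diffeology G X a C =
     quotient_diffeology (subset_diffeology (smooth_plot X) C) (orbit G a)"

definition carries_reduced_form ::
    "'g monoid \<Rightarrow> 'x mfd \<Rightarrow> ('g \<Rightarrow> 'x \<Rightarrow> 'x) \<Rightarrow> 'x set \<Rightarrow> nat \<Rightarrow> 'x mform \<Rightarrow> bool" where
  "carries_reduced_form G X a C k \<omega> \<longleftrightarrow>
     (\<exists>\<alpha>. diffeological_form (reduced_diffeology G X a C) k \<alpha> \<and>
          eq_diff_form (subset_diffeology (smooth_plot X) C) k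
            (diff_pullback id (diff_form_of X \<omega>)) (diff_pullback (orbit G a) \<alpha>))"

end

theory Submission
  imports Defs
begin

text \<open>
  Two plots \<open>P\<close>, \<open>Q\<close> of the zero level with the same orbits must pull the form back to the same
  form. Write \<open>Q u = g u \<cdot> P u\<close>, where \<open>g\<close> may be discontinuous. Local freeness makes the
  solutions \<open>g\<close> over a fixed \<open>u\<close> isolated, so Baire's theorem, applied to countably many compact
  subsets of \<open>G\<close>, gives a dense set of points \<open>u\<close> at which \<open>g\<close> may be chosen continuous. There,
  injectivity of the infinitesimal action turns difference quotients into
  \<open>Q\<^sub>* v = (g \<cdot> P)\<^sub>* v + Z\<^sub>X\<close> for some \<open>Z\<close> in the Lie algebra. The generators \<open>Z\<^sub>X\<close> contribute nothing,
  because the moment map vanishes along both plots, and invariance gives equality at \<open>u\<close>; by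
  continuity it holds everywhere. Relating \<^const>\<open>lie_exp\<close> to the infinitesimal action requires the
  existence of one-parameter subgroups, which comes from Picard iteration in a chart.
\<close>

section \<open>Calculus on open subsets of Euclidean spaces\<close>

text \<open>Smooth P and Q with the same orbits need not be related by a continuous g, even locally.
  With discrete but nontrivial stabilizers g may be forced to jump: let the sign group act on the
  line, let f be positive except for a flat zero at 0, and compare f(u) with the function that is
  f(u) for u > 0 and -f(u) for u < 0.

  Where g is continuous at the single point u, it still cannot be differentiated. Instead, pairs (k,
  t) that solve the equation on the line through u in direction v, with k close to the identity,
  accumulate at (1, 0), and compactness extracts a limit direction of these solutions. The resulting
  Z depends on v. This suffices, because a form is evaluated on finitely many vectors, each of which
  can be decomposed separately.

  \<open>lie_exp\<close> is a definite description, so \<open>stabilizer_algebra\<close> and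
  \<open>inf_gen\<close> carry information only once one-parameter subgroups are known both to exist
  and to be unique. The level set C is handled only through plots of X with values in C.\<close>

lemma Euclidean_space_eu: "Euclidean_space n = top_of_set {x. \<forall>i\<ge>n. x i = 0}"
  by (simp add: Euclidean_space_def euclidean_product_topology)

lemma Rn_iff: "x \<in> Rn n \<longleftrightarrow> (\<forall>i\<ge>n. x i = 0)"
  by (simp add: topspace_Euclidean_space)

lemma Rn_add: "x \<in> Rn n \<Longrightarrow> v \<in> Rn n \<Longrightarrow> (\<lambda>i. x i + t * v i) \<in> Rn n"
  by (simp add: Rn_iff)

lemma basis_vec_Rn: "i < n \<Longrightarrow> basis_vec i \<in> Rn n"
  by (auto simp: Rn_iff basis_vec_def)

lemma openin_Rn_subset: "openin (Euclidean_space n) U \<Longrightarrow> x \<in> U \<Longrightarrow> x \<in> Rn n"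
  by (meson openin_subset subsetD)

lemma openin_Rn_trans: "openin (Euclidean_space n) U \<Longrightarrow> openin (top_of_set U) W \<Longrightarrow> openin (Euclidean_space n) W"
  unfolding Euclidean_space_eu by (rule openin_trans)

text \<open>Kept abstract in P so that it can be nested, for radii uniform in two indices. Induction
  instead of a minimum over a finite set makes n = 0 harmless: any radius will do there.\<close>

lemma common_delta:
  fixes P :: "nat \<Rightarrow> real \<Rightarrow> bool"
  assumes "\<And>i. i < n \<Longrightarrow> \<exists>d>0. P i d" and mono: "\<And>i d d'. P i d \<Longrightarrow> 0 < d' \<Longrightarrow> d' \<le> d \<Longrightarrow> P i d'"
  shows "\<exists>d>0. \<forall>i<n. P i d"
  using assms(1)
proof (induction n)
  case 0
  then show ?case by (auto intro: exI[of _ 1])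
next
  case (Suc n)
  then obtain d where d: "d > 0" "\<forall>i<n. P i d" by auto
  from Suc(2)[of n] obtain e where e: "e > 0" "P n e" by auto
  have "\<forall>i<Suc n. P i (min d e)"
    using d e mono by (metis less_Suc_eq min.cobounded1 min.cobounded2 min_less_iff_conj)
  then show ?case using d e by (intro exI[of _ "min d e"]) auto
qed

text \<open>Only coordinates below n constrain y: from n on both points vanish, so the factors of a
  basic open set contain the coordinates of y because they contain those of x. Boxes like this one
  stand in for balls throughout.\<close>

lemma openin_Rn_box:
  assumes "openin (Euclidean_space n) U" "x \<in> U"
  obtains \<delta> where "\<delta> > 0" "\<And>y. y \<in> Rn n \<Longrightarrow> (\<And>i. i < n \<Longrightarrow> \<bar>y i - x i\<bar> < \<delta>) \<Longrightarrow> y \<in> U"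
proof -
  obtain T where T: "openin (powertop_real UNIV) T" "U = T \<inter> Rn n"
    using assms(1) by (auto simp: Euclidean_space_def openin_subtopology topspace_Euclidean_space)
  with assms obtain X where X: "x \<in> Pi\<^sub>E UNIV X" "\<And>i. openin euclideanreal (X i)" "Pi\<^sub>E UNIV X \<subseteq> T"
    using product_topology_open_contains_basis[OF T(1)] by blast
  have xR: "x \<in> Rn n" using T assms by auto
  have "\<exists>d>0. \<forall>i<n. ball (x i) d \<subseteq> X i"
  proof (rule common_delta)
    fix i
    have "open (X i)" "x i \<in> X i" using X by auto
    then show "\<exists>d>0. ball (x i) d \<subseteq> X i" by (meson open_contains_ball_eq)
  next
    fix i and d d' :: real
    assume "ball (x i) d \<subseteq> X i" "d' \<le> d"
    then show "ball (x i) d' \<subseteq> X i" by (meson subset_ball subset_trans)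
  qed
  then obtain d where d: "d > 0" "\<forall>i<n. ball (x i) d \<subseteq> X i" by blast
  show thesis
  proof (rule that[OF d(1)])
    fix y assume y: "y \<in> Rn n" "\<And>i. i < n \<Longrightarrow> \<bar>y i - x i\<bar> < d"
    have "y i \<in> X i" for i
    proof (cases "i < n")
      case True
      then show ?thesis using d(2) y(2)[of i] by (force simp: dist_real_def)
    next
      case False
      then have "y i = x i" using xR y by (simp add: Rn_iff)
      then show ?thesis using X(1) by auto
    qed
    then show "y \<in> U" using X T y by auto
  qed
qed

lemma continuous_on_Rn_box:
  fixes f :: "vec \<Rightarrow> real"
  assumes "openin (Euclidean_space n) U" "x \<in> U" "continuous_on U f" "e > 0"
  obtains \<delta> where "\<delta> > 0"
    "\<And>y. y \<in> Rn n \<Longrightarrow> (\<And>i. i < n \<Longrightarrow> \<bar>y i - x i\<bar> < \<delta>) \<Longrightarrow> y \<in> U \<and> \<bar>f y - f x\<bar> < e"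
proof -
  have "openin (top_of_set U) (U \<inter> f -` ball (f x) e)"
    using assms(3) by (intro continuous_openin_preimage_gen) auto
  then have *: "openin (Euclidean_space n) (U \<inter> f -` ball (f x) e)"
    using assms(1) openin_Rn_trans by blast
  have "x \<in> U \<inter> f -` ball (f x) e" using assms by auto
  then show thesis
    using openin_Rn_box[OF *] that
    by (smt (verit) IntD1 IntD2 dist_commute dist_real_def mem_ball vimage_eq)
qed

text \<open>Asks for continuity at t0 only, so that it applies to curves of which little is known at
  other times.\<close>

lemma openin_Rn_curve:
  assumes "openin (Euclidean_space n) U" "\<eta> t0 \<in> U"
    and "\<forall>\<^sub>F t in at t0. \<eta> t \<in> Rn n" and "\<And>i. i < n \<Longrightarrow> isCont (\<lambda>t. \<eta> t i) t0"
  shows "\<forall>\<^sub>F t in nhds t0. \<eta> t \<in> U"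
proof -
  obtain d where d: "d > 0" "\<And>y. y \<in> Rn n \<Longrightarrow> (\<And>i. i < n \<Longrightarrow> \<bar>y i - \<eta> t0 i\<bar> < d) \<Longrightarrow> y \<in> U"
    using openin_Rn_box[OF assms(1,2)] by blast
  have "\<forall>\<^sub>F t in at t0. \<bar>\<eta> t i - \<eta> t0 i\<bar> < d" if "i < n" for i
    using assms(4)[OF that] d(1) unfolding isCont_def tendsto_iff dist_real_def by blast
  then have "\<forall>\<^sub>F t in at t0. \<forall>i\<in>{..<n}. \<bar>\<eta> t i - \<eta> t0 i\<bar> < d"
    by (intro eventually_ball_finite) auto
  with assms(3) have "\<forall>\<^sub>F t in at t0. \<eta> t \<in> U"
    by eventually_elim (use d in auto)
  then show ?thesis
    using assms(2) by (auto simp: eventually_nhds_conv_at)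
qed

lemma openin_Rn_line:
  assumes "openin (Euclidean_space n) U" "x \<in> U" "v \<in> Rn n"
  shows "\<forall>\<^sub>F t in nhds 0. (\<lambda>i. x i + t * v i) \<in> U"
proof (rule openin_Rn_curve[OF assms(1)])
  show "\<forall>\<^sub>F t in at 0. (\<lambda>i. x i + t * v i) \<in> Rn n"
    using assms openin_Rn_subset[OF assms(1)] by (auto simp: Rn_add)
qed (use assms in \<open>auto intro!: continuous_intros\<close>)

lemma dderiv_cong:
  assumes "openin (Euclidean_space n) U" "x \<in> U" "v \<in> Rn n" "\<And>y. y \<in> U \<Longrightarrow> f y = g y"
  shows "dderiv f x v = dderiv g x v"
  unfolding dderiv_def
  by (rule deriv_cong_ev) (use openin_Rn_line[OF assms(1-3)] assms(4) in \<open>auto elim: eventually_mono\<close>)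

lemma line_differentiable_cong:
  assumes "openin (Euclidean_space n) U" "x \<in> U" "v \<in> Rn n" "\<And>y. y \<in> U \<Longrightarrow> f y = g y"
  shows "((\<lambda>t. f (\<lambda>j. x j + t * v j)) has_real_derivative D) (at 0) \<longleftrightarrow>
         ((\<lambda>t. g (\<lambda>j. x j + t * v j)) has_real_derivative D) (at 0)"
  by (rule DERIV_cong_ev) (use openin_Rn_line[OF assms(1-3)] assms(4) in \<open>auto elim: eventually_mono\<close>)

section \<open>C^k functions: locality, algebra, chain rule\<close>

lemma Ck_cong:
  assumes "openin (Euclidean_space n) U" "\<And>x. x \<in> U \<Longrightarrow> f x = g x"
  shows "Ck k n U f \<longleftrightarrow> Ck k n U g"
  using assms(2)
proof (induction k arbitrary: f g)
  case 0
  then show ?case by (simp cong: continuous_on_cong)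
next
  case (Suc k)
  have 1: "continuous_on U f \<longleftrightarrow> continuous_on U g" using Suc(2) by (simp cong: continuous_on_cong)
  have 2: "(\<lambda>t. f (\<lambda>j. x j + t * basis_vec i j)) differentiable (at 0) \<longleftrightarrow>
      (\<lambda>t. g (\<lambda>j. x j + t * basis_vec i j)) differentiable (at 0)" if "i < n" "x \<in> U" for x i
    unfolding real_differentiable_def
    by (intro iff_exI line_differentiable_cong[OF assms(1) that(2) basis_vec_Rn[OF that(1)]] Suc(2))
  have 3: "Ck k n U (\<lambda>x. dderiv f x (basis_vec i)) \<longleftrightarrow> Ck k n U (\<lambda>x. dderiv g x (basis_vec i))"
    if "i < n" for i
    by (intro Suc.IH dderiv_cong[OF assms(1) _ basis_vec_Rn[OF that]] Suc(2))
  show ?case using 1 2 3 by simp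
qed

lemma Ck_subset: "Ck k n U f \<Longrightarrow> V \<subseteq> U \<Longrightarrow> Ck k n V f"
proof (induction k arbitrary: f)
  case 0
  then show ?case using continuous_on_subset by auto
next
  case (Suc k)
  then show ?case using continuous_on_subset by (auto simp: subset_iff)
qed

lemma Ck_pred: "Ck (Suc k) n U f \<Longrightarrow> Ck k n U f"
  by (induction k arbitrary: f) auto

lemma Ck_continuous: "Ck k n U f \<Longrightarrow> continuous_on U f"
  by (cases k) auto

lemma Ck_local:
  assumes "openin (Euclidean_space n) U"
    "\<And>x. x \<in> U \<Longrightarrow> \<exists>V. openin (Euclidean_space n) V \<and> x \<in> V \<and> V \<subseteq> U \<and> Ck k n V f"
  shows "Ck k n U f"
  using assms(2)
proof (induction k arbitrary: f)
  case 0
  have "continuous (at x within U) f" if "x \<in> U" for x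
  proof -
    obtain V where V: "openin (Euclidean_space n) V" "x \<in> V" "V \<subseteq> U" "continuous_on V f"
      using 0 \<open>x \<in> U\<close> by auto
    from V(1) obtain T where T: "open T" "V = T \<inter> Rn n"
      by (auto simp: Euclidean_space_eu openin_open)
    have UR: "U \<subseteq> Rn n" using assms(1) openin_subset by blast
    have "V = T \<inter> U" using T V(3) UR by auto
    \<comment> \<open>Near x the open set T cuts V out of U, so both filters agree and continuity
      passes from V to U.\<close>
    then have "(at x within U) = (at x within V)"
      by (intro at_within_nhd[OF _ T(1)]) (use V T in auto)
    then show ?thesis using V continuous_on_eq_continuous_within by fastforce
  qed
  then show ?case by (simp add: continuous_on_eq_continuous_within)
next
  case (Suc k)
  have "Ck k n U f"
  proof (rule Suc.IH)
    fix x assume "x \<in> U"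
    then show "\<exists>V. openin (Euclidean_space n) V \<and> x \<in> V \<and> V \<subseteq> U \<and> Ck k n V f"
      using Suc(2)[of x] Ck_pred[of k n _ f] by metis
  qed
  then have 0: "continuous_on U f" by (rule Ck_continuous)
  have 1: "Ck k n U (\<lambda>x. dderiv f x (basis_vec i))" if "i < n" for i
  proof (rule Suc.IH)
    fix x assume "x \<in> U"
    then obtain V where "openin (Euclidean_space n) V" "x \<in> V" "V \<subseteq> U" "Ck (Suc k) n V f"
      using Suc(2) by metis
    then show "\<exists>V. openin (Euclidean_space n) V \<and> x \<in> V \<and> V \<subseteq> U \<and>
        Ck k n V (\<lambda>x. dderiv f x (basis_vec i))"
      using that by auto
  qed
  have 2: "(\<lambda>t. f (\<lambda>j. x j + t * basis_vec i j)) differentiable (at 0)" if "i < n" "x \<in> U" for i x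
    using Suc(2)[OF that(2)] that(1) by auto
  from 0 1 2 show ?case by simp
qed

text \<open>\<open>Ck\<close> is phrased with \<open>dderiv\<close>. Here a closed form D may be
  supplied for the partial derivatives, and \<open>dderiv\<close> equals it by uniqueness of
  derivatives. The closure properties below rest on this rule.\<close>

lemma Ck_SucI:
  assumes "continuous_on U f" "openin (Euclidean_space n) U"
    and "\<And>i x. i < n \<Longrightarrow> x \<in> U \<Longrightarrow> ((\<lambda>t. f (\<lambda>j. x j + t * basis_vec i j)) has_real_derivative D i x) (at 0)"
    and "\<And>i. i < n \<Longrightarrow> Ck k n U (D i)"
  shows "Ck (Suc k) n U f"
proof -
  have "dderiv f x (basis_vec i) = D i x" if "i < n" "x \<in> U" for i x
    unfolding dderiv_def by (rule DERIV_imp_deriv[OF assms(3)[OF that]])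
  then have "Ck k n U (\<lambda>x. dderiv f x (basis_vec i)) \<longleftrightarrow> Ck k n U (D i)" if "i < n" for i
    using that by (intro Ck_cong assms(2))
  then have 1: "Ck k n U (\<lambda>x. dderiv f x (basis_vec i))" if "i < n" for i
    using assms(4) that by blast
  have 2: "(\<lambda>t. f (\<lambda>j. x j + t * basis_vec i j)) differentiable (at 0)" if "i < n" "x \<in> U" for i x
    unfolding real_differentiable_def using assms(3)[OF that] by (rule exI)
  show ?thesis unfolding Ck.simps(2)
    by (intro conjI allI impI ballI 1 2 assms(1))
qed

lemma Ck_partial_DERIV:
  assumes "Ck (Suc k) n U f" "i < n" "x \<in> U"
  shows "((\<lambda>t. f (\<lambda>j. x j + t * basis_vec i j)) has_real_derivative dderiv f x (basis_vec i)) (at 0)"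
proof -
  have "(\<lambda>t. f (\<lambda>j. x j + t * basis_vec i j)) differentiable (at 0)" using assms by simp
  then show ?thesis unfolding dderiv_def by (simp add: DERIV_deriv_iff_real_differentiable)
qed

lemma Ck_const: assumes "openin (Euclidean_space n) U" shows "Ck k n U (\<lambda>x. c)"
proof (induction k arbitrary: c)
  case (Suc k)
  show ?case by (rule Ck_SucI[OF _ assms, where D="\<lambda>i x. 0"]) (simp_all add: Suc)
qed simp

lemma continuous_on_coord: "continuous_on U (\<lambda>x::vec. x i)"
  by (rule continuous_on_subset[OF continuous_on_product_coordinates subset_UNIV])

lemma Ck_coord: assumes "openin (Euclidean_space n) U" shows "Ck k n U (\<lambda>x. x i)"
proof (cases k)
  case 0
  then show ?thesis by (simp add: continuous_on_coord)
next
  case (Suc k')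
  show ?thesis unfolding Suc
  proof (rule Ck_SucI[OF continuous_on_coord assms, where D="\<lambda>l x. basis_vec l i"])
    show "((\<lambda>t. x i + t * basis_vec l i) has_real_derivative basis_vec l i) (at 0)" for x l
      by (auto intro!: derivative_eq_intros)
  qed (rule Ck_const[OF assms])
qed

lemma Ck_add:
  assumes "openin (Euclidean_space n) U" "Ck k n U f" "Ck k n U g"
  shows "Ck k n U (\<lambda>x. f x + g x)"
  using assms(2,3)
proof (induction k arbitrary: f g)
  case (Suc k)
  show ?case
  proof (rule Ck_SucI[OF _ assms(1)])
    show "continuous_on U (\<lambda>x. f x + g x)"
      using Suc(2,3)[THEN Ck_continuous] by (intro continuous_intros)
    show "((\<lambda>t. f (\<lambda>j. x j + t * basis_vec i j) + g (\<lambda>j. x j + t * basis_vec i j)) has_real_derivative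
        dderiv f x (basis_vec i) + dderiv g x (basis_vec i)) (at 0)" if "i < n" "x \<in> U" for i x
      using Suc(2,3) that by (intro DERIV_add Ck_partial_DERIV)
    show "Ck k n U (\<lambda>x. dderiv f x (basis_vec i) + dderiv g x (basis_vec i))" if "i < n" for i
      using Suc(2,3) that by (intro Suc.IH) simp_all
  qed
qed (simp add: continuous_on_add continuous_on_mult)

lemma Ck_mult:
  assumes "openin (Euclidean_space n) U" "Ck k n U f" "Ck k n U g"
  shows "Ck k n U (\<lambda>x. f x * g x)"
  using assms(2,3)
proof (induction k arbitrary: f g)
  case (Suc k)
  show ?case
  proof (rule Ck_SucI[OF _ assms(1)])
    show "continuous_on U (\<lambda>x. f x * g x)"
      using Suc(2,3)[THEN Ck_continuous] by (intro continuous_intros)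
    show "((\<lambda>t. f (\<lambda>j. x j + t * basis_vec i j) * g (\<lambda>j. x j + t * basis_vec i j)) has_real_derivative
        dderiv f x (basis_vec i) * g x + dderiv g x (basis_vec i) * f x) (at 0)" if "i < n" "x \<in> U" for i x
      using DERIV_mult[OF Ck_partial_DERIV[OF Suc(2) that] Ck_partial_DERIV[OF Suc(3) that]] by simp
    show "Ck k n U (\<lambda>x. dderiv f x (basis_vec i) * g x + dderiv g x (basis_vec i) * f x)" if "i < n" for i
      using Suc(2,3) that Ck_pred[OF Suc(2)] Ck_pred[OF Suc(3)] by (intro Ck_add[OF assms(1)] Suc.IH) simp_all
  qed
qed (simp add: continuous_on_add continuous_on_mult)

lemma Ck_sum:
  assumes "openin (Euclidean_space n) U" "\<And>i. i \<in> I \<Longrightarrow> Ck k n U (f i)"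
  shows "Ck k n U (\<lambda>x. \<Sum>i\<in>I. f i x)"
  using assms(2)
  by (induction I rule: infinite_finite_induct) (use Ck_const[OF assms(1)] Ck_add[OF assms(1)] in auto)

text \<open>Move from x to y one coordinate at a time. On each edge the mean value inequality is
  applied to f minus its linear part at x; the derivative there is the oscillation of one partial
  derivative, at most e near x by continuity. Distance is the sum of absolute values.\<close>

lemma Ck1_total_derivative:
  assumes U: "openin (Euclidean_space n) U" and f: "Ck (Suc k) n U f" and x: "x \<in> U" and e: "e > 0"
  obtains \<delta> where "\<delta> > 0"
    "\<And>y. y \<in> Rn n \<Longrightarrow> (\<And>i. i < n \<Longrightarrow> \<bar>y i - x i\<bar> < \<delta>) \<Longrightarrow>
       y \<in> U \<and> \<bar>f y - f x - (\<Sum>i<n. dderiv f x (basis_vec i) * (y i - x i))\<bar> \<le> e * (\<Sum>i<n. \<bar>y i - x i\<bar>)"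
proof -
  let ?p = "\<lambda>y i. dderiv f y (basis_vec i)"
  obtain d0 where d0: "d0 > 0" "\<And>y. y \<in> Rn n \<Longrightarrow> (\<And>i. i < n \<Longrightarrow> \<bar>y i - x i\<bar> < d0) \<Longrightarrow> y \<in> U"
    using openin_Rn_box[OF U x] by blast
  have "\<exists>d>0. \<forall>j<n. \<forall>y\<in>Rn n. (\<forall>i<n. \<bar>y i - x i\<bar> < d) \<longrightarrow> y \<in> U \<and> \<bar>?p y j - ?p x j\<bar> < e"
  proof (rule common_delta)
    fix j assume "j < n"
    then have "Ck k n U (\<lambda>y. ?p y j)" using f by simp
    from continuous_on_Rn_box[OF U x Ck_continuous[OF this] e]
    show "\<exists>d>0. \<forall>y\<in>Rn n. (\<forall>i<n. \<bar>y i - x i\<bar> < d) \<longrightarrow> y \<in> U \<and> \<bar>?p y j - ?p x j\<bar> < e" by metis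
  qed force
  then obtain d1 where d1: "d1 > 0" and
    p: "\<And>j y. j < n \<Longrightarrow> y \<in> Rn n \<Longrightarrow> (\<And>i. i < n \<Longrightarrow> \<bar>y i - x i\<bar> < d1) \<Longrightarrow> \<bar>?p y j - ?p x j\<bar> < e"
    by blast
  have xR: "x \<in> Rn n" using x U openin_Rn_subset by blast
  define d where "d = min d0 d1"
  have "d > 0" using d0 d1 by (simp add: d_def)
  then show thesis
  proof (rule that)
    fix y assume y: "y \<in> Rn n" "\<And>i. i < n \<Longrightarrow> \<bar>y i - x i\<bar> < d"
    have yU: "y \<in> U" using y d0(2)[of y] by (simp add: d_def)
    \<comment> \<open>Corner k of the path: the first k coordinates already agree with y.\<close>
    define w where "w k = (\<lambda>j. if j < k then y j else x j)" for k :: nat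
    have step: "\<bar>f (w (Suc l)) - f (w l) - ?p x l * (y l - x l)\<bar> \<le> e * \<bar>y l - x l\<bar>" if l: "l < n" for l
    proof -
      define h where "h t = f (\<lambda>j. w l j + t * basis_vec l j) - ?p x l * t" for t
      define S where "S = {t. \<bar>t\<bar> \<le> \<bar>y l - x l\<bar>}"
      have S: "S = cball 0 \<bar>y l - x l\<bar>" by (auto simp: S_def dist_real_def)
      have der: "(h has_real_derivative ?p (\<lambda>j. w l j + t * basis_vec l j) l - ?p x l) (at t)"
        and bd: "\<bar>?p (\<lambda>j. w l j + t * basis_vec l j) l - ?p x l\<bar> \<le> e" if "t \<in> S" for t
      proof -
        define q where "q = (\<lambda>j. w l j + t * basis_vec l j)"
        have qR: "q \<in> Rn n" using y(1) xR l by (auto simp: q_def w_def Rn_iff basis_vec_def)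
        have qd: "\<bar>q i - x i\<bar> < d" if "i < n" for i
          using y(2)[OF that] y(2)[OF l] \<open>t \<in> S\<close> \<open>d > 0\<close> by (auto simp: q_def w_def basis_vec_def S_def)
        have qU: "q \<in> U" using d0(2)[OF qR] qd by (simp add: d_def)
        have "((\<lambda>s. f (\<lambda>j. q j + s * basis_vec l j)) has_real_derivative ?p q l) (at 0)"
          by (rule Ck_partial_DERIV[OF f l qU])
        then have "((\<lambda>s. f (\<lambda>j. w l j + s * basis_vec l j)) has_real_derivative ?p q l) (at (0 + t))"
          unfolding DERIV_shift by (simp add: q_def algebra_simps)
        then have "(h has_real_derivative ?p q l - ?p x l) (at t)"
          unfolding h_def by (auto intro!: derivative_eq_intros)
        then show "(h has_real_derivative ?p (\<lambda>j. w l j + t * basis_vec l j) l - ?p x l) (at t)"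
          by (simp add: q_def)
        have "\<bar>?p q l - ?p x l\<bar> < e" using p[OF l qR] qd by (simp add: d_def)
        then show "\<bar>?p (\<lambda>j. w l j + t * basis_vec l j) l - ?p x l\<bar> \<le> e" by (simp add: q_def)
      qed
      have "norm (h (y l - x l) - h 0) \<le> e * norm (y l - x l - 0)"
      proof (rule field_differentiable_bound[of S])
        show "convex S" unfolding S by simp
        show "(h has_field_derivative ?p (\<lambda>j. w l j + t * basis_vec l j) l - ?p x l) (at t within S)" if "t \<in> S" for t
          using der[OF that] DERIV_subset by blast
        show "norm (?p (\<lambda>j. w l j + t * basis_vec l j) l - ?p x l) \<le> e" if "t \<in> S" for t
          using bd[OF that] by simp
      qed (auto simp: S_def)
      moreover have "(\<lambda>j. w l j + (y l - x l) * basis_vec l j) = w (Suc l)"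
        by (auto simp: w_def basis_vec_def fun_eq_iff less_Suc_eq)
      ultimately show ?thesis by (simp add: h_def algebra_simps)
    qed
    have wn: "w n = y" using y(1) xR by (auto simp: w_def Rn_iff fun_eq_iff)
    have w0: "w 0 = x" by (simp add: w_def)
    have tele: "f y - f x = (\<Sum>l<n. f (w (Suc l)) - f (w l))"
      using sum_lessThan_telescope[of "\<lambda>l. f (w l)" n] wn w0 by simp
    have "\<bar>f y - f x - (\<Sum>i<n. ?p x i * (y i - x i))\<bar>
        = \<bar>\<Sum>l<n. f (w (Suc l)) - f (w l) - ?p x l * (y l - x l)\<bar>"
      unfolding tele by (simp add: sum_subtractf)
    also have "\<dots> \<le> (\<Sum>l<n. e * \<bar>y l - x l\<bar>)"
      by (rule order_trans[OF sum_abs]) (intro sum_mono step, auto)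
    also have "\<dots> = e * (\<Sum>i<n. \<bar>y i - x i\<bar>)" by (simp add: sum_distrib_left)
    finally show "y \<in> U \<and> \<bar>f y - f x - (\<Sum>i<n. ?p x i * (y i - x i))\<bar> \<le> e * (\<Sum>i<n. \<bar>y i - x i\<bar>)"
      using yU by simp
  qed
qed

text \<open>The curve is assumed differentiable at t0 only, so that a curve with a known velocity at
  a single time can be inserted into a chart expression.\<close>

lemma Ck1_curve_DERIV:
  assumes U: "openin (Euclidean_space n) U" and f: "Ck (Suc k) n U f" and x: "\<eta> t0 \<in> U"
    and ev: "\<forall>\<^sub>F t in at t0. \<eta> t \<in> Rn n"
    and der: "\<And>i. i < n \<Longrightarrow> ((\<lambda>t. \<eta> t i) has_real_derivative \<eta>' i) (at t0)"
  shows "((\<lambda>t. f (\<eta> t)) has_real_derivative (\<Sum>i<n. dderiv f (\<eta> t0) (basis_vec i) * \<eta>' i)) (at t0)"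
proof -
  let ?p = "\<lambda>i. dderiv f (\<eta> t0) (basis_vec i)"
  let ?q = "\<lambda>i t. (\<eta> t i - \<eta> t0 i) / (t - t0)"
  define R where "R t = (f (\<eta> t) - f (\<eta> t0) - (\<Sum>i<n. ?p i * (\<eta> t i - \<eta> t0 i))) / (t - t0)" for t
  have q: "(?q i \<longlongrightarrow> \<eta>' i) (at t0)" if "i < n" for i
    using der[OF that] by (simp add: has_field_derivative_iff)
  have cont: "((\<lambda>t. \<eta> t i) \<longlongrightarrow> \<eta> t0 i) (at t0)" if "i < n" for i
    using DERIV_isCont[OF der[OF that]] by (simp add: isCont_def)
  have "(R \<longlongrightarrow> 0) (at t0)"
  proof (rule tendstoI)
    fix r :: real assume "r > 0"
    \<comment> \<open>Near t0 the sum of the absolute difference quotients stays below B; the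
      summand 1 makes this bound strict and B positive.\<close>
    define B where "B = (\<Sum>i<n. \<bar>\<eta>' i\<bar>) + 1"
    have B: "B > 0" by (simp add: B_def add_nonneg_pos sum_nonneg)
    define e where "e = r / B"
    have e: "e > 0" using B \<open>r > 0\<close> by (simp add: e_def)
    obtain d where d: "d > 0" "\<And>y. y \<in> Rn n \<Longrightarrow> (\<And>i. i < n \<Longrightarrow> \<bar>y i - \<eta> t0 i\<bar> < d) \<Longrightarrow>
       y \<in> U \<and> \<bar>f y - f (\<eta> t0) - (\<Sum>i<n. ?p i * (y i - \<eta> t0 i))\<bar> \<le> e * (\<Sum>i<n. \<bar>y i - \<eta> t0 i\<bar>)"
      using Ck1_total_derivative[OF U f x e] by blast
    have "\<forall>\<^sub>F t in at t0. \<bar>\<eta> t i - \<eta> t0 i\<bar> < d" if "i < n" for i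
      using tendstoD[OF cont[OF that] d(1)] by (simp add: dist_real_def)
    then have 1: "\<forall>\<^sub>F t in at t0. \<forall>i\<in>{..<n}. \<bar>\<eta> t i - \<eta> t0 i\<bar> < d"
      by (intro eventually_ball_finite) auto
    have "((\<lambda>t. \<Sum>i<n. \<bar>?q i t\<bar>) \<longlongrightarrow> (\<Sum>i<n. \<bar>\<eta>' i\<bar>)) (at t0)"
      by (intro tendsto_sum tendsto_rabs q) simp
    then have 2: "\<forall>\<^sub>F t in at t0. (\<Sum>i<n. \<bar>?q i t\<bar>) < B"
      by (rule order_tendstoD) (simp add: B_def)
    have 3: "\<forall>\<^sub>F t in at t0. t \<noteq> t0" by (simp add: eventually_at_filter)
    show "\<forall>\<^sub>F t in at t0. dist (R t) 0 < r"
      using ev 1 2 3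
    proof eventually_elim
      case (elim t)
      have "\<bar>f (\<eta> t) - f (\<eta> t0) - (\<Sum>i<n. ?p i * (\<eta> t i - \<eta> t0 i))\<bar> \<le> e * (\<Sum>i<n. \<bar>\<eta> t i - \<eta> t0 i\<bar>)"
        using d(2)[of "\<eta> t"] elim by simp
      then have "\<bar>R t\<bar> \<le> e * (\<Sum>i<n. \<bar>\<eta> t i - \<eta> t0 i\<bar>) / \<bar>t - t0\<bar>"
        using elim by (simp add: R_def abs_divide divide_right_mono)
      also have "\<dots> = e * (\<Sum>i<n. \<bar>?q i t\<bar>)"
        by (simp add: sum_divide_distrib[symmetric])
      also have "\<dots> < e * B" using elim e by simp
      also have "\<dots> = r" using B by (simp add: e_def)
      finally show ?case by simp
    qed
  qed
  moreover have "((\<lambda>t. \<Sum>i<n. ?p i * ?q i t) \<longlongrightarrow> (\<Sum>i<n. ?p i * \<eta>' i)) (at t0)"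
    by (intro tendsto_sum tendsto_mult tendsto_const q) simp
  ultimately have "((\<lambda>t. (\<Sum>i<n. ?p i * ?q i t) + R t) \<longlongrightarrow> (\<Sum>i<n. ?p i * \<eta>' i) + 0) (at t0)"
    by (intro tendsto_add)
  moreover have "(\<Sum>i<n. ?p i * ?q i t) + R t = (f (\<eta> t) - f (\<eta> t0)) / (t - t0)" for t
    unfolding R_def diff_divide_distrib[of "f (\<eta> t) - f (\<eta> t0)"] by (simp add: sum_divide_distrib)
  ultimately show ?thesis by (simp add: has_field_derivative_iff)
qed

lemma Ck1_dderiv:
  assumes U: "openin (Euclidean_space n) U" and f: "Ck (Suc k) n U f" and x: "x \<in> U" and v: "v \<in> Rn n"
  shows "((\<lambda>t. f (\<lambda>i. x i + t * v i)) has_real_derivative dderiv f x v) (at 0)" (is ?D)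
    and "dderiv f x v = (\<Sum>i<n. dderiv f x (basis_vec i) * v i)" (is ?E)
proof -
  have "((\<lambda>t. f ((\<lambda>t i. x i + t * v i) t)) has_real_derivative
      (\<Sum>i<n. dderiv f ((\<lambda>t i. x i + t * v i) 0) (basis_vec i) * v i)) (at 0)"
  proof (rule Ck1_curve_DERIV[OF U f])
    show "\<forall>\<^sub>F t in at 0. (\<lambda>i. x i + t * v i) \<in> Rn n"
      using v openin_Rn_subset[OF U x] by (intro always_eventually allI Rn_add)
    show "((\<lambda>t. x i + t * v i) has_real_derivative v i) (at 0)" for i
      by (auto intro!: derivative_eq_intros)
  qed (use x in simp)
  then have *: "((\<lambda>t. f (\<lambda>i. x i + t * v i)) has_real_derivative (\<Sum>i<n. dderiv f x (basis_vec i) * v i)) (at 0)"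
    by simp
  from DERIV_imp_deriv[OF this] show ?E by (simp add: dderiv_def)
  with * show ?D by simp
qed

text \<open>The topology on \<open>vec\<close> involves all coordinates, but those from n on are
  constantly 0 on V.\<close>

lemma continuous_on_Rn_map:
  assumes "g ` V \<subseteq> Rn n" "\<And>i. i < n \<Longrightarrow> continuous_on V (\<lambda>x. g x i)"
  shows "continuous_on V (g :: vec \<Rightarrow> vec)"
proof (rule continuous_on_coordinatewise_then_product)
  fix i
  show "continuous_on V (\<lambda>x. g x i)"
  proof (cases "i < n")
    case False
    then have "continuous_on V (\<lambda>x. g x i) \<longleftrightarrow> continuous_on V (\<lambda>x. 0::real)"
      using assms(1) by (intro continuous_on_cong refl) (auto simp: Rn_iff image_subset_iff)
    then show ?thesis by simp
  qed (use assms in simp)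
qed

text \<open>Induction on k with f general: by the chain rule a partial derivative of the composite
  is a sum of products of partial derivatives of f, composed with g, and partial derivatives of g,
  all of them C^k.\<close>

lemma Ck_compose:
  assumes V: "openin (Euclidean_space m) V" and U: "openin (Euclidean_space n) U" and gU: "g ` V \<subseteq> U"
  shows "Ck k n U f \<Longrightarrow> (\<And>i. i < n \<Longrightarrow> Ck k m V (\<lambda>x. g x i)) \<Longrightarrow> Ck k m V (\<lambda>x. f (g x))"
proof (induction k arbitrary: f)
  case (0 f)
  have "continuous_on V g"
    by (rule continuous_on_Rn_map[of _ _ n]) (use 0 gU openin_subset[OF U] in auto)
  then show ?case
    using continuous_on_compose2[OF _ _ gU, of f] 0 by simp
next
  case (Suc k f)
  have "continuous_on V g"
    by (rule continuous_on_Rn_map[of _ _ n]) (use Suc(3)[THEN Ck_continuous] gU openin_subset[OF U] in auto)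
  then have "continuous_on V (\<lambda>x. f (g x))"
    by (rule continuous_on_compose2[OF Ck_continuous[OF Suc(2)] _ gU])
  then show ?case
  proof (rule Ck_SucI[OF _ V, where D = "\<lambda>i x. \<Sum>l<n. dderiv f (g x) (basis_vec l) * dderiv (\<lambda>x. g x l) x (basis_vec i)"])
    fix i x assume i: "i < m" and x: "x \<in> V"
    have gx: "g x \<in> U" using x gU by auto
    have "\<forall>\<^sub>F t in at 0. (\<lambda>j. x j + t * basis_vec i j) \<in> V"
      using openin_Rn_line[OF V x basis_vec_Rn[OF i]] by (simp add: eventually_nhds_conv_at)
    then have ev: "\<forall>\<^sub>F t in at 0. g (\<lambda>j. x j + t * basis_vec i j) \<in> Rn n"
      by (rule eventually_mono) (use gU openin_subset[OF U] in blast)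
    have "((\<lambda>t. f ((\<lambda>t. g (\<lambda>j. x j + t * basis_vec i j)) t)) has_real_derivative
      (\<Sum>l<n. dderiv f ((\<lambda>t. g (\<lambda>j. x j + t * basis_vec i j)) 0) (basis_vec l) * dderiv (\<lambda>x. g x l) x (basis_vec i))) (at 0)"
      by (rule Ck1_curve_DERIV[OF U Suc(2) _ ev Ck_partial_DERIV[OF Suc(3) i x]]) (use gx in simp_all)
    then show "((\<lambda>t. f (g (\<lambda>j. x j + t * basis_vec i j))) has_real_derivative
      (\<Sum>l<n. dderiv f (g x) (basis_vec l) * dderiv (\<lambda>x. g x l) x (basis_vec i))) (at 0)"
      by simp
  next
    fix i assume i: "i < m"
    show "Ck k m V (\<lambda>x. \<Sum>l<n. dderiv f (g x) (basis_vec l) * dderiv (\<lambda>x. g x l) x (basis_vec i))"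
    proof (intro Ck_sum Ck_mult V)
      fix l assume "l \<in> {..<n}"
      then have l: "l < n" by simp
      show "Ck k m V (\<lambda>x. dderiv f (g x) (basis_vec l))"
        by (rule Suc.IH) (use Suc(2) l Ck_pred[OF Suc(3)] in simp_all)
      show "Ck k m V (\<lambda>x. dderiv (\<lambda>x. g x l) x (basis_vec i))"
        using Suc(3)[OF l] i by simp
    qed
  qed
qed

section \<open>Smooth functions and smooth maps between open sets\<close>

lemma smooth_fun_Ck: "smooth_fun n U f \<Longrightarrow> Ck k n U f"
  by (simp add: smooth_fun_def)

lemma smooth_fun_subset: "smooth_fun n U f \<Longrightarrow> V \<subseteq> U \<Longrightarrow> smooth_fun n V f"
  unfolding smooth_fun_def by (intro allI) (rule Ck_subset, rule spec)

lemma smooth_fun_cong: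
  "openin (Euclidean_space n) U \<Longrightarrow> (\<And>x. x \<in> U \<Longrightarrow> f x = g x) \<Longrightarrow> smooth_fun n U f \<longleftrightarrow> smooth_fun n U g"
  unfolding smooth_fun_def by (intro iff_allI Ck_cong)

lemma smooth_fun_local:
  assumes "openin (Euclidean_space n) U"
    "\<And>x. x \<in> U \<Longrightarrow> \<exists>V. openin (Euclidean_space n) V \<and> x \<in> V \<and> V \<subseteq> U \<and> smooth_fun n V f"
  shows "smooth_fun n U f"
  unfolding smooth_fun_def
proof
  fix k
  show "Ck k n U f"
    by (rule Ck_local[OF assms(1)]) (use assms(2) smooth_fun_Ck in metis)
qed

lemma smooth_fun_const: "openin (Euclidean_space n) U \<Longrightarrow> smooth_fun n U (\<lambda>x. c)"
  and smooth_fun_coord: "openin (Euclidean_space n) U \<Longrightarrow> smooth_fun n U (\<lambda>x. x i)"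
  by (simp_all add: smooth_fun_def Ck_const Ck_coord)

lemma smooth_fun_add:
  "openin (Euclidean_space n) U \<Longrightarrow> smooth_fun n U f \<Longrightarrow> smooth_fun n U g \<Longrightarrow> smooth_fun n U (\<lambda>x. f x + g x)"
  and smooth_fun_mult:
  "openin (Euclidean_space n) U \<Longrightarrow> smooth_fun n U f \<Longrightarrow> smooth_fun n U g \<Longrightarrow> smooth_fun n U (\<lambda>x. f x * g x)"
  by (simp_all add: smooth_fun_def Ck_add Ck_mult)

lemma smooth_fun_sum:
  "openin (Euclidean_space n) U \<Longrightarrow> (\<And>i. i \<in> I \<Longrightarrow> smooth_fun n U (f i)) \<Longrightarrow> smooth_fun n U (\<lambda>x. \<Sum>i\<in>I. f i x)"
  by (simp add: smooth_fun_def Ck_sum)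

lemma smooth_fun_compose:
  assumes "openin (Euclidean_space m) V" "openin (Euclidean_space n) U" "g ` V \<subseteq> U"
    "smooth_fun n U f" "\<And>i. i < n \<Longrightarrow> smooth_fun m V (\<lambda>x. g x i)"
  shows "smooth_fun m V (\<lambda>x. f (g x))"
  unfolding smooth_fun_def
  by (rule allI, rule Ck_compose[OF assms(1-3)]) (simp_all add: smooth_fun_Ck assms(4,5))

lemma smooth_fun_dderiv:
  assumes U: "openin (Euclidean_space n) U" and f: "smooth_fun n U f" and v: "v \<in> Rn n"
  shows "smooth_fun n U (\<lambda>x. dderiv f x v)"
proof -
  have "smooth_fun n U (\<lambda>x. dderiv f x (basis_vec i))" if "i < n" for i
    unfolding smooth_fun_def using smooth_fun_Ck[OF f, of "Suc _"] that by simp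
  then have "smooth_fun n U (\<lambda>x. \<Sum>i<n. dderiv f x (basis_vec i) * v i)"
    by (intro smooth_fun_sum smooth_fun_mult smooth_fun_const U) simp
  moreover have "smooth_fun n U (\<lambda>x. dderiv f x v) \<longleftrightarrow> smooth_fun n U (\<lambda>x. \<Sum>i<n. dderiv f x (basis_vec i) * v i)"
    by (intro smooth_fun_cong U Ck1_dderiv(2)[OF U smooth_fun_Ck[OF f]] v)
  ultimately show ?thesis by simp
qed

lemma smooth_fun_curve_DERIV:
  assumes U: "openin (Euclidean_space n) U" and f: "smooth_fun n U f" and x: "\<eta> t0 \<in> U"
    and ev: "\<forall>\<^sub>F t in at t0. \<eta> t \<in> Rn n" and v: "\<eta>' \<in> Rn n"
    and der: "\<And>i. i < n \<Longrightarrow> ((\<lambda>t. \<eta> t i) has_real_derivative \<eta>' i) (at t0)"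
  shows "((\<lambda>t. f (\<eta> t)) has_real_derivative dderiv f (\<eta> t0) \<eta>') (at t0)"
  using Ck1_curve_DERIV[OF U smooth_fun_Ck[OF f] x ev der] Ck1_dderiv(2)[OF U smooth_fun_Ck[OF f] x v] by simp

lemma smooth_fun_line_DERIV:
  assumes "openin (Euclidean_space n) U" and "smooth_fun n U f" and "x \<in> U" and "v \<in> Rn n"
  shows "((\<lambda>t. f (\<lambda>i. x i + t * v i)) has_real_derivative dderiv f x v) (at 0)"
  by (rule Ck1_dderiv(1)[OF assms(1) smooth_fun_Ck[OF assms(2)] assms(3,4)])

lemma smooth_fun_continuous: "smooth_fun n U f \<Longrightarrow> continuous_on U f"
  by (rule Ck_continuous[OF smooth_fun_Ck])

lemma euclid_smooth_mapD:
  assumes "euclid_smooth_map m V n U f"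
  shows "openin (Euclidean_space m) V" "openin (Euclidean_space n) U" "f ` V \<subseteq> U"
    "i < n \<Longrightarrow> smooth_fun m V (\<lambda>v. f v i)" "x \<in> V \<Longrightarrow> f x \<in> U" "x \<in> V \<Longrightarrow> f x \<in> Rn n"
  using assms openin_Rn_subset[of n U "f x"] unfolding euclid_smooth_map_def by auto

text \<open>Removes the bound i < n: from n on the coordinate function is constantly 0 on V.\<close>

lemma euclid_smooth_map_coord:
  assumes "euclid_smooth_map m V n U f"
  shows "smooth_fun m V (\<lambda>v. f v i)"
proof (cases "i < n")
  case False
  note f = euclid_smooth_mapD[OF assms]
  have "f v i = 0" if "v \<in> V" for v
    using f(6)[OF that] False by (simp add: Rn_iff)
  then show ?thesis using smooth_fun_cong[OF f(1), of "\<lambda>v. f v i" "\<lambda>v. 0"] smooth_fun_const[OF f(1)] by simp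
qed (rule euclid_smooth_mapD(4)[OF assms])

lemma euclid_smooth_map_continuous:
  "euclid_smooth_map m V n U f \<Longrightarrow> continuous_on V f"
  by (intro continuous_on_coordinatewise_then_product smooth_fun_continuous euclid_smooth_map_coord)

lemma euclid_smooth_map_vimage:
  assumes "euclid_smooth_map m V n U f" "openin (Euclidean_space n) W"
  shows "openin (Euclidean_space m) {v \<in> V. f v \<in> W}"
proof -
  note f = euclid_smooth_mapD[OF assms(1)]
  obtain T where T: "open T" "W = T \<inter> Rn n"
    using assms(2) by (auto simp: Euclidean_space_eu openin_open)
  have "openin (top_of_set V) (V \<inter> f -` T)"
    by (rule continuous_openin_preimage_gen[OF euclid_smooth_map_continuous[OF assms(1)] T(1)])
  moreover have "V \<inter> f -` T = {v \<in> V. f v \<in> W}" using T f(6) by auto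
  ultimately show ?thesis using openin_Rn_trans[OF f(1)] by simp
qed

lemma euclid_smooth_map_restrict:
  assumes "euclid_smooth_map m V n U f" "openin (Euclidean_space m) V'" "V' \<subseteq> V"
    "openin (Euclidean_space n) U'" "f ` V' \<subseteq> U'"
  shows "euclid_smooth_map m V' n U' f"
  using assms smooth_fun_subset[OF _ assms(3)] unfolding euclid_smooth_map_def by simp

lemma euclid_smooth_map_smooth_fun:
  assumes "euclid_smooth_map m V n U f" "smooth_fun n U h"
  shows "smooth_fun m V (\<lambda>x. h (f x))"
  using smooth_fun_compose[of m V n U f h] assms unfolding euclid_smooth_map_def by simp

lemma euclid_smooth_map_compose:
  assumes "euclid_smooth_map m V n U f" "euclid_smooth_map n U k W g"
  shows "euclid_smooth_map m V k W (\<lambda>x. g (f x))"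
  unfolding euclid_smooth_map_def
proof (intro conjI allI impI)
  show "(\<lambda>x. g (f x)) ` V \<subseteq> W"
    using euclid_smooth_mapD(5)[OF assms(1)] euclid_smooth_mapD(5)[OF assms(2)] by auto
  show "smooth_fun m V (\<lambda>v. g (f v) i)" if "i < k" for i
    by (rule euclid_smooth_map_smooth_fun[OF assms(1) euclid_smooth_map_coord[OF assms(2)]])
qed (rule euclid_smooth_mapD[OF assms(1)] euclid_smooth_mapD[OF assms(2)])+

section \<open>Differentials of smooth maps\<close>

lemma vderiv_in_Rn:
  assumes "euclid_smooth_map m V n U f" "x \<in> V" "v \<in> Rn m"
  shows "vderiv f x v \<in> Rn n"
proof -
  note f = euclid_smooth_mapD[OF assms(1)]
  have "dderiv (\<lambda>y. f y i) x v = 0" if "i \<ge> n" for i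
  proof -
    have "dderiv (\<lambda>y. f y i) x v = dderiv (\<lambda>y. 0) x v"
      by (rule dderiv_cong[OF f(1) assms(2,3)]) (use f(6) that in \<open>simp add: Rn_iff\<close>)
    then show ?thesis by (simp add: dderiv_def)
  qed
  then show ?thesis by (simp add: Rn_iff vderiv_def)
qed

lemma vderiv_cong:
  assumes "openin (Euclidean_space n) U" "x \<in> U" "v \<in> Rn n" "\<And>y. y \<in> U \<Longrightarrow> f y = g y"
  shows "vderiv f x v = vderiv g x v"
  unfolding vderiv_def by (intro ext dderiv_cong[OF assms(1-3)]) (simp add: assms(4))

lemma vderiv_curve:
  assumes f: "euclid_smooth_map m V n U f" and x: "\<eta> t0 \<in> V"
    and ev: "\<forall>\<^sub>F t in at t0. \<eta> t \<in> Rn m" and v: "\<eta>' \<in> Rn m"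
    and der: "\<And>i. i < m \<Longrightarrow> ((\<lambda>t. \<eta> t i) has_real_derivative \<eta>' i) (at t0)"
  shows "((\<lambda>t. f (\<eta> t) i) has_real_derivative vderiv f (\<eta> t0) \<eta>' i) (at t0)"
  unfolding vderiv_def
  by (rule smooth_fun_curve_DERIV[OF euclid_smooth_mapD(1)[OF f] euclid_smooth_map_coord[OF f] x ev v der])

lemma vderiv_line:
  assumes "euclid_smooth_map m V n U f" "x \<in> V" "v \<in> Rn m"
  shows "((\<lambda>t. f (\<lambda>j. x j + t * v j) i) has_real_derivative vderiv f x v i) (at 0)"
  unfolding vderiv_def
  by (rule smooth_fun_line_DERIV[OF euclid_smooth_mapD(1)[OF assms(1)] euclid_smooth_map_coord[OF assms(1)] assms(2,3)])

lemma dderiv_chain: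
  assumes f: "euclid_smooth_map m V n U f" and h: "smooth_fun n U h" and x: "x \<in> V" and v: "v \<in> Rn m"
  shows "dderiv (\<lambda>y. h (f y)) x v = dderiv h (f x) (vderiv f x v)"
proof -
  note fD = euclid_smooth_mapD[OF f]
  have "((\<lambda>t. h ((\<lambda>t. f (\<lambda>j. x j + t * v j)) t)) has_real_derivative
      dderiv h ((\<lambda>t. f (\<lambda>j. x j + t * v j)) 0) (vderiv f x v)) (at 0)"
  proof (rule smooth_fun_curve_DERIV[OF fD(2) h])
    have "\<forall>\<^sub>F t in at 0. (\<lambda>j. x j + t * v j) \<in> V"
      using openin_Rn_line[OF fD(1) x v] by (simp add: eventually_nhds_conv_at)
    then show "\<forall>\<^sub>F t in at 0. f (\<lambda>j. x j + t * v j) \<in> Rn n"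
      by (rule eventually_mono) (rule fD(6))
    show "((\<lambda>t. f (\<lambda>j. x j + t * v j) i) has_real_derivative vderiv f x v i) (at 0)" for i
      by (rule vderiv_line[OF f x v])
  qed (use fD(5)[OF x] vderiv_in_Rn[OF f x v] in simp_all)
  from DERIV_imp_deriv[OF this] show ?thesis by (simp add: dderiv_def)
qed

lemma vderiv_chain:
  assumes "euclid_smooth_map m V n U f" "euclid_smooth_map n U k W g" "x \<in> V" "v \<in> Rn m"
  shows "vderiv (\<lambda>y. g (f y)) x v = vderiv g (f x) (vderiv f x v)"
  unfolding vderiv_def[of "\<lambda>y. g (f y)"] vderiv_def[of g]
  by (intro ext dderiv_chain[OF assms(1) euclid_smooth_map_coord[OF assms(2)] assms(3,4)])

lemma dderiv_linear:
  assumes "openin (Euclidean_space n) U" "smooth_fun n U f" "x \<in> U" "v \<in> Rn n" "w \<in> Rn n"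
  shows "dderiv f x (\<lambda>j. s * v j + t * w j) = s * dderiv f x v + t * dderiv f x w"
proof -
  have 1: "(\<lambda>j. s * v j + t * w j) \<in> Rn n" using assms by (simp add: Rn_iff)
  note * = Ck1_dderiv(2)[OF assms(1) smooth_fun_Ck[OF assms(2)] assms(3)]
  show ?thesis
    unfolding *[OF assms(4)] *[OF assms(5)] *[OF 1]
    by (simp add: sum_distrib_left sum.distrib algebra_simps)
qed

lemma vderiv_linear:
  assumes "euclid_smooth_map m V n U f" "x \<in> V" "v \<in> Rn m" "w \<in> Rn m"
  shows "vderiv f x (\<lambda>j. s * v j + t * w j) = (\<lambda>j. s * vderiv f x v j + t * vderiv f x w j)"
  unfolding vderiv_def
  by (rule ext, rule dderiv_linear[OF euclid_smooth_mapD(1) euclid_smooth_map_coord]) (rule assms)+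

lemma vderiv_id: "vderiv (\<lambda>y. y) x v = v"
proof -
  have "deriv (\<lambda>t. x i + t * v i) 0 = v i" for i
    by (rule DERIV_imp_deriv) (auto intro!: derivative_eq_intros)
  then show ?thesis by (simp add: vderiv_def dderiv_def fun_eq_iff)
qed

lemma compact_Rn_box: "compact {y \<in> Rn d. \<forall>i<d. \<bar>y i - x i\<bar> \<le> r}"
proof -
  \<comment> \<open>Tychonoff: the coordinates from d on are confined to the compact singleton {0},
    which encodes membership in \<open>Rn d\<close>.\<close>
  have "compactin (powertop_real UNIV) (Pi\<^sub>E UNIV (\<lambda>i. if i < d then {x i - r..x i + r} else {0}))"
    unfolding compactin_PiE by auto
  moreover have "Pi\<^sub>E UNIV (\<lambda>i. if i < d then {x i - r..x i + r} else {0}) = {y \<in> Rn d. \<forall>i<d. \<bar>y i - x i\<bar> \<le> r}"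
  proof (intro equalityI subsetI)
    fix y assume "y \<in> Pi\<^sub>E UNIV (\<lambda>i. if i < d then {x i - r..x i + r} else {0})"
    then have y: "y i \<in> (if i < d then {x i - r..x i + r} else {0})" for i by (simp add: PiE_iff)
    have "y i = 0" if "i \<ge> d" for i using y[of i] that by simp
    moreover have "\<bar>y i - x i\<bar> \<le> r" if "i < d" for i using y[of i] that by (simp add: abs_le_iff)
    ultimately show "y \<in> {y \<in> Rn d. \<forall>i<d. \<bar>y i - x i\<bar> \<le> r}" by (simp add: Rn_iff)
  next
    fix y assume y: "y \<in> {y \<in> Rn d. \<forall>i<d. \<bar>y i - x i\<bar> \<le> r}"
    have "y i \<in> (if i < d then {x i - r..x i + r} else {0})" for i
      using y by (cases "i < d") (auto simp: Rn_iff abs_le_iff algebra_simps)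
    then show "y \<in> Pi\<^sub>E UNIV (\<lambda>i. if i < d then {x i - r..x i + r} else {0})" by (simp add: PiE_iff)
  qed
  ultimately show ?thesis by (simp add: euclidean_product_topology)
qed

lemma open_Rn_box:
  assumes "x \<in> Rn d"
  shows "openin (Euclidean_space d) {y \<in> Rn d. \<forall>i<d. \<bar>y i - x i\<bar> < r}"
proof -
  have "open (\<Inter>i\<in>{..<d}. {y :: vec. \<bar>y i - x i\<bar> < r})"
    by (intro open_INT ballI open_Collect_less continuous_intros continuous_on_coord) simp
  then have "openin (Euclidean_space d) ({x. \<forall>i\<ge>d. x i = 0} \<inter> (\<Inter>i\<in>{..<d}. {y :: vec. \<bar>y i - x i\<bar> < r}))"
    unfolding Euclidean_space_eu by (rule openin_open_Int)
  moreover have "{x. \<forall>i\<ge>d. x i = 0} \<inter> (\<Inter>i\<in>{..<d}. {y :: vec. \<bar>y i - x i\<bar> < r}) = {y \<in> Rn d. \<forall>i<d. \<bar>y i - x i\<bar> < r}"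
    by (auto simp: Rn_iff)
  ultimately show ?thesis by simp
qed

section \<open>Plots and tangent vectors\<close>

text \<open>The part of the manifold axioms that products of manifolds satisfy without further proof.\<close>

definition chart_cover :: "'a mfd \<Rightarrow> bool" where
  "chart_cover M \<longleftrightarrow> (\<Union>c\<in>matlas M. fst c) = mpoints M \<and>
     (\<forall>c\<in>matlas M. openin (mtop M) (fst c) \<and> inj_on (snd c) (fst c) \<and>
        openin (Euclidean_space (mdim M)) (snd c ` fst c) \<and>
        continuous_map (subtopology (mtop M) (fst c)) (Euclidean_space (mdim M)) (snd c))"

lemma smooth_manifold_chart_cover:
  assumes "smooth_manifold M" shows "chart_cover M"
proof -
  have "inj_on (snd c) (fst c) \<and> continuous_map (subtopology (mtop M) (fst c)) (Euclidean_space (mdim M)) (snd c)"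
    if c: "c \<in> matlas M" for c
  proof -
    have h: "homeomorphic_map (subtopology (mtop M) (fst c))
          (subtopology (Euclidean_space (mdim M)) (snd c ` fst c)) (snd c)"
      and o: "openin (mtop M) (fst c)"
      using assms c unfolding smooth_manifold_def by auto
    have "topspace (subtopology (mtop M) (fst c)) = fst c"
      using openin_subset[OF o] by auto
    then have "inj_on (snd c) (fst c)" using homeomorphic_imp_injective_map[OF h] by simp
    moreover have "continuous_map (subtopology (mtop M) (fst c)) (Euclidean_space (mdim M)) (snd c)"
      using homeomorphic_imp_continuous_map[OF h] continuous_map_into_fulltopology by blast
    ultimately show ?thesis ..
  qed
  then show ?thesis using assms unfolding chart_cover_def smooth_manifold_def by simp
qed

lemma chart_coverD:
  assumes "chart_cover M" "c \<in> matlas M"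
  shows "openin (mtop M) (fst c)" "inj_on (snd c) (fst c)"
    "openin (Euclidean_space (mdim M)) (snd c ` fst c)"
    "continuous_map (subtopology (mtop M) (fst c)) (Euclidean_space (mdim M)) (snd c)"
    "y \<in> snd c ` fst c \<Longrightarrow> param c y \<in> fst c"
    "y \<in> snd c ` fst c \<Longrightarrow> snd c (param c y) = y"
    "x \<in> fst c \<Longrightarrow> param c (snd c x) = x"
    "x \<in> fst c \<Longrightarrow> snd c x \<in> snd c ` fst c"
    "x \<in> fst c \<Longrightarrow> x \<in> mpoints M"
    "x \<in> fst c \<Longrightarrow> snd c x \<in> Rn (mdim M)"
proof -
  show 1: "openin (mtop M) (fst c)" "inj_on (snd c) (fst c)"
    "openin (Euclidean_space (mdim M)) (snd c ` fst c)"
    "continuous_map (subtopology (mtop M) (fst c)) (Euclidean_space (mdim M)) (snd c)"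
    using assms unfolding chart_cover_def by auto
  show "y \<in> snd c ` fst c \<Longrightarrow> param c y \<in> fst c" by (rule inv_into_into)
  show "y \<in> snd c ` fst c \<Longrightarrow> snd c (param c y) = y" by (rule f_inv_into_f)
  show "x \<in> fst c \<Longrightarrow> param c (snd c x) = x" by (rule inv_into_f_f[OF 1(2)])
  show "x \<in> fst c \<Longrightarrow> snd c x \<in> snd c ` fst c" by (rule imageI)
  show "x \<in> fst c \<Longrightarrow> x \<in> mpoints M" using openin_subset[OF 1(1)] by (rule subsetD)
  show "x \<in> fst c \<Longrightarrow> snd c x \<in> Rn (mdim M)" using openin_subset[OF 1(3)] by auto
qed

lemma charts_at_ex: "chart_cover M \<Longrightarrow> x \<in> mpoints M \<Longrightarrow> \<exists>c. c \<in> charts_at M x"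
  unfolding chart_cover_def charts_at_def by blast

lemma charts_atD: "c \<in> charts_at M x \<Longrightarrow> c \<in> matlas M" "c \<in> charts_at M x \<Longrightarrow> x \<in> fst c"
  by (simp_all add: charts_at_def)

lemma some_chart_at: "chart_cover M \<Longrightarrow> x \<in> mpoints M \<Longrightarrow> some_chart M x \<in> charts_at M x"
  unfolding some_chart_def by (rule someI_ex) (rule charts_at_ex)

lemma chart_vimage_open:
  assumes "chart_cover M" "c \<in> matlas M" "openin (Euclidean_space (mdim M)) W"
  shows "openin (mtop M) {x \<in> fst c. snd c x \<in> W}"
proof -
  note C = chart_coverD[OF assms(1,2)]
  have "openin (subtopology (mtop M) (fst c)) {x \<in> topspace (subtopology (mtop M) (fst c)). snd c x \<in> W}"
    by (rule openin_continuous_map_preimage[OF C(4) assms(3)])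
  moreover have "{x \<in> topspace (subtopology (mtop M) (fst c)). snd c x \<in> W} = {x \<in> fst c. snd c x \<in> W}"
    using openin_subset[OF C(1)] by auto
  ultimately have "openin (subtopology (mtop M) (fst c)) {x \<in> fst c. snd c x \<in> W}" by simp
  then show ?thesis by (rule openin_trans_full[OF _ C(1)])
qed

lemma smooth_manifoldD:
  assumes "smooth_manifold M"
  shows "Hausdorff_space (mtop M)" "chart_cover M"
    "c \<in> matlas M \<Longrightarrow> openin (mtop M) O' \<Longrightarrow> openin (Euclidean_space (mdim M)) (snd c ` (fst c \<inter> O'))"
    "c \<in> matlas M \<Longrightarrow> c' \<in> matlas M \<Longrightarrow>
        smooth_fun (mdim M) (snd c ` (fst c \<inter> fst c')) (\<lambda>y. snd c' (param c y) i)"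
proof -
  show "Hausdorff_space (mtop M)" using assms unfolding smooth_manifold_def by blast
  show cc: "chart_cover M" by (rule smooth_manifold_chart_cover[OF assms])
  show "c \<in> matlas M \<Longrightarrow> c' \<in> matlas M \<Longrightarrow>
        smooth_fun (mdim M) (snd c ` (fst c \<inter> fst c')) (\<lambda>y. snd c' (param c y) i)"
    using assms unfolding smooth_manifold_def by blast
  show "openin (Euclidean_space (mdim M)) (snd c ` (fst c \<inter> O'))"
    if c: "c \<in> matlas M" and o: "openin (mtop M) O'"
  proof -
    have h: "homeomorphic_map (subtopology (mtop M) (fst c))
          (subtopology (Euclidean_space (mdim M)) (snd c ` fst c)) (snd c)"
      using assms c unfolding smooth_manifold_def by blast
    have "openin (subtopology (mtop M) (fst c)) (fst c \<inter> O')"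
      unfolding Int_commute[of "fst c"] by (rule openin_subtopology_Int[OF o])
    then have "openin (subtopology (Euclidean_space (mdim M)) (snd c ` fst c)) (snd c ` (fst c \<inter> O'))"
      using homeomorphic_imp_open_map[OF h] by (simp add: open_map_def)
    then show ?thesis using openin_trans_full chart_coverD(3)[OF cc c] by blast
  qed
qed

section \<open>Plots of a manifold\<close>

lemma smooth_plotD:
  assumes "smooth_plot M n U P"
  shows "openin (Euclidean_space n) U" "u \<in> U \<Longrightarrow> P u \<in> mpoints M"
    "c \<in> matlas M \<Longrightarrow> openin (Euclidean_space n) {u\<in>U. P u \<in> fst c}"
    "c \<in> matlas M \<Longrightarrow> smooth_fun n {u\<in>U. P u \<in> fst c} (\<lambda>u. snd c (P u) i)"
  using assms unfolding smooth_plot_def by auto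

lemma smooth_plot_rep:
  assumes "chart_cover M" "smooth_plot M n U P" "c \<in> matlas M"
  shows "euclid_smooth_map n {u\<in>U. P u \<in> fst c} (mdim M) (snd c ` fst c) (\<lambda>u. snd c (P u))"
  unfolding euclid_smooth_map_def
  using smooth_plotD[OF assms(2)] chart_coverD(3)[OF assms(1,3)] assms(3) by auto

lemma smooth_plot_compose:
  assumes P: "smooth_plot M n U P" and f: "euclid_smooth_map m V n U f"
  shows "smooth_plot M m V (\<lambda>v. P (f v))"
  unfolding smooth_plot_def
proof (intro conjI ballI allI)
  note fD = euclid_smooth_mapD[OF f]
  show "openin (Euclidean_space m) V" by (rule fD(1))
  show "(\<lambda>v. P (f v)) ` V \<subseteq> mpoints M" using smooth_plotD(2)[OF P] fD(5) by auto
  fix c assume c: "c \<in> matlas M"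
  let ?U = "{u \<in> U. P u \<in> fst c}" and ?V = "{v \<in> V. P (f v) \<in> fst c}"
  have eq: "?V = {v \<in> V. f v \<in> ?U}" using fD(5) by auto
  show o: "openin (Euclidean_space m) ?V"
    unfolding eq by (rule euclid_smooth_map_vimage[OF f smooth_plotD(3)[OF P c]])
  have "euclid_smooth_map m ?V n ?U f"
    by (rule euclid_smooth_map_restrict[OF f o _ smooth_plotD(3)[OF P c]]) (use fD(5) in auto)
  then show "smooth_fun m ?V (\<lambda>u. snd c (P (f u)) i)" for i
    by (rule euclid_smooth_map_smooth_fun[OF _ smooth_plotD(4)[OF P c]])
qed

lemma euclid_smooth_map_inclusion:
  assumes "openin (Euclidean_space n) U" "openin (Euclidean_space n) V" "V \<subseteq> U"
  shows "euclid_smooth_map n V n U (\<lambda>u. u)"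
  unfolding euclid_smooth_map_def using assms smooth_fun_coord by auto

lemma smooth_plot_subset:
  assumes "smooth_plot M n U P" "openin (Euclidean_space n) V" "V \<subseteq> U"
  shows "smooth_plot M n V P"
  by (rule smooth_plot_compose[OF assms(1) euclid_smooth_map_inclusion[OF smooth_plotD(1)[OF assms(1)] assms(2,3)]])

lemma smooth_plot_cong:
  assumes "smooth_plot M n U P" "\<And>u. u \<in> U \<Longrightarrow> P u = Q u"
  shows "smooth_plot M n U Q"
  unfolding smooth_plot_def
proof (intro conjI ballI allI)
  note PD = smooth_plotD[OF assms(1)]
  show "openin (Euclidean_space n) U" by (rule PD)
  show "Q ` U \<subseteq> mpoints M" using PD(2) assms(2) by auto
  fix c assume c: "c \<in> matlas M"
  have eq: "{u \<in> U. Q u \<in> fst c} = {u \<in> U. P u \<in> fst c}" using assms(2) by auto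
  show "openin (Euclidean_space n) {u \<in> U. Q u \<in> fst c}" unfolding eq by (rule PD(3)[OF c])
  show "smooth_fun n {u \<in> U. Q u \<in> fst c} (\<lambda>u. snd c (Q u) i)" for i
    unfolding eq using PD(4)[OF c, of i] assms(2)
    by (subst smooth_fun_cong[OF PD(3)[OF c], of _ "\<lambda>u. snd c (P u) i"]) auto
qed

text \<open>The sheaf property of plots. Openness of V is part of \<open>smooth_plot\<close>, so it
  is not listed separately.\<close>

lemma smooth_plot_local:
  assumes U: "openin (Euclidean_space n) U"
    and loc: "\<And>u. u \<in> U \<Longrightarrow> \<exists>V. u \<in> V \<and> V \<subseteq> U \<and> smooth_plot M n V P"
  shows "smooth_plot M n U P"
  unfolding smooth_plot_def
proof (intro conjI ballI allI)
  show "openin (Euclidean_space n) U" by (rule U)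
  show "P ` U \<subseteq> mpoints M"
  proof
    fix x assume "x \<in> P ` U"
    then obtain u where u: "u \<in> U" "x = P u" by auto
    then obtain V where "u \<in> V" "smooth_plot M n V P" using loc by blast
    then show "x \<in> mpoints M" using smooth_plotD(2) u(2) by blast
  qed
  fix c assume c: "c \<in> matlas M"
  have 1: "\<exists>W. openin (Euclidean_space n) W \<and> u \<in> W \<and> W \<subseteq> {u \<in> U. P u \<in> fst c} \<and>
      smooth_fun n W (\<lambda>u. snd c (P u) i)" if "u \<in> {u \<in> U. P u \<in> fst c}" for u i
  proof -
    from that have "u \<in> U" by simp
    from loc[OF this] obtain V where V: "u \<in> V" "V \<subseteq> U" "smooth_plot M n V P" by (elim exE conjE)
    have "u \<in> {u \<in> V. P u \<in> fst c}" "{u \<in> V. P u \<in> fst c} \<subseteq> {u \<in> U. P u \<in> fst c}"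
      using V(1,2) that by auto
    then show ?thesis
      by (intro exI[of _ "{u \<in> V. P u \<in> fst c}"] conjI smooth_plotD(3)[OF V(3) c] smooth_plotD(4)[OF V(3) c])
  qed
  show o: "openin (Euclidean_space n) {u \<in> U. P u \<in> fst c}"
    unfolding openin_subopen[of _ "{u \<in> U. P u \<in> fst c}"]
  proof
    fix u assume "u \<in> {u \<in> U. P u \<in> fst c}"
    from 1[OF this, of 0] show "\<exists>T. openin (Euclidean_space n) T \<and> u \<in> T \<and> T \<subseteq> {u \<in> U. P u \<in> fst c}"
      by (elim exE conjE) (intro exI conjI)
  qed
  show "smooth_fun n {u \<in> U. P u \<in> fst c} (\<lambda>u. snd c (P u) i)" for i
    by (rule smooth_fun_local[OF o 1])
qed

text \<open>Smoothness read in the one chart c suffices: in another chart the map is its reading in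
  c followed by the coordinate change, which the atlas makes smooth.\<close>

lemma smooth_plot_in_chart:
  assumes M: "smooth_manifold M" and U: "openin (Euclidean_space n) U" and c: "c \<in> matlas M"
    and PU: "P ` U \<subseteq> fst c" and sm: "\<And>i. smooth_fun n U (\<lambda>u. snd c (P u) i)"
  shows "smooth_plot M n U P"
  unfolding smooth_plot_def
proof (intro conjI ballI allI)
  note D = smooth_manifoldD[OF M]
  note C = chart_coverD[OF D(2) c]
  show "openin (Euclidean_space n) U" by (rule U)
  show "P ` U \<subseteq> mpoints M" using C(9) PU by auto
  fix c' assume c': "c' \<in> matlas M"
  note C' = chart_coverD[OF D(2) c']
  let ?W = "snd c ` (fst c \<inter> fst c')" and ?V = "{u \<in> U. P u \<in> fst c'}"
  have rep: "euclid_smooth_map n U (mdim M) (snd c ` fst c) (\<lambda>u. snd c (P u))"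
    unfolding euclid_smooth_map_def using U C(3) PU sm by auto
  have W: "openin (Euclidean_space (mdim M)) ?W" by (rule D(3)[OF c C'(1)])
  have eq: "?V = {u \<in> U. snd c (P u) \<in> ?W}"
    using PU inj_onD[OF C(2)] by (auto simp: image_iff subset_iff)
  show o: "openin (Euclidean_space n) ?V"
    unfolding eq by (rule euclid_smooth_map_vimage[OF rep W])
  fix i
  have "euclid_smooth_map n ?V (mdim M) ?W (\<lambda>u. snd c (P u))"
    by (rule euclid_smooth_map_restrict[OF rep o _ W]) (use PU in auto)
  from euclid_smooth_map_smooth_fun[OF this D(4)[OF c c', of i]]
  have "smooth_fun n ?V (\<lambda>u. snd c' (param c (snd c (P u))) i)" .
  then show "smooth_fun n ?V (\<lambda>u. snd c' (P u) i)"
    by (subst smooth_fun_cong[OF o, of _ "\<lambda>u. snd c' (param c (snd c (P u))) i"]) (use PU C(7) in auto)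
qed

lemma smooth_plot_param:
  assumes M: "smooth_manifold M" and c: "c \<in> matlas M"
  shows "smooth_plot M (mdim M) (snd c ` fst c) (param c)"
proof (rule smooth_plot_in_chart[OF M _ c])
  note C = chart_coverD[OF smooth_manifoldD(2)[OF M] c]
  show "openin (Euclidean_space (mdim M)) (snd c ` fst c)" by (rule C(3))
  show "param c ` snd c ` fst c \<subseteq> fst c" using C(5) by auto
  show "smooth_fun (mdim M) (snd c ` fst c) (\<lambda>u. snd c (param c u) i)" for i
    by (rule iffD2[OF smooth_fun_cong[OF C(3)] smooth_fun_coord[OF C(3)]]) (simp only: C(6))
qed

lemma smooth_plot_const:
  assumes "smooth_manifold M" "openin (Euclidean_space n) U" "x \<in> mpoints M"
  shows "smooth_plot M n U (\<lambda>u. x)"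
proof -
  obtain c where c: "c \<in> charts_at M x"
    using charts_at_ex[OF smooth_manifoldD(2)[OF assms(1)] assms(3)] by blast
  show ?thesis
    by (rule smooth_plot_in_chart[OF assms(1,2) charts_atD(1)[OF c]])
      (use charts_atD(2)[OF c] smooth_fun_const[OF assms(2)] in auto)
qed

text \<open>\<open>smooth_map\<close> tests F on parametrizations of charts only; every plot factors
  locally through one of them, and being a plot is local. The domain is a mere
  \<open>chart_cover\<close> so that it may be a product.\<close>

lemma smooth_plot_map:
  assumes M: "chart_cover M" and F: "smooth_map M N F" and P: "smooth_plot M n U P"
  shows "smooth_plot N n U (\<lambda>u. F (P u))"
proof (rule smooth_plot_local)
  show "openin (Euclidean_space n) U" by (rule smooth_plotD(1)[OF P])
  fix u assume u: "u \<in> U"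
  obtain c where c: "c \<in> charts_at M (P u)" using charts_at_ex[OF M smooth_plotD(2)[OF P u]] by blast
  note cD = charts_atD[OF c]
  let ?V = "{u \<in> U. P u \<in> fst c}"
  have "smooth_plot N (mdim M) (snd c ` fst c) (\<lambda>y. F (param c y))"
    using F cD(1) unfolding smooth_map_def by blast
  from smooth_plot_compose[OF this smooth_plot_rep[OF M P cD(1)]]
  have "smooth_plot N n ?V (\<lambda>u. F (param c (snd c (P u))))" .
  then have "smooth_plot N n ?V (\<lambda>u. F (P u))"
    by (rule smooth_plot_cong) (use chart_coverD(7)[OF M cD(1)] in simp)
  then show "\<exists>V. u \<in> V \<and> V \<subseteq> U \<and> smooth_plot N n V (\<lambda>u. F (P u))"
    using u cD(2) by (intro exI[of _ ?V]) auto
qed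

section \<open>Products of manifolds\<close>

lemma smooth_plot_prod:
  assumes "smooth_plot M n U P" "smooth_plot N n U Q"
  shows "smooth_plot (prod_mfd M N) n U (\<lambda>u. (P u, Q u))"
  unfolding smooth_plot_def
proof (intro conjI ballI allI)
  note PD = smooth_plotD[OF assms(1)] and QD = smooth_plotD[OF assms(2)]
  show "openin (Euclidean_space n) U" by (rule PD)
  show "(\<lambda>u. (P u, Q u)) ` U \<subseteq> mpoints (prod_mfd M N)"
    using PD(2) QD(2) by (auto simp: prod_mfd_def)
  fix c assume "c \<in> matlas (prod_mfd M N)"
  then obtain a b where ab: "a \<in> matlas M" "b \<in> matlas N"
    and c: "c = (fst a \<times> fst b, \<lambda>p i. if i < mdim M then snd a (fst p) i else snd b (snd p) (i - mdim M))"
    by (auto simp: prod_mfd_def)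
  have eq: "{u \<in> U. (P u, Q u) \<in> fst c} = {u \<in> U. P u \<in> fst a} \<inter> {u \<in> U. Q u \<in> fst b}"
    by (auto simp: c)
  show "openin (Euclidean_space n) {u \<in> U. (P u, Q u) \<in> fst c}"
    unfolding eq using PD(3)[OF ab(1)] QD(3)[OF ab(2)] by (rule openin_Int)
  show "smooth_fun n {u \<in> U. (P u, Q u) \<in> fst c} (\<lambda>u. snd c (P u, Q u) i)" for i
  proof (cases "i < mdim M")
    case True
    then show ?thesis unfolding eq using smooth_fun_subset[OF PD(4)[OF ab(1)]] by (simp add: c)
  next
    case False
    then show ?thesis unfolding eq using smooth_fun_subset[OF QD(4)[OF ab(2)]] by (simp add: c)
  qed
qed

text \<open>Smoothness of multiplication and of the action is stated on \<open>prod_mfd\<close>.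
  Once the product charts form a \<open>chart_cover\<close>, these maps can be applied to pairs of
  plots.\<close>

lemma chart_cover_prod:
  assumes "chart_cover M" "chart_cover N"
  shows "chart_cover (prod_mfd M N)"
  unfolding chart_cover_def
proof (intro conjI ballI)
  show "(\<Union>c\<in>matlas (prod_mfd M N). fst c) = mpoints (prod_mfd M N)"
  proof -
    have "(\<Union>c\<in>matlas (prod_mfd M N). fst c) = (\<Union>c\<in>matlas M. fst c) \<times> (\<Union>c\<in>matlas N. fst c)"
    proof (intro equalityI subsetI)
      fix p assume "p \<in> (\<Union>c\<in>matlas (prod_mfd M N). fst c)"
      then show "p \<in> (\<Union>c\<in>matlas M. fst c) \<times> (\<Union>c\<in>matlas N. fst c)"
        by (auto simp: prod_mfd_def)
    next
      fix p assume "p \<in> (\<Union>c\<in>matlas M. fst c) \<times> (\<Union>c\<in>matlas N. fst c)"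
      then obtain a b where ab: "a \<in> matlas M" "b \<in> matlas N" "fst p \<in> fst a" "snd p \<in> fst b"
        by (auto simp: mem_Times_iff)
      then have "(fst a \<times> fst b, \<lambda>p i. if i < mdim M then snd a (fst p) i else snd b (snd p) (i - mdim M))
          \<in> matlas (prod_mfd M N)"
        unfolding prod_mfd_def mfd.simps mem_Collect_eq by (intro exI[of _ a] exI[of _ b] conjI refl)
      moreover have "p \<in> fst a \<times> fst b" using ab by (simp add: mem_Times_iff)
      ultimately show "p \<in> (\<Union>c\<in>matlas (prod_mfd M N). fst c)" by (intro UN_I) (assumption, simp only: fst_conv)
    qed
    then show ?thesis using assms unfolding chart_cover_def by (simp add: prod_mfd_def)
  qed
  fix c assume "c \<in> matlas (prod_mfd M N)"
  then obtain a b where ab: "a \<in> matlas M" "b \<in> matlas N"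
    and c: "c = (fst a \<times> fst b, \<lambda>p i. if i < mdim M then snd a (fst p) i else snd b (snd p) (i - mdim M))"
    by (auto simp: prod_mfd_def)
  note A = chart_coverD[OF assms(1) ab(1)] and B = chart_coverD[OF assms(2) ab(2)]
  let ?m = "mdim M" and ?n = "mdim N"
  have top: "mtop (prod_mfd M N) = prod_topology (mtop M) (mtop N)" "mdim (prod_mfd M N) = ?m + ?n"
    by (simp_all add: prod_mfd_def)
  show "openin (mtop (prod_mfd M N)) (fst c)"
    unfolding top using A(1) B(1) by (simp add: c openin_prod_Times_iff)
  show "inj_on (snd c) (fst c)"
  proof (rule inj_onI)
    fix p q assume pq: "p \<in> fst c" "q \<in> fst c" "snd c p = snd c q"
    have "snd a (fst p) i = snd a (fst q) i" for i
    proof (cases "i < ?m")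
      case True
      then show ?thesis using fun_cong[OF pq(3), of i] by (simp add: c)
    next
      \<comment> \<open>From \<open>?m\<close> on the first chart vanishes for both points, so the
        entries that c stores there for the second chart do not interfere.\<close>
      case False
      then show ?thesis using A(10)[of "fst p"] A(10)[of "fst q"] pq by (auto simp: c Rn_iff)
    qed
    then have "snd a (fst p) = snd a (fst q)" by (rule ext)
    then have 1: "fst p = fst q" by (rule inj_onD[OF A(2)]) (use pq in \<open>auto simp: c\<close>)
    have "snd b (snd p) i = snd b (snd q) i" for i
      using fun_cong[OF pq(3), of "i + ?m"] by (simp add: c)
    then have "snd b (snd p) = snd b (snd q)" by (rule ext)
    then have 2: "snd p = snd q" by (rule inj_onD[OF B(2)]) (use pq in \<open>auto simp: c\<close>)
    show "p = q" using 1 2 by (rule prod_eqI)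
  qed
  let ?f = "\<lambda>z::vec. \<lambda>i. if i < ?m then z i else 0" and ?g = "\<lambda>z::vec. \<lambda>i. z (i + ?m)"
  have R: "openin (Euclidean_space (?m + ?n)) (Rn (?m + ?n))" by simp
  have f: "euclid_smooth_map (?m + ?n) (Rn (?m + ?n)) ?m (Rn ?m) ?f"
    unfolding euclid_smooth_map_def
    by (auto simp: Rn_iff image_subset_iff intro: smooth_fun_coord[OF R])
  have g: "euclid_smooth_map (?m + ?n) (Rn (?m + ?n)) ?n (Rn ?n) ?g"
    unfolding euclid_smooth_map_def
    by (auto simp: Rn_iff image_subset_iff intro: smooth_fun_coord[OF R])
  \<comment> \<open>The image of a product chart is cut out by the two coordinate projections, hence
    open as an intersection of preimages.\<close>
  have "snd c ` fst c = {z \<in> Rn (?m + ?n). ?f z \<in> snd a ` fst a} \<inter> {z \<in> Rn (?m + ?n). ?g z \<in> snd b ` fst b}"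
    (is "_ = ?S")
  proof
    show "snd c ` fst c \<subseteq> ?S"
    proof
      fix z assume "z \<in> snd c ` fst c"
      then obtain p where p: "z = snd c p" "p \<in> fst c" by (rule imageE)
      define x y where "x = fst p" and "y = snd p"
      have xy: "x \<in> fst a" "y \<in> fst b" "z = (\<lambda>i. if i < ?m then snd a x i else snd b y (i - ?m))"
        using p by (auto simp: c x_def y_def)
      have "?f z = snd a x" using A(10)[OF xy(1)] by (auto simp: xy(3) Rn_iff fun_eq_iff)
      moreover have "?g z = snd b y" by (simp add: xy(3))
      moreover have "z \<in> Rn (?m + ?n)" using B(10)[OF xy(2)] by (auto simp: xy(3) Rn_iff)
      ultimately show "z \<in> ?S" using xy by auto
    qed
    show "?S \<subseteq> snd c ` fst c"
    proof
      fix z assume z: "z \<in> ?S"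
      then obtain x y where xy: "x \<in> fst a" "y \<in> fst b" "?f z = snd a x" "?g z = snd b y" by blast
      have "snd c (x, y) i = z i" for i
        using fun_cong[OF xy(3), of i] fun_cong[OF xy(4), of "i - ?m"] by (auto simp: c)
      then have "z = snd c (x, y)" by (simp add: fun_eq_iff)
      then show "z \<in> snd c ` fst c" using xy by (auto simp: c)
    qed
  qed
  then show "openin (Euclidean_space (mdim (prod_mfd M N))) (snd c ` fst c)"
    unfolding top
    by (simp only:) (intro openin_Int euclid_smooth_map_vimage[OF f A(3)] euclid_smooth_map_vimage[OF g B(3)])
  show "continuous_map (subtopology (mtop (prod_mfd M N)) (fst c)) (Euclidean_space (mdim (prod_mfd M N))) (snd c)"
  proof -
    have A': "continuous_map (subtopology (mtop M) (fst a)) euclideanreal (\<lambda>x. snd a x i)" for i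
      using A(4) unfolding Euclidean_space_def continuous_map_in_subtopology
      by (simp add: continuous_map_componentwise_UNIV)
    have B': "continuous_map (subtopology (mtop N) (fst b)) euclideanreal (\<lambda>x. snd b x i)" for i
      using B(4) unfolding Euclidean_space_def continuous_map_in_subtopology
      by (simp add: continuous_map_componentwise_UNIV)
    have eq: "subtopology (prod_topology (mtop M) (mtop N)) (fst c)
        = prod_topology (subtopology (mtop M) (fst a)) (subtopology (mtop N) (fst b))"
      by (simp add: c subtopology_Times)
    have 1: "continuous_map (subtopology (prod_topology (mtop M) (mtop N)) (fst c)) euclideanreal (\<lambda>p. snd c p i)" for i
      unfolding eq
      using continuous_map_compose[OF continuous_map_fst A', unfolded comp_def]
        continuous_map_compose[OF continuous_map_snd B', unfolded comp_def]
      by (cases "i < ?m") (simp_all add: c)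
    have 2: "snd c p i = 0" if "p \<in> fst c" "i \<ge> ?m + ?n" for p i
      using that B(10)[of "snd p"] by (auto simp: c Rn_iff)
    show ?thesis
      unfolding top Euclidean_space_def continuous_map_in_subtopology continuous_map_componentwise_UNIV
      using 1 2 by auto
  qed
qed

lemma smooth_plot_map2:
  assumes "chart_cover M" "chart_cover N" "smooth_map (prod_mfd M N) K F"
    "smooth_plot M n U P" "smooth_plot N n U Q"
  shows "smooth_plot K n U (\<lambda>u. F (P u, Q u))"
  by (rule smooth_plot_map[OF chart_cover_prod[OF assms(1,2)] assms(3) smooth_plot_prod[OF assms(4,5)]])

section \<open>Derivatives of plots and tangent vectors\<close>

lemma plot_deriv_cong:
  fixes M :: "'a mfd"
  assumes "openin (Euclidean_space n) U" "u \<in> U" "\<xi> \<in> Rn n" "\<And>y. y \<in> U \<Longrightarrow> P y = Q y"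
  shows "plot_deriv M P u \<xi> = plot_deriv M Q u \<xi>"
proof
  fix c :: "'a mchart"
  have "vderiv (\<lambda>y. snd c (P y)) u \<xi> = vderiv (\<lambda>y. snd c (Q y)) u \<xi>"
    by (rule vderiv_cong[OF assms(1-3)]) (simp only: assms(4))
  then show "plot_deriv M P u \<xi> c = plot_deriv M Q u \<xi> c"
    unfolding plot_deriv_def assms(4)[OF assms(2)] by (simp only:)
qed

lemma plot_deriv_at: "c \<in> charts_at M (P u) \<Longrightarrow> plot_deriv M P u \<xi> c = vderiv (\<lambda>y. snd c (P y)) u \<xi>"
  and plot_deriv_off: "c \<notin> charts_at M (P u) \<Longrightarrow> plot_deriv M P u \<xi> c = (\<lambda>i. 0)"
  by (simp_all add: plot_deriv_def)

lemma plot_curve_DERIV: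
  assumes M: "chart_cover M" and P: "smooth_plot M n U P" and u: "\<eta> t0 \<in> U"
    and c: "c \<in> charts_at M (P (\<eta> t0))"
    and ev: "\<forall>\<^sub>F t in at t0. \<eta> t \<in> Rn n" and v: "\<xi> \<in> Rn n"
    and der: "\<And>i. i < n \<Longrightarrow> ((\<lambda>t. \<eta> t i) has_real_derivative \<xi> i) (at t0)"
  shows "((\<lambda>t. snd c (P (\<eta> t)) i) has_real_derivative plot_deriv M P (\<eta> t0) \<xi> c i) (at t0)"
  unfolding plot_deriv_at[where P=P and u="\<eta> t0", OF c]
  by (rule vderiv_curve[OF smooth_plot_rep[OF M P charts_atD(1)[OF c]] _ ev v der])
    (use u charts_atD(2)[OF c] in auto)

lemma plot_deriv_compose:
  assumes M: "chart_cover M" and P: "smooth_plot M n U P" and f: "euclid_smooth_map m V n U f"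
    and v: "v \<in> V" and \<xi>: "\<xi> \<in> Rn m"
  shows "plot_deriv M (\<lambda>y. P (f y)) v \<xi> = plot_deriv M P (f v) (vderiv f v \<xi>)"
proof
  fix c
  show "plot_deriv M (\<lambda>y. P (f y)) v \<xi> c = plot_deriv M P (f v) (vderiv f v \<xi>) c"
  proof (cases "c \<in> charts_at M (P (f v))")
    case True
    note c = charts_atD[OF True] and fD = euclid_smooth_mapD[OF f]
    let ?U = "{u \<in> U. P u \<in> fst c}" and ?V = "{y \<in> V. f y \<in> {u \<in> U. P u \<in> fst c}}"
    have "euclid_smooth_map m ?V n ?U f"
      by (rule euclid_smooth_map_restrict[OF f euclid_smooth_map_vimage[OF f smooth_plotD(3)[OF P c(1)]] _ smooth_plotD(3)[OF P c(1)]])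
        auto
    from vderiv_chain[OF this smooth_plot_rep[OF M P c(1)] _ \<xi>, of v] show ?thesis
      using v c(2) fD(5)[OF v] True by (simp add: plot_deriv_at)
  qed (simp add: plot_deriv_off)
qed

lemma transition_smooth:
  assumes M: "smooth_manifold M" and c: "c \<in> matlas M" and c': "c' \<in> matlas M"
  shows "euclid_smooth_map (mdim M) (snd c ` (fst c \<inter> fst c')) (mdim M) (snd c' ` fst c') (\<lambda>y. snd c' (param c y))"
proof -
  note D = smooth_manifoldD[OF M]
  note C = chart_coverD[OF D(2) c] and C' = chart_coverD[OF D(2) c']
  show ?thesis
    unfolding euclid_smooth_map_def
    using D(3)[OF c C'(1)] C'(3) D(4)[OF c c'] C(7) by auto
qed

lemma plot_deriv_tangent:
  assumes M: "smooth_manifold M" and P: "smooth_plot M n U P" and u: "u \<in> U" and \<xi>: "\<xi> \<in> Rn n"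
  shows "plot_deriv M P u \<xi> \<in> tangent_space M (P u)"
proof -
  note cc = smooth_manifoldD(2)[OF M]
  have 1: "plot_deriv M P u \<xi> c \<in> Rn (mdim M)" if c: "c \<in> charts_at M (P u)" for c
    unfolding plot_deriv_at[where P=P and u=u, OF c]
    by (rule vderiv_in_Rn[OF smooth_plot_rep[OF cc P charts_atD(1)[OF c]] _ \<xi>]) (use u charts_atD(2)[OF c] in simp)
  have 2: "plot_deriv M P u \<xi> c' = vderiv (\<lambda>y. snd c' (param c y)) (snd c (P u)) (plot_deriv M P u \<xi> c)"
    if c: "c \<in> charts_at M (P u)" and c': "c' \<in> charts_at M (P u)" for c c'
  proof -
    note cD = charts_atD[OF c] and cD' = charts_atD[OF c']
    note C = chart_coverD[OF cc cD(1)]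
    let ?V = "{u \<in> U. P u \<in> fst c} \<inter> {u \<in> U. P u \<in> fst c'}"
    have V: "openin (Euclidean_space n) ?V"
      by (intro openin_Int smooth_plotD(3)[OF P] cD(1) cD'(1))
    have rep: "euclid_smooth_map n ?V (mdim M) (snd c ` (fst c \<inter> fst c')) (\<lambda>u. snd c (P u))"
      by (rule euclid_smooth_map_restrict[OF smooth_plot_rep[OF cc P cD(1)] V _ euclid_smooth_mapD(1)[OF transition_smooth[OF M cD(1) cD'(1)]]])
        auto
    have uV: "u \<in> ?V" using u cD(2) cD'(2) by simp
    have "vderiv (\<lambda>y. snd c' (P y)) u \<xi> = vderiv (\<lambda>y. snd c' (param c (snd c (P y)))) u \<xi>"
      by (rule vderiv_cong[OF V uV \<xi>]) (simp add: C(7))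
    also have "\<dots> = vderiv (\<lambda>y. snd c' (param c y)) (snd c (P u)) (vderiv (\<lambda>y. snd c (P y)) u \<xi>)"
      by (rule vderiv_chain[OF rep transition_smooth[OF M cD(1) cD'(1)] uV \<xi>])
    finally show ?thesis by (simp add: plot_deriv_at[where P=P and u=u, OF c] plot_deriv_at[where P=P and u=u, OF c'])
  qed
  show ?thesis unfolding tangent_space_def
    by (intro CollectI conjI allI impI ballI 1 2 plot_deriv_off)
qed

text \<open>A tangent vector is determined by its entry in one chart: the compatibility condition in
  \<open>tangent_space\<close> is the formula for the derivative of \<open>param c\<close> as read
  in the other charts.\<close>

lemma tangent_rep:
  assumes "chart_cover M" "v \<in> tangent_space M x" "c \<in> charts_at M x"
  shows "v = plot_deriv M (param c) (snd c x) (v c)"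
proof
  fix c'
  have p: "param c (snd c x) = x" using chart_coverD(7)[OF assms(1)] charts_atD[OF assms(3)] by blast
  show "v c' = plot_deriv M (param c) (snd c x) (v c) c'"
  proof (cases "c' \<in> charts_at M x")
    case True
    have "v c' = vderiv (\<lambda>y. snd c' (param c y)) (snd c x) (v c)"
      using assms(2,3) True unfolding tangent_space_def by blast
    then show ?thesis using True by (simp only: plot_deriv_def p if_True)
  next
    case False
    have "v c' = (\<lambda>i. 0)"
      using assms(2) False unfolding tangent_space_def by blast
    then show ?thesis using False by (simp only: plot_deriv_def p if_False)
  qed
qed

lemma tangent_eqI:
  assumes "chart_cover M" "v \<in> tangent_space M x" "w \<in> tangent_space M x" "c \<in> charts_at M x" "v c = w c"
  shows "v = w"
  by (rule trans[OF tangent_rep[OF assms(1,2,4)] trans[OF _ tangent_rep[OF assms(1,3,4), symmetric]]])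
    (simp only: assms(5))

lemma tangent_in_Rn: "v \<in> tangent_space M x \<Longrightarrow> c \<in> charts_at M x \<Longrightarrow> v c \<in> Rn (mdim M)"
  unfolding tangent_space_def by blast

lemma param_deriv_at:
  assumes M: "smooth_manifold M" and c: "c \<in> charts_at M x" and \<zeta>: "\<zeta> \<in> Rn (mdim M)"
  shows "plot_deriv M (param c) (snd c x) \<zeta> c = \<zeta>"
    "plot_deriv M (param c) (snd c x) \<zeta> \<in> tangent_space M x"
proof -
  note cD = charts_atD[OF c]
  note C = chart_coverD[OF smooth_manifoldD(2)[OF M] cD(1)]
  have p: "param c (snd c x) = x" by (rule C(7)[OF cD(2)])
  have "vderiv (\<lambda>y. snd c (param c y)) (snd c x) \<zeta> = vderiv (\<lambda>y. y) (snd c x) \<zeta>"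
    by (rule vderiv_cong[OF C(3) C(8)[OF cD(2)] \<zeta>]) (rule C(6))
  then show "plot_deriv M (param c) (snd c x) \<zeta> c = \<zeta>"
    using c by (simp add: plot_deriv_def p vderiv_id)
  show "plot_deriv M (param c) (snd c x) \<zeta> \<in> tangent_space M x"
    using plot_deriv_tangent[OF M smooth_plot_param[OF M cD(1)] C(8)[OF cD(2)] \<zeta>] by (simp add: p)
qed

text \<open>\<open>tangent_map\<close> is computed in an arbitrarily chosen chart. On velocities of
  plots this identity describes it without reference to the choice, and in this form invariance is
  later applied to pullbacks.\<close>

lemma tangent_map_plot:
  assumes M: "smooth_manifold M" and N: "chart_cover N" and F: "smooth_map M N F"
    and P: "smooth_plot M n U P" and u: "u \<in> U" and \<xi>: "\<xi> \<in> Rn n"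
  shows "tangent_map M N F (P u) (plot_deriv M P u \<xi>) = plot_deriv N (\<lambda>y. F (P y)) u \<xi>"
proof -
  note cc = smooth_manifoldD(2)[OF M]
  define c where "c = some_chart M (P u)"
  have c: "c \<in> charts_at M (P u)"
    unfolding c_def by (rule some_chart_at[OF cc smooth_plotD(2)[OF P u]])
  note cD = charts_atD[OF c]
  note C = chart_coverD[OF cc cD(1)]
  let ?V = "{u \<in> U. P u \<in> fst c}"
  note V = smooth_plotD(3)[OF P cD(1)]
  have uV: "u \<in> ?V" using u cD(2) by simp
  have Fp: "smooth_plot N (mdim M) (snd c ` fst c) (\<lambda>y. F (param c y))"
    using F cD(1) unfolding smooth_map_def by blast
  have "plot_deriv N (\<lambda>y. F (P y)) u \<xi> = plot_deriv N (\<lambda>y. F (param c (snd c (P y)))) u \<xi>"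
    by (rule plot_deriv_cong[OF V uV \<xi>]) (simp add: C(7))
  also have "\<dots> = plot_deriv N (\<lambda>y. F (param c y)) (snd c (P u)) (vderiv (\<lambda>y. snd c (P y)) u \<xi>)"
    by (rule plot_deriv_compose[OF N Fp smooth_plot_rep[OF cc P cD(1)] uV \<xi>])
  finally show ?thesis
    unfolding tangent_map_def Let_def c_def[symmetric] plot_deriv_at[where P=P and u=u, OF c] by simp
qed

lemma plot_deriv_linear:
  assumes M: "chart_cover M" and P: "smooth_plot M n U P" and u: "u \<in> U"
    and \<xi>: "\<xi> \<in> Rn n" "\<zeta> \<in> Rn n"
  shows "plot_deriv M P u (\<lambda>j. s * \<xi> j + t * \<zeta> j)
    = tadd (tscale s (plot_deriv M P u \<xi>)) (tscale t (plot_deriv M P u \<zeta>))"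
proof
  fix c
  show "plot_deriv M P u (\<lambda>j. s * \<xi> j + t * \<zeta> j) c
    = tadd (tscale s (plot_deriv M P u \<xi>)) (tscale t (plot_deriv M P u \<zeta>)) c"
  proof (cases "c \<in> charts_at M (P u)")
    case True
    note cD = charts_atD[OF True]
    show ?thesis
      unfolding tadd_def tscale_def plot_deriv_at[where P=P and u=u, OF True]
      by (rule vderiv_linear[OF smooth_plot_rep[OF M P cD(1)] _ \<xi>]) (use u cD(2) in simp)
  qed (simp add: plot_deriv_off tadd_def tscale_def)
qed

section \<open>Differential forms\<close>

lemma vecs_update: "vs \<in> vecs n k \<Longrightarrow> v \<in> Rn n \<Longrightarrow> vs[i := v] \<in> vecs n k"
  unfolding vecs_def using set_update_subset_insert[of vs i v] by auto

lemma alternating_form_add: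
  assumes "alternating_form n k A" "vs \<in> vecs n k" "i < k" "v \<in> Rn n" "w \<in> Rn n"
  shows "A (vs[i := (\<lambda>j. s * v j + t * w j)]) = s * A (vs[i := v]) + t * A (vs[i := w])"
  using assms unfolding alternating_form_def by blast

lemma alternating_form_expand:
  assumes A: "alternating_form n k A" and vs: "vs \<in> vecs n k" and p: "p < k" and v: "v \<in> Rn n"
  shows "A (vs[p := v]) = (\<Sum>i<n. v i * A (vs[p := basis_vec i]))"
proof -
  \<comment> \<open>Induction over truncations of v, adding one coordinate at a time by linearity in
    two vectors.\<close>
  have "A (vs[p := (\<lambda>l. if l < j then v l else 0)]) = (\<Sum>i<j. v i * A (vs[p := basis_vec i]))" if "j \<le> n" for j
    using that
  proof (induction j)
    case 0
    \<comment> \<open>Linearity with both scalars 0 shows that a zero entry makes the value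
      0.\<close>
    have "(\<lambda>l. 0) = (\<lambda>j::nat. 0 * v j + 0 * v j)" by simp
    then show ?case using alternating_form_add[OF A vs p v v, of 0 0] by simp
  next
    case (Suc j)
    have b: "basis_vec j \<in> Rn n" and t: "(\<lambda>l. if l < j then v l else 0) \<in> Rn n"
      using Suc v by (auto simp: Rn_iff basis_vec_def)
    have eq: "(\<lambda>l. if l < Suc j then v l else 0) = (\<lambda>l. 1 * (if l < j then v l else 0) + v j * basis_vec j l)"
      by (auto simp: basis_vec_def fun_eq_iff less_Suc_eq)
    show ?case unfolding eq using alternating_form_add[OF A vs p t b, of 1 "v j"] Suc by simp
  qed
  from this[of n] have "A (vs[p := (\<lambda>l. if l < n then v l else 0)]) = (\<Sum>i<n. v i * A (vs[p := basis_vec i]))" by simp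
  moreover have "(\<lambda>l. if l < n then v l else 0) = v" using v by (auto simp: Rn_iff fun_eq_iff)
  ultimately show ?thesis by simp
qed

lemma euclid_formD:
  assumes "euclid_form n k U a"
  shows "u \<in> U \<Longrightarrow> alternating_form n k (a u)" "vs \<in> vecs n k \<Longrightarrow> smooth_fun n U (\<lambda>u. a u vs)"
  using assms unfolding euclid_form_def by auto

text \<open>By definition a form is smooth only for constant arguments. Each moving argument is
  expanded in the basis, leftmost first; its coefficients are smooth, and the basis vector that
  replaces it joins the constant list cs.\<close>

lemma euclid_form_smooth_args:
  assumes a: "euclid_form n k U a" and g: "euclid_smooth_map m V n U g"
  shows "set cs \<subseteq> Rn n \<Longrightarrow> (\<And>w x. w \<in> set ws \<Longrightarrow> x \<in> V \<Longrightarrow> w x \<in> Rn n) \<Longrightarrow>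
    (\<And>w i. w \<in> set ws \<Longrightarrow> smooth_fun m V (\<lambda>x. w x i)) \<Longrightarrow> length cs + length ws = k \<Longrightarrow>
    smooth_fun m V (\<lambda>x. a (g x) (cs @ map (\<lambda>w. w x) ws))"
proof (induction ws arbitrary: cs)
  case Nil
  then have "cs \<in> vecs n k" by (simp add: vecs_def)
  then show ?case using euclid_smooth_map_smooth_fun[OF g euclid_formD(2)[OF a]] by simp
next
  case (Cons w ws)
  note gD = euclid_smooth_mapD[OF g]
  have "smooth_fun m V (\<lambda>x. a (g x) ((cs @ [basis_vec i]) @ map (\<lambda>w. w x) ws))" if "i < n" for i
    by (rule Cons.IH) (use Cons.prems basis_vec_Rn[OF that] in auto)
  then have "smooth_fun m V (\<lambda>x. \<Sum>i<n. w x i * a (g x) ((cs @ [basis_vec i]) @ map (\<lambda>w. w x) ws))"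
    by (intro smooth_fun_sum smooth_fun_mult gD(1)) (use Cons.prems in auto)
  moreover have "a (g x) (cs @ map (\<lambda>w. w x) (w # ws))
      = (\<Sum>i<n. w x i * a (g x) ((cs @ [basis_vec i]) @ map (\<lambda>w. w x) ws))" if x: "x \<in> V" for x
  proof -
    have wx: "w x \<in> Rn n" using Cons.prems(2)[of w x] x by simp
    have vs: "cs @ w x # map (\<lambda>w. w x) ws \<in> vecs n k"
      unfolding vecs_def using Cons.prems(1,2,4) x by auto
    have p: "length cs < k" using Cons.prems by simp
    from alternating_form_expand[OF euclid_formD(1)[OF a gD(5)[OF x]] vs p wx]
    show ?thesis by (simp add: list_update_append)
  qed
  ultimately show ?case
    using smooth_fun_cong[OF gD(1), of "\<lambda>x. a (g x) (cs @ map (\<lambda>w. w x) (w # ws))"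
      "\<lambda>x. \<Sum>i<n. w x i * a (g x) ((cs @ [basis_vec i]) @ map (\<lambda>w. w x) ws)"] by blast
qed

lemma euclid_pullback_form:
  assumes a: "euclid_form n k U a" and f: "euclid_smooth_map m V n U f"
  shows "euclid_form m k V (euclid_pullback f a)"
  unfolding euclid_form_def
proof (intro conjI ballI)
  note fD = euclid_smooth_mapD[OF f]
  fix x assume x: "x \<in> V"
  note A = euclid_formD(1)[OF a fD(5)[OF x]]
  have mv: "map (vderiv f x) vs \<in> vecs n k" if "vs \<in> vecs m k" for vs
    using that vderiv_in_Rn[OF f x] unfolding vecs_def by auto
  show "alternating_form m k (euclid_pullback f a x)"
    unfolding alternating_form_def euclid_pullback_def
  proof (intro conjI ballI allI impI)
    fix vs i v w s t
    assume h: "vs \<in> vecs m k" "i < k" "v \<in> Rn m" "w \<in> Rn m"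
    show "a (f x) (map (vderiv f x) (vs[i := (\<lambda>j. s * v j + t * w j)]))
        = s * a (f x) (map (vderiv f x) (vs[i := v])) + t * a (f x) (map (vderiv f x) (vs[i := w]))"
      unfolding map_update vderiv_linear[OF f x h(3,4)]
      by (rule alternating_form_add[OF A mv[OF h(1)] h(2) vderiv_in_Rn[OF f x h(3)] vderiv_in_Rn[OF f x h(4)]])
  next
    fix vs i j
    assume h: "vs \<in> vecs m k" "i < j \<and> j < k \<and> vs ! i = vs ! j"
    then have "length vs = k" by (simp add: vecs_def)
    then have "map (vderiv f x) vs ! i = map (vderiv f x) vs ! j" using h by simp
    then show "a (f x) (map (vderiv f x) vs) = 0"
      using A mv[OF h(1)] h(2) unfolding alternating_form_def by blast
  qed
next
  fix vs assume vs: "vs \<in> vecs m k"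
  note fD = euclid_smooth_mapD[OF f]
  have vR: "v \<in> Rn m" if "v \<in> set vs" for v using vs that unfolding vecs_def by blast
  have "smooth_fun m V (\<lambda>x. a (f x) ([] @ map (\<lambda>w. w x) (map (\<lambda>v x. vderiv f x v) vs)))"
  proof (rule euclid_form_smooth_args[OF a f])
    show "w x \<in> Rn n" if "w \<in> set (map (\<lambda>v x. vderiv f x v) vs)" "x \<in> V" for w x
      using that vderiv_in_Rn[OF f that(2)] vR by auto
    show "smooth_fun m V (\<lambda>x. w x i)" if "w \<in> set (map (\<lambda>v x. vderiv f x v) vs)" for w i
    proof -
      obtain v where "v \<in> set vs" "w = (\<lambda>x. vderiv f x v)" using \<open>w \<in> _\<close> by auto
      then show ?thesis
        using smooth_fun_dderiv[OF fD(1) euclid_smooth_map_coord[OF f, of i] vR] by (simp add: vderiv_def)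
    qed
  qed (use vs in \<open>auto simp: vecs_def\<close>)
  then show "smooth_fun m V (\<lambda>x. euclid_pullback f a x vs)"
    by (simp add: euclid_pullback_def comp_def)
qed

text \<open>Both defining conditions evaluate the form only on lists in \<open>vecs n k\<close>;
  elsewhere A and B may differ.\<close>

lemma alternating_form_cong:
  assumes "\<And>vs. vs \<in> vecs n k \<Longrightarrow> A vs = B vs"
  shows "alternating_form n k A \<longleftrightarrow> alternating_form n k B"
proof -
  have "(\<forall>vs\<in>vecs n k. \<forall>i<k. \<forall>v\<in>Rn n. \<forall>w\<in>Rn n. \<forall>s t.
        A (vs[i := (\<lambda>j. s * v j + t * w j)]) = s * A (vs[i := v]) + t * A (vs[i := w])) \<longleftrightarrow>
     (\<forall>vs\<in>vecs n k. \<forall>i<k. \<forall>v\<in>Rn n. \<forall>w\<in>Rn n. \<forall>s t.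
        B (vs[i := (\<lambda>j. s * v j + t * w j)]) = s * B (vs[i := v]) + t * B (vs[i := w]))"
  proof (intro ball_cong refl iff_allI imp_cong)
    fix vs i v w s t
    assume h: "vs \<in> vecs n k" "v \<in> Rn n" "w \<in> Rn n"
    have e: "A (vs[i := u]) = B (vs[i := u])" if "u \<in> Rn n" for u
      by (rule assms[OF vecs_update[OF h(1) that]])
    have l: "(\<lambda>j. s * v j + t * w j) \<in> Rn n" using h by (simp add: Rn_iff)
    show "(A (vs[i := (\<lambda>j. s * v j + t * w j)]) = s * A (vs[i := v]) + t * A (vs[i := w])) =
        (B (vs[i := (\<lambda>j. s * v j + t * w j)]) = s * B (vs[i := v]) + t * B (vs[i := w]))"
      by (simp only: e[OF l] e[OF h(2)] e[OF h(3)])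
  qed
  moreover have "(\<forall>vs\<in>vecs n k. \<forall>i j. i < j \<and> j < k \<and> vs ! i = vs ! j \<longrightarrow> A vs = 0) \<longleftrightarrow>
     (\<forall>vs\<in>vecs n k. \<forall>i j. i < j \<and> j < k \<and> vs ! i = vs ! j \<longrightarrow> B vs = 0)"
    by (intro ball_cong refl iff_allI imp_cong) (simp only: assms)
  ultimately show ?thesis unfolding alternating_form_def by (rule conj_cong)
qed

lemma euclid_form_local:
  assumes U: "openin (Euclidean_space n) U"
    and loc: "\<And>u. u \<in> U \<Longrightarrow> \<exists>V b. openin (Euclidean_space n) V \<and> u \<in> V \<and> V \<subseteq> U \<and> euclid_form n k V b \<and>
        (\<forall>v\<in>V. \<forall>vs\<in>vecs n k. a v vs = b v vs)"
  shows "euclid_form n k U a"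
  unfolding euclid_form_def
proof (intro conjI ballI)
  fix u assume "u \<in> U"
  from loc[OF this] obtain V b where V: "openin (Euclidean_space n) V" "u \<in> V" "euclid_form n k V b"
    "\<And>v vs. v \<in> V \<Longrightarrow> vs \<in> vecs n k \<Longrightarrow> a v vs = b v vs" by blast
  show "alternating_form n k (a u)"
    by (rule iffD2[OF alternating_form_cong euclid_formD(1)[OF V(3,2)]]) (rule V(4)[OF V(2)])
next
  fix vs assume vs: "vs \<in> vecs n k"
  show "smooth_fun n U (\<lambda>u. a u vs)"
  proof (rule smooth_fun_local[OF U])
    fix u assume "u \<in> U"
    from loc[OF this] obtain V b where V: "openin (Euclidean_space n) V" "u \<in> V" "V \<subseteq> U" "euclid_form n k V b"
      "\<And>v vs. v \<in> V \<Longrightarrow> vs \<in> vecs n k \<Longrightarrow> a v vs = b v vs" by blast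
    have "smooth_fun n V (\<lambda>u. a u vs)"
      by (rule iffD2[OF smooth_fun_cong[OF V(1)] euclid_formD(2)[OF V(4) vs]]) (rule V(5)[OF _ vs])
    then show "\<exists>V. openin (Euclidean_space n) V \<and> u \<in> V \<and> V \<subseteq> U \<and> smooth_fun n V (\<lambda>u. a u vs)"
      using V(1-3) by (intro exI[of _ V] conjI)
  qed
qed

section \<open>Pullback of forms by plots\<close>

lemma plot_pullback_compose:
  assumes M: "chart_cover M" and P: "smooth_plot M n U P" and f: "euclid_smooth_map m V n U f"
    and v: "v \<in> V" and vs: "vs \<in> vecs m k"
  shows "plot_pullback M (\<lambda>y. P (f y)) \<omega> v vs = euclid_pullback f (plot_pullback M P \<omega>) v vs"
proof -
  have "map (plot_deriv M (\<lambda>y. P (f y)) v) vs = map (plot_deriv M P (f v)) (map (vderiv f v) vs)"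
    unfolding map_map by (rule map_cong[OF refl])
      (use vs plot_deriv_compose[OF M P f v] in \<open>auto simp: vecs_def\<close>)
  then show ?thesis by (simp only: plot_pullback_def euclid_pullback_def)
qed

lemma plot_pullback_cong:
  assumes "openin (Euclidean_space n) U" "u \<in> U" "vs \<in> vecs n k" "\<And>y. y \<in> U \<Longrightarrow> P y = Q y"
  shows "plot_pullback M P \<omega> u vs = plot_pullback M Q \<omega> u vs"
proof -
  have "map (plot_deriv M P u) vs = map (plot_deriv M Q u) vs"
    by (rule map_cong[OF refl], rule plot_deriv_cong[OF assms(1,2)]) (use assms(3,4) in \<open>auto simp: vecs_def\<close>)
  then show ?thesis by (simp only: plot_pullback_def assms(4)[OF assms(2)])
qed

text \<open>Locally P is its reading in a chart followed by \<open>param c\<close>, so the pullback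
  is the ordinary pullback of the chart expression of \<omega>, which \<open>mform\<close> makes a
  smooth form.\<close>

lemma plot_pullback_form:
  assumes M: "smooth_manifold M" and \<omega>: "mform M k \<omega>" and P: "smooth_plot M n U P"
  shows "euclid_form n k U (plot_pullback M P \<omega>)"
proof (rule euclid_form_local[OF smooth_plotD(1)[OF P]])
  note cc = smooth_manifoldD(2)[OF M]
  fix u assume u: "u \<in> U"
  obtain c where c: "c \<in> charts_at M (P u)" using charts_at_ex[OF cc smooth_plotD(2)[OF P u]] by blast
  note cD = charts_atD[OF c]
  note C = chart_coverD[OF cc cD(1)]
  let ?V = "{u \<in> U. P u \<in> fst c}"
  note rep = smooth_plot_rep[OF cc P cD(1)]
  note V = euclid_smooth_mapD(1)[OF rep]
  have "euclid_form (mdim M) k (snd c ` fst c) (plot_pullback M (param c) \<omega>)"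
    using \<omega> cD(1) unfolding mform_def by blast
  from euclid_pullback_form[OF this rep]
  have 1: "euclid_form n k ?V (euclid_pullback (\<lambda>u. snd c (P u)) (plot_pullback M (param c) \<omega>))" .
  have 2: "plot_pullback M P \<omega> v vs = euclid_pullback (\<lambda>u. snd c (P u)) (plot_pullback M (param c) \<omega>) v vs"
    if v: "v \<in> ?V" and vs: "vs \<in> vecs n k" for v vs
  proof -
    have "plot_pullback M P \<omega> v vs = plot_pullback M (\<lambda>y. param c (snd c (P y))) \<omega> v vs"
      by (rule plot_pullback_cong[OF V v vs]) (simp add: C(7))
    also have "\<dots> = euclid_pullback (\<lambda>u. snd c (P u)) (plot_pullback M (param c) \<omega>) v vs"
      by (rule plot_pullback_compose[OF cc smooth_plot_param[OF M cD(1)] rep v vs])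
    finally show ?thesis .
  qed
  show "\<exists>V b. openin (Euclidean_space n) V \<and> u \<in> V \<and> V \<subseteq> U \<and> euclid_form n k V b \<and>
        (\<forall>v\<in>V. \<forall>vs\<in>vecs n k. plot_pullback M P \<omega> v vs = b v vs)"
  proof (intro exI conjI ballI)
    show "u \<in> ?V" "?V \<subseteq> U" using u cD(2) by auto
  qed (rule V 1 | erule (1) 2)+
qed

text \<open>The derivative of \<open>param c\<close> maps coordinates linearly onto the tangent
  space, so multilinearity of the chart expression transfers to tangent vectors. The second
  conclusion transfers the alternating property in the same way.\<close>

lemma mform_add:
  assumes M: "smooth_manifold M" and \<omega>: "mform M k \<omega>" and x: "x \<in> mpoints M"
    and vs: "length vs = k" "set vs \<subseteq> tangent_space M x" and i: "i < k"
    and v: "v \<in> tangent_space M x" and w: "w \<in> tangent_space M x"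
  shows "\<omega> x (vs[i := tadd v w]) = \<omega> x (vs[i := v]) + \<omega> x (vs[i := w])"
    "i < j \<Longrightarrow> j < k \<Longrightarrow> vs ! i = vs ! j \<Longrightarrow> \<omega> x vs = 0"
proof -
  note cc = smooth_manifoldD(2)[OF M]
  obtain c where c: "c \<in> charts_at M x" using charts_at_ex[OF cc x] by blast
  note cD = charts_atD[OF c]
  note C = chart_coverD[OF cc cD(1)]
  have p: "param c (snd c x) = x" by (rule C(7)[OF cD(2)])
  let ?A = "plot_pullback M (param c) \<omega> (snd c x)" and ?D = "plot_deriv M (param c) (snd c x)"
  have A: "alternating_form (mdim M) k ?A"
    using \<omega> cD C(8)[OF cD(2)] unfolding mform_def euclid_form_def by blast
  have D: "v = ?D (v c)" if "v \<in> tangent_space M x" for v by (rule tangent_rep[OF cc that c])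
  let ?vs = "map (\<lambda>v. v c) vs"
  have vsR: "?vs \<in> vecs (mdim M) k" using vs tangent_in_Rn[OF _ c] unfolding vecs_def by auto
  have mD: "map ?D ?vs = vs" unfolding map_map
    by (rule map_idI) (use vs D in force)
  have up: "\<omega> x (vs[i := ?D \<xi>]) = ?A (?vs[i := \<xi>])" for \<xi>
    unfolding plot_pullback_def map_update mD p ..
  have lin: "?D (\<lambda>j. s * \<xi> j + t * \<zeta> j) = tadd (tscale s (?D \<xi>)) (tscale t (?D \<zeta>))"
    if "\<xi> \<in> Rn (mdim M)" "\<zeta> \<in> Rn (mdim M)" for \<xi> \<zeta> s t
    by (rule plot_deriv_linear[OF cc smooth_plot_param[OF M cD(1)] C(8)[OF cD(2)] that])
  note vc = tangent_in_Rn[OF v c] and wc = tangent_in_Rn[OF w c]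
  have gen: "\<omega> x (vs[i := tadd (tscale s v) (tscale t w)]) = s * \<omega> x (vs[i := v]) + t * \<omega> x (vs[i := w])" for s t
  proof -
    have "tadd (tscale s v) (tscale t w) = ?D (\<lambda>j. s * v c j + t * w c j)"
      unfolding lin[OF vc wc] D[OF v, symmetric] D[OF w, symmetric] ..
    then have "\<omega> x (vs[i := tadd (tscale s v) (tscale t w)]) = ?A (?vs[i := (\<lambda>j. s * v c j + t * w c j)])"
      by (simp only: up)
    also have "\<dots> = s * ?A (?vs[i := v c]) + t * ?A (?vs[i := w c])"
      by (rule alternating_form_add[OF A vsR i vc wc])
    also have "\<dots> = s * \<omega> x (vs[i := v]) + t * \<omega> x (vs[i := w])"
      unfolding up[symmetric] D[OF v, symmetric] D[OF w, symmetric] ..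
    finally show ?thesis .
  qed
  show "\<omega> x (vs[i := tadd v w]) = \<omega> x (vs[i := v]) + \<omega> x (vs[i := w])"
    using gen[of 1 1] by (simp add: tscale_def)
  show "\<omega> x vs = 0" if "i < j" "j < k" "vs ! i = vs ! j"
  proof -
    have "?vs ! i = ?vs ! j" using that vs(1) by simp
    then have "?A ?vs = 0" using A vsR that unfolding alternating_form_def by blast
    then show ?thesis by (simp only: plot_pullback_def mD p)
  qed
qed

lemma tadd_tangent:
  assumes M: "smooth_manifold M" and x: "x \<in> mpoints M"
    and v: "v \<in> tangent_space M x" and w: "w \<in> tangent_space M x"
  shows "tadd (tscale s v) (tscale t w) \<in> tangent_space M x"
proof -
  note cc = smooth_manifoldD(2)[OF M]
  obtain c where c: "c \<in> charts_at M x" using charts_at_ex[OF cc x] by blast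
  note cD = charts_atD[OF c]
  note C = chart_coverD[OF cc cD(1)]
  note vc = tangent_in_Rn[OF v c] and wc = tangent_in_Rn[OF w c]
  have "tadd (tscale s v) (tscale t w) = plot_deriv M (param c) (snd c x) (\<lambda>j. s * v c j + t * w c j)"
    unfolding plot_deriv_linear[OF cc smooth_plot_param[OF M cD(1)] C(8)[OF cD(2)] vc wc]
      tangent_rep[OF cc v c, symmetric] tangent_rep[OF cc w c, symmetric] ..
  moreover have "(\<lambda>j. s * v c j + t * w c j) \<in> Rn (mdim M)" using vc wc by (simp add: Rn_iff)
  ultimately show ?thesis using param_deriv_at(2)[OF M c] by simp
qed

section \<open>Descent to the reduced space\<close>

text \<open>The form on the quotient must be written down before it is known to be well defined: its
  value at u is computed from an arbitrary local lift. The hypothesis \<open>unique\<close>, on the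
  intersection of two domains, makes all lifts agree, and each property is then checked on a
  convenient lift.\<close>

lemma carries_reduced_formI:
  fixes X :: "'x mfd"
  assumes X: "smooth_manifold X" and \<omega>: "mform X k \<omega>"
    and unique: "\<And>n U P Q u vs. smooth_plot X n U P \<Longrightarrow> P ` U \<subseteq> C \<Longrightarrow> smooth_plot X n U Q \<Longrightarrow> Q ` U \<subseteq> C \<Longrightarrow>
      (\<And>u. u \<in> U \<Longrightarrow> orbit G a (P u) = orbit G a (Q u)) \<Longrightarrow> u \<in> U \<Longrightarrow> vs \<in> vecs n k \<Longrightarrow>
      plot_pullback X P \<omega> u vs = plot_pullback X Q \<omega> u vs"
  shows "carries_reduced_form G X a C k \<omega>"
proof -
  note cc = smooth_manifoldD(2)[OF X]
  define lift where "lift n R u V Q \<longleftrightarrow> openin (Euclidean_space n) V \<and> u \<in> V \<and> smooth_plot X n V Q \<and>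
      Q ` V \<subseteq> C \<and> (\<forall>v\<in>V. R v = orbit G a (Q v))" for n and R :: "vec \<Rightarrow> 'x set" and u V Q
  \<comment> \<open>The value ignores U: it depends only on the germ of R at u.\<close>
  define \<alpha> :: "'x set diff_form" where
    "\<alpha> n U R u vs = plot_pullback X (SOME Q. \<exists>V. lift n R u V Q) \<omega> u vs" for n U R u vs
  have \<alpha>: "\<alpha> n U R u vs = plot_pullback X Q \<omega> u vs" if l: "lift n R u V Q" and vs: "vs \<in> vecs n k" for n U R u vs V Q
  proof -
    define Q' where "Q' = (SOME Q. \<exists>V. lift n R u V Q)"
    have "\<exists>Q V. lift n R u V Q" using l by blast
    from someI_ex[OF this] obtain V' where l': "lift n R u V' Q'" unfolding Q'_def ..
    note L = l[unfolded lift_def] and L' = l'[unfolded lift_def]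
    have o: "openin (Euclidean_space n) (V \<inter> V')" using L L' by blast
    have "plot_pullback X Q' \<omega> u vs = plot_pullback X Q \<omega> u vs"
    proof (rule unique[where U = "V \<inter> V'" and n=n])
      show "smooth_plot X n (V \<inter> V') Q'" "smooth_plot X n (V \<inter> V') Q"
        using smooth_plot_subset[OF _ o] L L' by blast+
      show "orbit G a (Q' v) = orbit G a (Q v)" if "v \<in> V \<inter> V'" for v
        using L L' that by (metis IntD1 IntD2)
    qed (use L L' vs in auto)
    then show ?thesis by (simp only: \<alpha>_def Q'_def)
  qed
  have lift_ex: "\<exists>V Q. lift n R u V Q \<and> V \<subseteq> U" if "reduced_diffeology G X a C n U R" "u \<in> U" for n U R u
    using that unfolding reduced_diffeology_def quotient_diffeology_def subset_diffeology_def lift_def by blast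
  have red_open: "openin (Euclidean_space n) U" if "reduced_diffeology G X a C n U R" for n U R
    using that unfolding reduced_diffeology_def quotient_diffeology_def by blast
  have form: "euclid_form n k U (\<alpha> n U R)" if R: "reduced_diffeology G X a C n U R" for n U R
  proof (rule euclid_form_local[OF red_open[OF R]])
    fix u assume u: "u \<in> U"
    obtain V Q where l: "lift n R u V Q" and VU: "V \<subseteq> U" using lift_ex[OF R u] by blast
    have L: "openin (Euclidean_space n) V" "u \<in> V" "smooth_plot X n V Q" using l unfolding lift_def by blast+
    have l2: "lift n R v V Q" if "v \<in> V" for v using l that unfolding lift_def by blast
    show "\<exists>V b. openin (Euclidean_space n) V \<and> u \<in> V \<and> V \<subseteq> U \<and> euclid_form n k V b \<and>
        (\<forall>v\<in>V. \<forall>vs\<in>vecs n k. \<alpha> n U R v vs = b v vs)"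
    proof (intro exI conjI ballI)
      show "\<alpha> n U R v vs = plot_pullback X Q \<omega> v vs" if "v \<in> V" "vs \<in> vecs n k" for v vs
        by (rule \<alpha>[OF l2[OF that(1)] that(2)])
    qed (rule L VU plot_pullback_form[OF X \<omega> L(3)])+
  qed
  have compat: "\<alpha> m V S v vs = euclid_pullback f (\<alpha> n U R) v vs"
    if R: "reduced_diffeology G X a C n U R" and f: "euclid_smooth_map m V n U f"
      and S: "\<And>v. v \<in> V \<Longrightarrow> S v = R (f v)" and v: "v \<in> V" and vs: "vs \<in> vecs m k"
    for n U R m V f S v vs
  proof -
    note fD = euclid_smooth_mapD[OF f]
    obtain W Q where l: "lift n R (f v) W Q" and WU: "W \<subseteq> U" using lift_ex[OF R fD(5)[OF v]] by blast
    have L: "openin (Euclidean_space n) W" "f v \<in> W" "smooth_plot X n W Q" "Q ` W \<subseteq> C"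
      "\<And>w. w \<in> W \<Longrightarrow> R w = orbit G a (Q w)" using l unfolding lift_def by blast+
    let ?V = "{y \<in> V. f y \<in> W}"
    have o: "openin (Euclidean_space m) ?V" by (rule euclid_smooth_map_vimage[OF f L(1)])
    have f': "euclid_smooth_map m ?V n W f"
      by (rule euclid_smooth_map_restrict[OF f o _ L(1)]) auto
    have vV: "v \<in> ?V" using v L(2) by simp
    \<comment> \<open>A lift of R near f v, composed with f, lifts S near v; compatibility becomes
      functoriality of \<open>plot_pullback\<close>.\<close>
    have "lift m S v ?V (\<lambda>y. Q (f y))"
      unfolding lift_def
      by (intro conjI o vV smooth_plot_compose[OF L(3) f']) (use L(4,5) S in auto)
    from \<alpha>[OF this vs] have "\<alpha> m V S v vs = plot_pullback X (\<lambda>y. Q (f y)) \<omega> v vs" .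
    also have "\<dots> = euclid_pullback f (plot_pullback X Q \<omega>) v vs"
      by (rule plot_pullback_compose[OF cc L(3) f' vV vs])
    also have "\<dots> = euclid_pullback f (\<alpha> n U R) v vs"
    proof -
      have "map (vderiv f v) vs \<in> vecs n k"
        using vs vderiv_in_Rn[OF f v] unfolding vecs_def by auto
      from \<alpha>[OF l this, of U] show ?thesis by (simp only: euclid_pullback_def)
    qed
    finally show ?thesis .
  qed
  have "diffeological_form (reduced_diffeology G X a C) k \<alpha>"
    unfolding diffeological_form_def
  proof (intro conjI allI impI ballI)
    fix n U R assume "reduced_diffeology G X a C n U R"
    then show "euclid_form n k U (\<alpha> n U R)" by (rule form)
  next
    fix n U R m V f S v vs
    assume "reduced_diffeology G X a C n U R \<and> euclid_smooth_map m V n U f \<and> (\<forall>v\<in>V. S v = R (f v))"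
      "v \<in> V" "vs \<in> vecs m k"
    then show "\<alpha> m V S v vs = euclid_pullback f (\<alpha> n U R) v vs"
      by (elim conjE) (rule compat, assumption+, erule (1) bspec)
  qed
  moreover have "eq_diff_form (subset_diffeology (smooth_plot X) C) k
      (diff_pullback id (diff_form_of X \<omega>)) (diff_pullback (orbit G a) \<alpha>)"
    unfolding eq_diff_form_def
  proof (intro allI impI ballI)
    fix n U P u vs assume P: "subset_diffeology (smooth_plot X) C n U P" and u: "u \<in> U" and vs: "vs \<in> vecs n k"
    have "lift n (orbit G a \<circ> P) u U P"
      using P u smooth_plotD(1) unfolding lift_def subset_diffeology_def comp_def by blast
    from \<alpha>[OF this vs, of U] show "diff_pullback id (diff_form_of X \<omega>) n U P u vs = diff_pullback (orbit G a) \<alpha> n U P u vs"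
      unfolding diff_pullback_def diff_form_of_def id_comp by simp
  qed
  ultimately show ?thesis unfolding carries_reduced_form_def by blast
qed

section \<open>Local solutions of ordinary differential equations\<close>

text \<open>A fixed point of the integral operator, which is a contraction on bounded continuous
  functions. Clamping space to the box and time to a short interval makes everything globally
  defined; inside both ranges the fixed point solves the equation.\<close>

lemma picard_local:
  fixes f :: "nat \<Rightarrow> vec \<Rightarrow> real"
  assumes r: "r > 0" and y0: "y0 \<in> Rn d"
    and B: "B = {y \<in> Rn d. \<forall>i<d. \<bar>y i - y0 i\<bar> \<le> r}"
    and K: "K \<ge> 0"
    and Lip: "\<And>i y y'. i < d \<Longrightarrow> y \<in> B \<Longrightarrow> y' \<in> B \<Longrightarrow> \<bar>f i y - f i y'\<bar> \<le> K * (\<Sum>j<d. \<bar>y j - y' j\<bar>)"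
  obtains \<epsilon> y where "\<epsilon> > 0" "y 0 = y0" "\<And>t. y t \<in> B"
    "\<And>t i. \<bar>t\<bar> < \<epsilon> \<Longrightarrow> i < d \<Longrightarrow> ((\<lambda>t. y t i) has_real_derivative f i (y t)) (at t)"
proof -
  \<comment> \<open>Coordinatewise projection onto the box. It does not increase coordinate
    distances, so f composed with it is bounded and Lipschitz everywhere.\<close>
  define cl where "cl z = (\<lambda>i. if i < d then max (y0 i - r) (min (y0 i + r) (z i)) else 0)" for z :: vec
  have clB: "cl z \<in> B" for z using r by (auto simp: B cl_def Rn_iff)
  have cl_id: "cl z = z" if "z \<in> B" for z
    using that by (auto simp: B cl_def Rn_iff fun_eq_iff max_def min_def abs_le_iff)
  have cl_lip: "\<bar>cl z i - cl z' i\<bar> \<le> \<bar>z i - z' i\<bar>" if "i < d" for z z' i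
    using that r by (auto simp: cl_def)
  have FL: "\<bar>f i (cl z) - f i (cl z')\<bar> \<le> K * (\<Sum>j<d. \<bar>z j - z' j\<bar>)" if "i < d" for i z z'
  proof -
    have "\<bar>f i (cl z) - f i (cl z')\<bar> \<le> K * (\<Sum>j<d. \<bar>cl z j - cl z' j\<bar>)" by (rule Lip[OF that clB clB])
    also have "\<dots> \<le> K * (\<Sum>j<d. \<bar>z j - z' j\<bar>)"
      by (intro mult_left_mono sum_mono cl_lip K) simp
    finally show ?thesis .
  qed
  \<comment> \<open>Bounds the components of f on the box: the values at y0 plus the Lipschitz
    constant times the largest possible coordinate sum.\<close>
  define N where "N = (\<Sum>i<d. \<bar>f i y0\<bar>) + K * (\<Sum>j<d. r)"
  have N0: "N \<ge> 0" unfolding N_def using K r by (simp add: sum_nonneg)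
  have y0B: "y0 \<in> B" using y0 r by (simp add: B)
  have FN: "\<bar>f i (cl z)\<bar> \<le> N" if i: "i < d" for i z
  proof -
    have "\<bar>f i (cl z)\<bar> \<le> \<bar>f i y0\<bar> + \<bar>f i (cl z) - f i y0\<bar>" by simp
    also have "\<bar>f i (cl z) - f i y0\<bar> \<le> K * (\<Sum>j<d. \<bar>cl z j - y0 j\<bar>)" by (rule Lip[OF i clB y0B])
    also have "\<dots> \<le> K * (\<Sum>j<d. r)"
      by (intro mult_left_mono sum_mono K) (use clB[of z] in \<open>simp add: B\<close>)
    also have "\<bar>f i y0\<bar> \<le> (\<Sum>i<d. \<bar>f i y0\<bar>)" by (rule member_le_sum) (use i in auto)
    finally show ?thesis unfolding N_def by simp
  qed
  \<comment> \<open>The first bound keeps the integral within r of the start, the second gives the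
    contraction factor 1/2. One factor d comes from the Lipschitz sum and one from summing the
    components; the 1 in each denominator excludes division by 0.\<close>
  define \<epsilon> where "\<epsilon> = min (r / (N + 1)) (1 / (2 * (K * d * d + 1)))"
  have Kd: "K * d \<ge> 0" "K * d * d \<ge> 0" using K by simp_all
  have \<epsilon>: "\<epsilon> > 0" using r N0 Kd(2) unfolding \<epsilon>_def by (smt (verit) divide_pos_pos)
  have \<epsilon>N: "N * \<epsilon> \<le> r"
  proof -
    have "\<epsilon> \<le> r / (N + 1)" by (simp add: \<epsilon>_def)
    then have "\<epsilon> * (N + 1) \<le> r" using N0 by (simp add: pos_le_divide_eq)
    then show ?thesis using \<epsilon> by (simp add: algebra_simps)
  qed
  have \<epsilon>K: "K * d * d * \<epsilon> \<le> 1 / 2"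
  proof -
    have "\<epsilon> * (K * d * d + 1) \<le> (1 / (2 * (K * d * d + 1))) * (K * d * d + 1)"
      by (intro mult_right_mono) (use Kd in \<open>simp_all add: \<epsilon>_def\<close>)
    also have "\<dots> = 1 / 2"
    proof -
      have "K * d * d + 1 \<noteq> 0" using Kd(2) by linarith
      moreover have "1 / (2 * q) * q = 1 / 2" if "q \<noteq> 0" for q :: real using that by simp
      ultimately show ?thesis by blast
    qed
    finally show ?thesis using \<epsilon> by (simp add: algebra_simps)
  qed
  define ct where "ct t = max (- \<epsilon>) (min \<epsilon> t)" for t :: real
  have ct: "ct t \<in> {-\<epsilon>..\<epsilon>}" "\<bar>ct t\<bar> \<le> \<epsilon>" for t using \<epsilon> by (auto simp: ct_def)
  define g where "g \<phi> i s = f i (cl (\<lambda>j. apply_bcontfun \<phi> (real j, s)))" for \<phi> :: "(real \<times> real) \<Rightarrow>\<^sub>C real" and i s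
  have g_cont: "continuous_on A (g \<phi> i)" if i: "i < d" for \<phi> i A
  proof -
    have "isCont (g \<phi> i) s0" for s0
    proof -
      have "((\<lambda>s. K * (\<Sum>j<d. \<bar>apply_bcontfun \<phi> (real j, s) - apply_bcontfun \<phi> (real j, s0)\<bar>)) \<longlongrightarrow>
          K * (\<Sum>j<d. \<bar>apply_bcontfun \<phi> (real j, s0) - apply_bcontfun \<phi> (real j, s0)\<bar>)) (at s0)"
      proof (intro tendsto_intros)
        fix j
        have "continuous_on UNIV (\<lambda>s. apply_bcontfun \<phi> (real j, s))"
          by (rule continuous_on_compose2[OF continuous_on_apply_bcontfun[where T=UNIV]]) (auto intro!: continuous_intros)
        then show "((\<lambda>s. apply_bcontfun \<phi> (real j, s)) \<longlongrightarrow> apply_bcontfun \<phi> (real j, s0)) (at s0)"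
          by (simp add: continuous_on_eq_continuous_at isCont_def)
      qed
      then have lim: "((\<lambda>s. K * (\<Sum>j<d. \<bar>apply_bcontfun \<phi> (real j, s) - apply_bcontfun \<phi> (real j, s0)\<bar>)) \<longlongrightarrow> 0) (at s0)"
        by simp
      show ?thesis unfolding isCont_def
      proof (rule metric_tendsto_imp_tendsto[OF lim])
        show "\<forall>\<^sub>F s in at s0. dist (g \<phi> i s) (g \<phi> i s0)
            \<le> dist (K * (\<Sum>j<d. \<bar>apply_bcontfun \<phi> (real j, s) - apply_bcontfun \<phi> (real j, s0)\<bar>)) 0"
          using FL[OF i] K by (auto simp: g_def dist_real_def sum_nonneg intro!: always_eventually)
      qed
    qed
    then show ?thesis by (simp add: continuous_at_imp_continuous_on)
  qed
  \<comment> \<open>Integration starts at -\<epsilon> to give one antiderivative on the whole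
    interval; subtracting its value at 0 in \<open>comp\<close> moves the initial time to 0.\<close>
  define H where "H \<phi> i t = integral {-\<epsilon>..t} (g \<phi> i)" for \<phi> i t
  have HD: "(H \<phi> i has_real_derivative g \<phi> i t) (at t within {-\<epsilon>..\<epsilon>})" if "i < d" "t \<in> {-\<epsilon>..\<epsilon>}" for \<phi> i t
    unfolding H_def by (rule integral_has_real_derivative[OF g_cont that(2)]) (rule that(1))
  \<comment> \<open>The space \<^typ>\<open>'a \<Rightarrow>\<^sub>C 'b\<close> is complete only for a metric domain, so the index \<open>i\<close> of a
    component is a real argument; \<open>hat\<close> interpolates between the integers.\<close>
  define comp where "comp \<phi> i t = y0 i + H \<phi> i (ct t) - H \<phi> i 0" for \<phi> i t
  define hat where "hat x i = max 0 (1 - \<bar>x - real i\<bar>)" for x i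
  define T where "T \<phi> p = (\<Sum>i<d. hat (fst p) i * comp \<phi> i (snd p))" for \<phi> and p :: "real \<times> real"
  have hat: "0 \<le> hat x i" "hat x i \<le> 1" for x i by (auto simp: hat_def)
  have hat_abs: "\<bar>hat x i * c\<bar> \<le> \<bar>c\<bar>" for x i c
    using mult_right_mono[OF hat(2)[of x i], of "\<bar>c\<bar>"] hat(1)[of x i] by (simp add: abs_mult)
  \<comment> \<open>At a natural number k only the hat function of index k is nonzero, so the
    component is recovered exactly.\<close>
  have T_nat: "T \<phi> (real k, t) = (if k < d then comp \<phi> k t else 0)" for \<phi> k t
  proof -
    have "hat (real k) i = (if i = k then 1 else 0)" for i
      by (cases i k rule: linorder_cases) (auto simp: hat_def abs_if)
    then show ?thesis by (simp add: T_def if_distrib[of "\<lambda>x. x * _"] cong: if_cong)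
  qed
  have z\<epsilon>: "0 \<in> {-\<epsilon>..\<epsilon>}" using \<epsilon> by simp
  have comp_bd: "\<bar>comp \<phi> i t - y0 i\<bar> \<le> r" if "i < d" for \<phi> i t
  proof -
    have "norm (H \<phi> i (ct t) - H \<phi> i 0) \<le> N * norm (ct t - 0)"
      by (rule field_differentiable_bound[OF _ HD[OF that] _ ct(1) z\<epsilon>])
        (use FN[OF that] in \<open>auto simp: g_def\<close>)
    also have "\<dots> \<le> N * \<epsilon>" using ct(2)[of t] N0 by (intro mult_left_mono) simp_all
    finally show ?thesis using \<epsilon>N by (simp add: comp_def)
  qed
  have Tbc: "T \<phi> \<in> bcontfun" for \<phi>
  proof (rule bcontfun_normI)
    have 1: "continuous_on UNIV (\<lambda>p. comp \<phi> i (snd p))" if i: "i < d" for i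
    proof -
      have "continuous_on {-\<epsilon>..\<epsilon>} (H \<phi> i)"
        using HD[OF i] by (meson DERIV_continuous_on)
      then have "continuous_on UNIV (\<lambda>p. H \<phi> i (ct (snd p)))"
        by (rule continuous_on_compose2) (use ct(1) in \<open>auto simp: ct_def intro!: continuous_intros\<close>)
      then show ?thesis unfolding comp_def by (intro continuous_intros)
    qed
    have 2: "continuous_on UNIV (\<lambda>p. hat (fst p) i)" for i
      unfolding hat_def by (intro continuous_intros)
    show "continuous_on UNIV (T \<phi>)"
      unfolding T_def by (intro continuous_on_sum continuous_on_mult 1 2) simp
    show "norm (T \<phi> p) \<le> (\<Sum>i<d. \<bar>y0 i\<bar> + r)" for p
    proof -
      have "norm (T \<phi> p) \<le> (\<Sum>i<d. \<bar>hat (fst p) i * comp \<phi> i (snd p)\<bar>)"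
        unfolding T_def by (simp add: sum_abs)
      also have "\<dots> \<le> (\<Sum>i<d. \<bar>y0 i\<bar> + r)"
      proof (rule sum_mono)
        fix i assume "i \<in> {..<d}"
        then show "\<bar>hat (fst p) i * comp \<phi> i (snd p)\<bar> \<le> \<bar>y0 i\<bar> + r"
          using hat_abs[of "fst p" i "comp \<phi> i (snd p)"] comp_bd[of i \<phi> "snd p"] by simp
      qed
      finally show ?thesis .
    qed
  qed
  define TT where "TT \<phi> = Bcontfun (T \<phi>)" for \<phi>
  have TT: "apply_bcontfun (TT \<phi>) = T \<phi>" for \<phi>
    unfolding TT_def by (rule Bcontfun_inverse[OF Tbc])
  have contr: "dist (TT \<phi>) (TT \<psi>) \<le> 1 / 2 * dist \<phi> \<psi>" for \<phi> \<psi>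
  proof (rule dist_bound)
    fix p :: "real \<times> real"
    have comp_diff: "\<bar>comp \<phi> i t - comp \<psi> i t\<bar> \<le> K * d * dist \<phi> \<psi> * \<epsilon>" if i: "i < d" for i t
    proof -
      let ?D = "\<lambda>t. H \<phi> i t - H \<psi> i t"
      have bd: "norm (g \<phi> i s - g \<psi> i s) \<le> K * d * dist \<phi> \<psi>" for s
      proof -
        have "norm (g \<phi> i s - g \<psi> i s) \<le> K * (\<Sum>j<d. \<bar>apply_bcontfun \<phi> (real j, s) - apply_bcontfun \<psi> (real j, s)\<bar>)"
          unfolding g_def using FL[OF i] by simp
        also have "\<dots> \<le> K * (\<Sum>j<d. dist \<phi> \<psi>)"
          by (intro mult_left_mono sum_mono K)
            (use dist_bounded[of \<phi> _ \<psi>] in \<open>simp add: dist_real_def\<close>)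
        finally show ?thesis by (simp add: mult.assoc)
      qed
      have "norm (?D (ct t) - ?D 0) \<le> (K * d * dist \<phi> \<psi>) * norm (ct t - 0)"
        by (rule field_differentiable_bound[where S="{-\<epsilon>..\<epsilon>}" and f'="\<lambda>s. g \<phi> i s - g \<psi> i s", OF _ _ bd ct(1) z\<epsilon>])
          (auto intro!: DERIV_diff HD i)
      also have "\<dots> \<le> (K * d * dist \<phi> \<psi>) * \<epsilon>"
        using ct(2)[of t] Kd by (intro mult_left_mono) simp_all
      finally show ?thesis by (simp add: comp_def algebra_simps)
    qed
    have "dist (apply_bcontfun (TT \<phi>) p) (apply_bcontfun (TT \<psi>) p)
        = \<bar>\<Sum>i<d. hat (fst p) i * (comp \<phi> i (snd p) - comp \<psi> i (snd p))\<bar>"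
      by (simp add: TT T_def dist_real_def right_diff_distrib sum_subtractf)
    also have "\<dots> \<le> (\<Sum>i<d. \<bar>hat (fst p) i * (comp \<phi> i (snd p) - comp \<psi> i (snd p))\<bar>)" by (rule sum_abs)
    also have "\<dots> \<le> (\<Sum>i<d. K * d * dist \<phi> \<psi> * \<epsilon>)"
      by (intro sum_mono order_trans[OF hat_abs comp_diff]) simp
    also have "\<dots> = (K * d * d * \<epsilon>) * dist \<phi> \<psi>" by simp
    also have "\<dots> \<le> 1 / 2 * dist \<phi> \<psi>" by (intro mult_right_mono \<epsilon>K) simp
    finally show "dist (apply_bcontfun (TT \<phi>) p) (apply_bcontfun (TT \<psi>) p) \<le> 1 / 2 * dist \<phi> \<psi>" .
  qed
  have "\<exists>!\<phi>. TT \<phi> = \<phi>"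
    using banach_fix_type[of "1/2" TT] contr by simp
  then obtain \<phi> where \<phi>: "TT \<phi> = \<phi>" by blast
  have \<phi>T: "apply_bcontfun \<phi> p = T \<phi> p" for p using TT[of \<phi>] \<phi> by simp
  define y where "y t = (\<lambda>i. apply_bcontfun \<phi> (real i, t))" for t
  have y: "y t i = (if i < d then comp \<phi> i t else 0)" for t i by (simp add: y_def \<phi>T T_nat)
  show thesis
  proof (rule that[OF \<epsilon>])
    show yB: "y t \<in> B" for t
      using comp_bd by (simp add: B y Rn_iff)
    show "y 0 = y0"
    proof
      fix i
      have "ct 0 = 0" using \<epsilon> by (simp add: ct_def)
      then show "y 0 i = y0 i" using y0 by (simp add: y comp_def Rn_iff)
    qed
    fix t i assume t: "\<bar>t\<bar> < \<epsilon>" and i: "i < d"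
    have tI: "t \<in> {-\<epsilon><..<\<epsilon>}" using t by auto
    have "(H \<phi> i has_real_derivative g \<phi> i t) (at t)"
      using HD[OF i, of t \<phi>] tI at_within_Icc_at[of "-\<epsilon>" t \<epsilon>] by simp
    then have D: "((\<lambda>t. y0 i + H \<phi> i t - H \<phi> i 0) has_real_derivative g \<phi> i t) (at t)"
      by (auto intro!: derivative_eq_intros)
    have "g \<phi> i t = f i (y t)" using cl_id[OF yB[of t]] by (simp add: g_def y_def)
    moreover have "((\<lambda>t. y t i) has_real_derivative g \<phi> i t) (at t)"
    proof (rule DERIV_cong_ev[THEN iffD2, OF refl _ refl D])
      have "\<forall>\<^sub>F s in nhds t. s \<in> {-\<epsilon><..<\<epsilon>}" using tI by (intro eventually_nhds_in_open) auto
      then show "\<forall>\<^sub>F s in nhds t. y s i = y0 i + H \<phi> i s - H \<phi> i 0"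
        by (rule eventually_mono) (use i in \<open>auto simp: y comp_def ct_def\<close>)
    qed
    ultimately show "((\<lambda>t. y t i) has_real_derivative f i (y t)) (at t)" by simp
  qed
qed

text \<open>Bounded partial derivatives on a small convex box give the Lipschitz condition of
  \<open>picard_local\<close>. Smoothness of the solution is a bootstrap: its derivative is F along
  the solution, so C^k improves to C^(k+1).\<close>

lemma smooth_ode_local:
  assumes U: "openin (Euclidean_space d) U" and F: "\<And>i. i < d \<Longrightarrow> smooth_fun d U (F i)" and y0: "y0 \<in> U"
  obtains \<epsilon> y where "\<epsilon> > 0" "y 0 = y0" "\<And>t. y t \<in> U"
    "\<And>t i. \<bar>t\<bar> < \<epsilon> \<Longrightarrow> i < d \<Longrightarrow> ((\<lambda>t. y t i) has_real_derivative F i (y t)) (at t)"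
    "\<And>i. smooth_fun 1 {x \<in> Rn 1. \<bar>x 0\<bar> < \<epsilon>} (\<lambda>x. y (x 0) i)"
proof -
  let ?p = "\<lambda>i y j. dderiv (F i) y (basis_vec j)"
  have y0R: "y0 \<in> Rn d" by (rule openin_Rn_subset[OF U y0])
  have ps: "smooth_fun d U (\<lambda>y. ?p i y j)" if "i < d" "j < d" for i j
    by (rule smooth_fun_dderiv[OF U F[OF that(1)] basis_vec_Rn[OF that(2)]])
  have "\<exists>r>0. \<forall>i<d. \<forall>j<d. \<forall>y\<in>Rn d. (\<forall>l<d. \<bar>y l - y0 l\<bar> < r) \<longrightarrow> \<bar>?p i y j - ?p i y0 j\<bar> < 1"
  proof (rule common_delta)
    fix i assume i: "i < d"
    show "\<exists>r>0. \<forall>j<d. \<forall>y\<in>Rn d. (\<forall>l<d. \<bar>y l - y0 l\<bar> < r) \<longrightarrow> \<bar>?p i y j - ?p i y0 j\<bar> < 1"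
    proof (rule common_delta)
      fix j assume j: "j < d"
      from continuous_on_Rn_box[OF U y0 smooth_fun_continuous[OF ps[OF i j]] zero_less_one]
      obtain r where "r > 0" "\<And>y. y \<in> Rn d \<Longrightarrow> (\<And>i. i < d \<Longrightarrow> \<bar>y i - y0 i\<bar> < r) \<Longrightarrow> y \<in> U \<and> \<bar>?p i y j - ?p i y0 j\<bar> < 1"
        by blast
      then show "\<exists>r>0. \<forall>y\<in>Rn d. (\<forall>l<d. \<bar>y l - y0 l\<bar> < r) \<longrightarrow> \<bar>?p i y j - ?p i y0 j\<bar> < 1"
        by (intro exI[of _ r]) blast
    qed force
  qed force
  then obtain r1 where r1: "r1 > 0" and
    p1: "\<And>i j y. i < d \<Longrightarrow> j < d \<Longrightarrow> y \<in> Rn d \<Longrightarrow> (\<And>l. l < d \<Longrightarrow> \<bar>y l - y0 l\<bar> < r1) \<Longrightarrow> \<bar>?p i y j - ?p i y0 j\<bar> < 1"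
    by blast
  obtain r2 where r2: "r2 > 0" "\<And>y. y \<in> Rn d \<Longrightarrow> (\<And>i. i < d \<Longrightarrow> \<bar>y i - y0 i\<bar> < r2) \<Longrightarrow> y \<in> U"
    using openin_Rn_box[OF U y0] by blast
  \<comment> \<open>Halving puts the closed box inside both open ones.\<close>
  define r where "r = min r1 r2 / 2"
  have r: "r > 0" "r < r1" "r < r2" using r1 r2(1) by (auto simp: r_def min_def)
  define B where "B = {y \<in> Rn d. \<forall>i<d. \<bar>y i - y0 i\<bar> \<le> r}"
  have BU: "y \<in> U" if "y \<in> B" for y
  proof (rule r2(2))
    show "y \<in> Rn d" using that by (simp add: B_def)
    show "\<bar>y i - y0 i\<bar> < r2" if "i < d" for i using that \<open>y \<in> B\<close> r(3) by (auto simp: B_def intro: le_less_trans)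
  qed
  \<comment> \<open>On the box each partial derivative differs by less than 1 from its value at y0,
    so K dominates all of them.\<close>
  define K where "K = (\<Sum>i<d. \<Sum>j<d. \<bar>?p i y0 j\<bar>) + 1"
  have K: "K \<ge> 0" unfolding K_def by (simp add: sum_nonneg add_nonneg_nonneg)
  have pK: "\<bar>?p i y j\<bar> \<le> K" if i: "i < d" and j: "j < d" and y: "y \<in> B" for i j y
  proof -
    have "\<bar>?p i y0 j\<bar> \<le> (\<Sum>j<d. \<bar>?p i y0 j\<bar>)" by (rule member_le_sum) (use j in auto)
    also have "\<dots> \<le> (\<Sum>i<d. \<Sum>j<d. \<bar>?p i y0 j\<bar>)"
      by (rule member_le_sum[of i "{..<d}" "\<lambda>i. \<Sum>j<d. \<bar>?p i y0 j\<bar>"]) (use i in \<open>auto intro: sum_nonneg\<close>)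
    moreover have "\<bar>?p i y j - ?p i y0 j\<bar> < 1"
    proof (rule p1[OF i j])
      show "y \<in> Rn d" using y by (simp add: B_def)
      show "\<bar>y l - y0 l\<bar> < r1" if "l < d" for l using that y r(2) by (auto simp: B_def intro: le_less_trans)
    qed
    ultimately show ?thesis unfolding K_def by linarith
  qed
  have Lip: "\<bar>F i y - F i y'\<bar> \<le> K * (\<Sum>j<d. \<bar>y j - y' j\<bar>)" if i: "i < d" and y: "y \<in> B" "y' \<in> B" for i y y'
  proof -
    \<comment> \<open>The segment from y' to y, which stays in the convex box.\<close>
    define \<eta> where "\<eta> t = (\<lambda>j. y' j + t * (y j - y' j))" for t
    have \<eta>B: "\<eta> t \<in> B" if "t \<in> {0..1}" for t
    proof -
      have "\<bar>y' j + t * (y j - y' j) - y0 j\<bar> \<le> r" if "j < d" for j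
      proof -
        have "y' j + t * (y j - y' j) - y0 j = (1 - t) * (y' j - y0 j) + t * (y j - y0 j)" by (simp add: algebra_simps)
        also have "\<bar>\<dots>\<bar> \<le> (1 - t) * \<bar>y' j - y0 j\<bar> + t * \<bar>y j - y0 j\<bar>"
          using \<open>t \<in> {0..1}\<close> abs_triangle_ineq[of "(1 - t) * (y' j - y0 j)" "t * (y j - y0 j)"] by (simp add: abs_mult)
        also have "\<dots> \<le> (1 - t) * r + t * r"
          using \<open>t \<in> {0..1}\<close> y that by (intro add_mono mult_left_mono) (auto simp: B_def)
        finally show ?thesis by (simp add: algebra_simps)
      qed
      then show ?thesis using y by (auto simp: B_def \<eta>_def Rn_iff)
    qed
    define w where "w = (\<lambda>j. y j - y' j)"
    have wR: "w \<in> Rn d" using y by (simp add: w_def B_def Rn_iff)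
    have der: "((\<lambda>t. F i (\<eta> t)) has_real_derivative dderiv (F i) (\<eta> t) w) (at t)" if "t \<in> {0..1}" for t
    proof (rule smooth_fun_curve_DERIV[where \<eta>=\<eta>, OF U F[OF i] BU[OF \<eta>B[OF that]] _ wR])
      show "\<forall>\<^sub>F t in at t. \<eta> t \<in> Rn d"
        using y by (intro always_eventually) (auto simp: \<eta>_def B_def Rn_iff)
      show "((\<lambda>t. \<eta> t j) has_real_derivative w j) (at t)" for j
        unfolding \<eta>_def w_def by (auto intro!: derivative_eq_intros)
    qed
    have bd: "norm (dderiv (F i) (\<eta> t) w) \<le> K * (\<Sum>j<d. \<bar>w j\<bar>)" if "t \<in> {0..1}" for t
    proof -
      have "dderiv (F i) (\<eta> t) w = (\<Sum>j<d. ?p i (\<eta> t) j * w j)"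
        by (rule Ck1_dderiv(2)[OF U smooth_fun_Ck[OF F[OF i]] BU[OF \<eta>B[OF that]] wR])
      also have "norm \<dots> \<le> (\<Sum>j<d. \<bar>?p i (\<eta> t) j * w j\<bar>)" by (simp add: sum_abs)
      also have "\<dots> \<le> (\<Sum>j<d. K * \<bar>w j\<bar>)"
        unfolding abs_mult by (intro sum_mono mult_right_mono pK i \<eta>B that) simp_all
      finally show ?thesis by (simp add: sum_distrib_left)
    qed
    have "norm (F i (\<eta> 1) - F i (\<eta> 0)) \<le> K * (\<Sum>j<d. \<bar>w j\<bar>) * norm (1 - 0 :: real)"
      by (rule field_differentiable_bound[where S="{0..1}" and f="\<lambda>t. F i (\<eta> t)"
            and f'="\<lambda>t. dderiv (F i) (\<eta> t) w"])
        (use bd der[THEN has_field_derivative_at_within] in auto)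
    moreover have "\<eta> 1 = y" "\<eta> 0 = y'" by (simp_all add: \<eta>_def)
    ultimately show ?thesis by (simp add: w_def)
  qed
  obtain \<epsilon> y where \<epsilon>: "\<epsilon> > 0" and y: "y 0 = y0" "\<And>t. y t \<in> B"
    and yD: "\<And>t i. \<bar>t\<bar> < \<epsilon> \<Longrightarrow> i < d \<Longrightarrow> ((\<lambda>t. y t i) has_real_derivative F i (y t)) (at t)"
    by (rule picard_local[OF r(1) y0R B_def K Lip]) blast+
  let ?V = "{x \<in> Rn 1. \<bar>x 0\<bar> < \<epsilon>}"
  have V: "openin (Euclidean_space 1) ?V"
  using open_Rn_box[of "\<lambda>i. 0" 1 "\<epsilon>"] by (simp add: Rn_iff)
  have Ck: "\<forall>i<d. Ck k 1 ?V (\<lambda>x. y (x 0) i)" for k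
  proof (induction k)
    case 0
    have "continuous_on ?V (\<lambda>x. y (x 0) i)" if "i < d" for i
    proof (rule continuous_on_compose2[of "{t. \<bar>t\<bar> < \<epsilon>}" "\<lambda>t. y t i"])
      show "continuous_on {t. \<bar>t\<bar> < \<epsilon>} (\<lambda>t. y t i)"
        using yD[OF _ that] by (auto intro!: continuous_at_imp_continuous_on DERIV_isCont)
    qed (auto intro: continuous_on_coord)
    then show ?case by simp
  next
    case (Suc k)
    show ?case
    proof (intro allI impI)
      fix i assume i: "i < d"
      show "Ck (Suc k) 1 ?V (\<lambda>x. y (x 0) i)"
      proof (rule Ck_SucI[OF _ V, where D="\<lambda>l x. F i (y (x 0))"])
        show "continuous_on ?V (\<lambda>x. y (x 0) i)" using Suc i Ck_continuous by blast
        show "Ck k 1 ?V (\<lambda>x. F i (y (x 0)))"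
          by (rule Ck_compose[OF V U]) (use Suc BU[OF y(2)] smooth_fun_Ck[OF F[OF i]] in auto)
        fix l :: nat and x assume l: "l < 1" and x: "x \<in> ?V"
        have "((\<lambda>t. y t i) has_real_derivative F i (y (x 0))) (at (0 + x 0))"
          using yD[of "x 0" i] x i by simp
        then have "((\<lambda>t. y (t + x 0) i) has_real_derivative F i (y (x 0))) (at 0)"
          unfolding DERIV_shift .
        then show "((\<lambda>t. y (x 0 + t * basis_vec l 0) i) has_real_derivative F i (y (x 0))) (at 0)"
          using l by (simp add: basis_vec_def add.commute)
      qed
    qed
  qed
  have sm: "smooth_fun 1 ?V (\<lambda>x. y (x 0) i)" for i
  proof (cases "i < d")
    case True
    then show ?thesis using Ck by (simp add: smooth_fun_def)
  next
    case False
    then have "y t i = 0" for t using y(2)[of t] by (simp add: B_def Rn_iff)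
    then show ?thesis using smooth_fun_const[OF V, of 0] by simp
  qed
  show thesis by (rule that[OF \<epsilon> y(1) BU[OF y(2)] yD sm])
qed

section \<open>Velocities of curves\<close>

text \<open>Coordinates on a product, in the layout used by the charts of
  \<open>prod_mfd\<close>.\<close>

definition vec_append :: "nat \<Rightarrow> vec \<Rightarrow> vec \<Rightarrow> vec" where
  "vec_append m y z = (\<lambda>i. if i < m then y i else z (i - m))"

definition vec_take :: "nat \<Rightarrow> vec \<Rightarrow> vec" where "vec_take m w = (\<lambda>i. if i < m then w i else 0)"

definition vec_drop :: "nat \<Rightarrow> vec \<Rightarrow> vec" where "vec_drop m w = (\<lambda>i. w (i + m))"

text \<open>The product of A and B, written as an intersection of preimages so that its openness
  follows from smoothness of the projections.\<close>

definition vec_times :: "nat \<Rightarrow> nat \<Rightarrow> vec set \<Rightarrow> vec set \<Rightarrow> vec set" where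
  "vec_times m n A B = {w \<in> Rn (m + n). vec_take m w \<in> A} \<inter> {w \<in> Rn (m + n). vec_drop m w \<in> B}"

lemma vec_take_append: "y \<in> Rn m \<Longrightarrow> vec_take m (vec_append m y z) = y"
  by (auto simp: vec_take_def vec_append_def Rn_iff fun_eq_iff)

lemma vec_drop_append: "vec_drop m (vec_append m y z) = z"
  by (auto simp: vec_drop_def vec_append_def fun_eq_iff)

lemma vec_append_Rn: "z \<in> Rn n \<Longrightarrow> vec_append m y z \<in> Rn (m + n)"
  by (auto simp: vec_append_def Rn_iff)

lemma vec_proj_smooth:
  "euclid_smooth_map (m + n) (Rn (m + n)) m (Rn m) (vec_take m)"
  "euclid_smooth_map (m + n) (Rn (m + n)) n (Rn n) (vec_drop m)"
proof -
  have R: "openin (Euclidean_space (m + n)) (Rn (m + n))" by simp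
  show "euclid_smooth_map (m + n) (Rn (m + n)) m (Rn m) (vec_take m)"
    "euclid_smooth_map (m + n) (Rn (m + n)) n (Rn n) (vec_drop m)"
    unfolding euclid_smooth_map_def
    by (auto simp: Rn_iff image_subset_iff vec_take_def vec_drop_def intro: smooth_fun_coord[OF R])
qed

lemma vec_times_open:
  assumes "openin (Euclidean_space m) A" "openin (Euclidean_space n) B"
  shows "openin (Euclidean_space (m + n)) (vec_times m n A B)"
  unfolding vec_times_def by (intro openin_Int euclid_smooth_map_vimage[OF vec_proj_smooth(1) assms(1)] euclid_smooth_map_vimage[OF vec_proj_smooth(2) assms(2)])

lemma vec_times_proj:
  assumes "openin (Euclidean_space m) A" "openin (Euclidean_space n) B"
  shows "euclid_smooth_map (m + n) (vec_times m n A B) m A (vec_take m)"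
    "euclid_smooth_map (m + n) (vec_times m n A B) n B (vec_drop m)"
  by (rule euclid_smooth_map_restrict[OF vec_proj_smooth(1) vec_times_open[OF assms] _ assms(1)]; force simp: vec_times_def)
     (rule euclid_smooth_map_restrict[OF vec_proj_smooth(2) vec_times_open[OF assms] _ assms(2)]; force simp: vec_times_def)

lemma vec_append_times:
  assumes "openin (Euclidean_space m) A" "openin (Euclidean_space n) B" "y \<in> A" "z \<in> B"
  shows "vec_append m y z \<in> vec_times m n A B"
  using vec_take_append[OF openin_Rn_subset[OF assms(1,3)]] vec_append_Rn[OF openin_Rn_subset[OF assms(2,4)]] assms(3,4)
  by (simp add: vec_times_def vec_drop_append)

lemma vec_append_smooth:
  assumes f: "euclid_smooth_map k V m A f" and g: "euclid_smooth_map k V n B g"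
  shows "euclid_smooth_map k V (m + n) (vec_times m n A B) (\<lambda>x. vec_append m (f x) (g x))"
  unfolding euclid_smooth_map_def
proof (intro conjI allI impI)
  note fD = euclid_smooth_mapD[OF f] and gD = euclid_smooth_mapD[OF g]
  show "openin (Euclidean_space k) V" by (rule fD(1))
  show "openin (Euclidean_space (m + n)) (vec_times m n A B)" by (rule vec_times_open[OF fD(2) gD(2)])
  show "(\<lambda>x. vec_append m (f x) (g x)) ` V \<subseteq> vec_times m n A B"
    using vec_append_times[OF fD(2) gD(2) fD(5) gD(5)] by auto
  show "smooth_fun k V (\<lambda>v. vec_append m (f v) (g v) i)" for i
    using euclid_smooth_map_coord[OF f, of i] euclid_smooth_map_coord[OF g, of "i - m"]
    by (cases "i < m") (simp_all add: vec_append_def)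
qed

lemma vderiv_append: "vderiv (\<lambda>x. vec_append m (f x) (g x)) x \<xi> = vec_append m (vderiv f x \<xi>) (vderiv g x \<xi>)"
  by (rule ext) (simp add: vderiv_def vec_append_def)

lemma const_smooth:
  assumes "openin (Euclidean_space m) V" "openin (Euclidean_space n) U" "u \<in> U"
  shows "euclid_smooth_map m V n U (\<lambda>x. u)"
  unfolding euclid_smooth_map_def using assms smooth_fun_const by auto

lemma vderiv_const: "vderiv (\<lambda>x. u) x \<xi> = (\<lambda>i. 0)"
  by (simp add: vderiv_def dderiv_def)

lemma id_smooth: "openin (Euclidean_space m) V \<Longrightarrow> euclid_smooth_map m V m V (\<lambda>x. x)"
  by (rule euclid_smooth_map_inclusion) auto

text \<open>\<open>velocity\<close> is built on \<open>deriv\<close>, which has a value even where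
  the curve is not differentiable. This relation records differentiability as well. It is demanded
  in one chart; the others follow by coordinate change.\<close>

definition curve_D :: "'a mfd \<Rightarrow> (real \<Rightarrow> 'a) \<Rightarrow> real \<Rightarrow> 'a tangent \<Rightarrow> bool" where
  "curve_D M \<gamma> t v \<longleftrightarrow> v \<in> tangent_space M (\<gamma> t) \<and>
     (\<exists>c\<in>charts_at M (\<gamma> t). (\<forall>\<^sub>F s in nhds t. \<gamma> s \<in> fst c) \<and>
        (\<forall>i. ((\<lambda>s. snd c (\<gamma> s) i) has_real_derivative v c i) (at t)))"

text \<open>The general source of velocities: near t the curve need only agree with a plot evaluated
  along a curve differentiable at t. Since the conclusions hold in every chart, they also yield
  chart independence of \<open>curve_D\<close>.\<close>

lemma curve_D_plot:
  assumes M: "smooth_manifold M" and P: "smooth_plot M n U P" and u: "\<eta> t \<in> U"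
    and ev: "\<forall>\<^sub>F s in nhds t. \<eta> s \<in> Rn n" and eq: "\<forall>\<^sub>F s in nhds t. \<gamma> s = P (\<eta> s)" and v: "\<xi> \<in> Rn n"
    and der: "\<And>i. i < n \<Longrightarrow> ((\<lambda>s. \<eta> s i) has_real_derivative \<xi> i) (at t)"
  shows "curve_D M \<gamma> t (plot_deriv M P (\<eta> t) \<xi>)"
    and "\<And>c. c \<in> charts_at M (\<gamma> t) \<Longrightarrow> \<forall>\<^sub>F s in nhds t. \<gamma> s \<in> fst c"
    and "\<And>c i. c \<in> charts_at M (\<gamma> t) \<Longrightarrow>
      ((\<lambda>s. snd c (\<gamma> s) i) has_real_derivative plot_deriv M P (\<eta> t) \<xi> c i) (at t)"
proof -
  note cc = smooth_manifoldD(2)[OF M]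
  have g: "\<gamma> t = P (\<eta> t)" by (rule eventually_nhds_x_imp_x[OF eq])
  have ev': "\<forall>\<^sub>F s in at t. \<eta> s \<in> Rn n" using ev by (simp add: eventually_nhds_conv_at)
  show 1: "\<forall>\<^sub>F s in nhds t. \<gamma> s \<in> fst c" if c: "c \<in> charts_at M (\<gamma> t)" for c
  proof -
    have "\<forall>\<^sub>F s in nhds t. \<eta> s \<in> {u \<in> U. P u \<in> fst c}"
    proof (rule openin_Rn_curve[OF smooth_plotD(3)[OF P charts_atD(1)[OF c]] _ ev'])
      show "\<eta> t \<in> {u \<in> U. P u \<in> fst c}" using u charts_atD(2)[OF c] by (simp add: g)
      show "isCont (\<lambda>s. \<eta> s i) t" if "i < n" for i by (rule DERIV_isCont[OF der[OF that]])
    qed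
    with eq show ?thesis by eventually_elim simp
  qed
  show 2: "((\<lambda>s. snd c (\<gamma> s) i) has_real_derivative plot_deriv M P (\<eta> t) \<xi> c i) (at t)"
    if c: "c \<in> charts_at M (\<gamma> t)" for c i
  proof -
    have "((\<lambda>s. snd c (P (\<eta> s)) i) has_real_derivative plot_deriv M P (\<eta> t) \<xi> c i) (at t)"
      by (rule plot_curve_DERIV[where \<eta>=\<eta>, OF cc P u _ ev' v der]) (use c g in simp_all)
    moreover have "\<forall>\<^sub>F s in nhds t. snd c (\<gamma> s) i = snd c (P (\<eta> s)) i"
      using eq by eventually_elim simp
    ultimately show ?thesis by (simp add: DERIV_cong_ev[OF refl _ refl])
  qed
  obtain c where c: "c \<in> charts_at M (\<gamma> t)"
    using charts_at_ex[OF cc smooth_plotD(2)[OF P u]] g by metis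
  have "plot_deriv M P (\<eta> t) \<xi> \<in> tangent_space M (\<gamma> t)"
    unfolding g by (rule plot_deriv_tangent[OF M P u v])
  with 1[OF c] 2[OF c] c show "curve_D M \<gamma> t (plot_deriv M P (\<eta> t) \<xi>)"
    unfolding curve_D_def by blast
qed

lemma curve_D_tangent: "curve_D M \<gamma> t v \<Longrightarrow> v \<in> tangent_space M (\<gamma> t)"
  by (simp add: curve_D_def)

text \<open>Near t the curve is \<open>param b\<close> along its own reading in the chart b of the
  definition, so \<open>curve_D_plot\<close> passes to any other chart.\<close>

lemma curve_D_chart:
  assumes M: "smooth_manifold M" and D: "curve_D M \<gamma> t v" and c: "c \<in> charts_at M (\<gamma> t)"
  shows "\<forall>\<^sub>F s in nhds t. \<gamma> s \<in> fst c"
    and "((\<lambda>s. snd c (\<gamma> s) i) has_real_derivative v c i) (at t)"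
proof -
  note cc = smooth_manifoldD(2)[OF M]
  from D obtain b where b: "b \<in> charts_at M (\<gamma> t)" and ev: "\<forall>\<^sub>F s in nhds t. \<gamma> s \<in> fst b"
    and der: "\<And>i. ((\<lambda>s. snd b (\<gamma> s) i) has_real_derivative v b i) (at t)"
    unfolding curve_D_def by blast
  note bD = charts_atD[OF b]
  note B = chart_coverD[OF cc bD(1)]
  have "\<forall>\<^sub>F s in nhds t. snd b (\<gamma> s) \<in> Rn (mdim M)"
    using ev by (rule eventually_mono) (rule B(10))
  moreover have "\<forall>\<^sub>F s in nhds t. \<gamma> s = param b (snd b (\<gamma> s))"
    using ev by (rule eventually_mono) (simp add: B(7))
  ultimately have "\<forall>\<^sub>F s in nhds t. \<gamma> s \<in> fst c" "((\<lambda>s. snd c (\<gamma> s) i) has_real_derivative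
      plot_deriv M (param b) (snd b (\<gamma> t)) (v b) c i) (at t)"
    using curve_D_plot(2,3)[where \<eta>="\<lambda>s. snd b (\<gamma> s)", OF M smooth_plot_param[OF M bD(1)] B(8)[OF bD(2)] _ _
        tangent_in_Rn[OF curve_D_tangent[OF D] b] der] c by blast+
  then show "\<forall>\<^sub>F s in nhds t. \<gamma> s \<in> fst c" "((\<lambda>s. snd c (\<gamma> s) i) has_real_derivative v c i) (at t)"
    using tangent_rep[OF cc curve_D_tangent[OF D] b] by simp_all
qed

lemma curve_D_local:
  assumes M: "smooth_manifold M" and D: "curve_D M \<gamma> t v" and c: "c \<in> charts_at M (\<gamma> t)"
  shows "\<forall>\<^sub>F s in nhds t. snd c (\<gamma> s) \<in> Rn (mdim M)" "\<forall>\<^sub>F s in nhds t. param c (snd c (\<gamma> s)) = \<gamma> s"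
proof -
  note C = chart_coverD[OF smooth_manifoldD(2)[OF M] charts_atD(1)[OF c]]
  show "\<forall>\<^sub>F s in nhds t. snd c (\<gamma> s) \<in> Rn (mdim M)" "\<forall>\<^sub>F s in nhds t. param c (snd c (\<gamma> s)) = \<gamma> s"
    using curve_D_chart(1)[OF M D c] C(10) C(7) by (auto elim: eventually_mono)
qed

lemma curve_D_velocity:
  assumes M: "smooth_manifold M" and D: "curve_D M \<gamma> 0 v"
  shows "velocity M \<gamma> = v"
proof
  fix c
  show "velocity M \<gamma> c = v c"
  proof (cases "c \<in> charts_at M (\<gamma> 0)")
    case True
    then show ?thesis
      unfolding velocity_def using DERIV_imp_deriv[OF curve_D_chart(2)[OF M D True]] by simp
  next
    case False
    have "v c = (\<lambda>i. 0)"
      using curve_D_tangent[OF D] False unfolding tangent_space_def by blast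
    then show ?thesis using False by (simp add: velocity_def)
  qed
qed

lemma curve_D_map:
  assumes M: "smooth_manifold M" and N: "smooth_manifold N" and D: "curve_D M \<gamma> t v" and c: "c \<in> charts_at M (\<gamma> t)"
    and F: "smooth_plot N (mdim M) (snd c ` fst c) (\<lambda>y. F (param c y))"
  shows "curve_D N (\<lambda>s. F (\<gamma> s)) t (plot_deriv N (\<lambda>y. F (param c y)) (snd c (\<gamma> t)) (v c))"
proof (rule curve_D_plot(1)[where \<eta>="\<lambda>s. snd c (\<gamma> s)", OF N F])
  note C = chart_coverD[OF smooth_manifoldD(2)[OF M] charts_atD(1)[OF c]]
  show "snd c (\<gamma> t) \<in> snd c ` fst c" using charts_atD(2)[OF c] by simp
  show "\<forall>\<^sub>F s in nhds t. snd c (\<gamma> s) \<in> Rn (mdim M)" by (rule curve_D_local[OF M D c])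
  show "\<forall>\<^sub>F s in nhds t. F (\<gamma> s) = F (param c (snd c (\<gamma> s)))"
    using curve_D_local(2)[OF M D c] by (rule eventually_mono) simp
  show "v c \<in> Rn (mdim M)" by (rule tangent_in_Rn[OF curve_D_tangent[OF D] c])
qed (rule curve_D_chart(2)[OF M D c])

text \<open>Velocity of a function of two curves, computed in concatenated coordinates; tangent
  vectors of the product manifold are thereby avoided.\<close>

lemma curve_D_map2:
  assumes M: "smooth_manifold M" and N: "smooth_manifold N" and K: "smooth_manifold K"
    and D: "curve_D M \<gamma> t v" and c: "c \<in> charts_at M (\<gamma> t)"
    and D': "curve_D N \<gamma>' t v'" and c': "c' \<in> charts_at N (\<gamma>' t)"
    and F: "smooth_plot K (mdim M + mdim N) (vec_times (mdim M) (mdim N) (snd c ` fst c) (snd c' ` fst c'))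
      (\<lambda>w. F (param c (vec_take (mdim M) w)) (param c' (vec_drop (mdim M) w)))"
  shows "curve_D K (\<lambda>s. F (\<gamma> s) (\<gamma>' s)) t
    (plot_deriv K (\<lambda>w. F (param c (vec_take (mdim M) w)) (param c' (vec_drop (mdim M) w)))
      (vec_append (mdim M) (snd c (\<gamma> t)) (snd c' (\<gamma>' t))) (vec_append (mdim M) (v c) (v' c')))"
proof (rule curve_D_plot(1)[where \<eta>="\<lambda>s. vec_append (mdim M) (snd c (\<gamma> s)) (snd c' (\<gamma>' s))", OF K F])
  note C = chart_coverD[OF smooth_manifoldD(2)[OF M] charts_atD(1)[OF c]]
  note C' = chart_coverD[OF smooth_manifoldD(2)[OF N] charts_atD(1)[OF c']]
  note l = curve_D_local[OF M D c] and l' = curve_D_local[OF N D' c']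
  show "vec_append (mdim M) (snd c (\<gamma> t)) (snd c' (\<gamma>' t)) \<in> vec_times (mdim M) (mdim N) (snd c ` fst c) (snd c' ` fst c')"
    by (rule vec_append_times[OF C(3) C'(3) C(8) C'(8)]) (use charts_atD[OF c] charts_atD[OF c'] in simp_all)
  show "\<forall>\<^sub>F s in nhds t. vec_append (mdim M) (snd c (\<gamma> s)) (snd c' (\<gamma>' s)) \<in> Rn (mdim M + mdim N)"
    using l'(1) by (rule eventually_mono) (rule vec_append_Rn)
  show "\<forall>\<^sub>F s in nhds t. F (\<gamma> s) (\<gamma>' s) =
      F (param c (vec_take (mdim M) (vec_append (mdim M) (snd c (\<gamma> s)) (snd c' (\<gamma>' s)))))
        (param c' (vec_drop (mdim M) (vec_append (mdim M) (snd c (\<gamma> s)) (snd c' (\<gamma>' s)))))"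
    using l l' by eventually_elim (simp add: vec_take_append vec_drop_append)
  show "vec_append (mdim M) (v c) (v' c') \<in> Rn (mdim M + mdim N)"
    by (rule vec_append_Rn[OF tangent_in_Rn[OF curve_D_tangent[OF D'] c']])
  show "((\<lambda>s. vec_append (mdim M) (snd c (\<gamma> s)) (snd c' (\<gamma>' s)) i) has_real_derivative vec_append (mdim M) (v c) (v' c') i) (at t)" for i
    using curve_D_chart(2)[OF M D c, of i] curve_D_chart(2)[OF N D' c', of "i - mdim M"]
    by (simp add: vec_append_def)
qed

text \<open>In a chart the coordinates have zero derivative near each time, and charts are
  injective; hence the curve is locally constant, and connectedness of I does the rest.\<close>

lemma curve_D_zero_const:
  assumes M: "smooth_manifold M" and I: "open I" "connected I"
    and D: "\<And>t. t \<in> I \<Longrightarrow> curve_D M \<gamma> t tzero" and st: "s \<in> I" "t \<in> I"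
  shows "\<gamma> s = \<gamma> t"
proof (rule connected_local_const[OF I(2) st], rule ballI)
  fix a assume a: "a \<in> I"
  note cc = smooth_manifoldD(2)[OF M]
  obtain c where c: "c \<in> charts_at M (\<gamma> a)" using D[OF a] unfolding curve_D_def by blast
  note C = chart_coverD[OF cc charts_atD(1)[OF c]]
  have "\<forall>\<^sub>F b in nhds a. b \<in> I \<and> \<gamma> b \<in> fst c"
    using eventually_nhds_in_open[OF I(1) a] curve_D_chart(1)[OF M D[OF a] c] by (rule eventually_conj)
  then obtain e where e: "e > 0" "\<And>b. dist b a < e \<Longrightarrow> b \<in> I \<and> \<gamma> b \<in> fst c"
    unfolding eventually_nhds_metric by blast
  have "\<gamma> a = \<gamma> b" if b: "b \<in> ball a e" for b
  proof -
    have mem: "x \<in> I" "\<gamma> x \<in> fst c" if "x \<in> ball a e" for x using e(2)[of x] that by (auto simp: dist_commute)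
    have "snd c (\<gamma> b) i = snd c (\<gamma> a) i" for i
    proof -
      have "\<exists>k. \<forall>x\<in>ball a e. snd c (\<gamma> x) i = k"
      proof (rule has_field_derivative_zero_constant)
        fix x assume x: "x \<in> ball a e"
        have "c \<in> charts_at M (\<gamma> x)" using c mem(2)[OF x] by (simp add: charts_at_def)
        from curve_D_chart(2)[OF M D[OF mem(1)[OF x]] this]
        show "((\<lambda>x. snd c (\<gamma> x) i) has_real_derivative 0) (at x within ball a e)"
          by (auto simp: tzero_def intro: has_field_derivative_at_within)
      qed simp
      then show ?thesis using b e(1) by (metis centre_in_ball)
    qed
    then have "snd c (\<gamma> b) = snd c (\<gamma> a)" by (rule ext)
    then show ?thesis using inj_onD[OF C(2) _ mem(2)[OF b] charts_atD(2)[OF c]] by simp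
  qed
  then have "\<forall>\<^sub>F b in nhds a. \<gamma> a = \<gamma> b"
    unfolding eventually_nhds_metric using e(1) by (metis dist_commute mem_ball)
  then show "\<forall>\<^sub>F b in at a within I. \<gamma> a = \<gamma> b"
    by (simp add: eventually_at_filter eventually_mono)
qed

lemma curve_D_shift:
  assumes "curve_D M (\<lambda>s. \<gamma> (t + s)) 0 v"
  shows "curve_D M \<gamma> t v"
proof -
  from assms obtain c where c: "c \<in> charts_at M (\<gamma> t)" and v: "v \<in> tangent_space M (\<gamma> t)"
    and ev: "\<forall>\<^sub>F s in nhds 0. \<gamma> (t + s) \<in> fst c"
    and der: "\<And>i. ((\<lambda>s. snd c (\<gamma> (t + s)) i) has_real_derivative v c i) (at 0)"
    unfolding curve_D_def by auto
  have "\<forall>\<^sub>F s in nhds t. \<gamma> s \<in> fst c"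
    using ev by (subst (asm) eventually_nhds_metric, subst eventually_nhds_metric)
      (metis add.commute add_diff_cancel_left' diff_add_cancel dist_norm diff_zero)
  moreover have "((\<lambda>s. snd c (\<gamma> s) i) has_real_derivative v c i) (at t)" for i
    using der[of i] DERIV_shift[of "\<lambda>s. snd c (\<gamma> s) i" "v c i" 0 t] by (simp add: add.commute)
  ultimately show ?thesis unfolding curve_D_def using c v by blast
qed

section \<open>One-parameter subgroups\<close>

lemma plot_deriv_const:
  assumes "openin (Euclidean_space n) U" "u \<in> U" "\<xi> \<in> Rn n" "\<And>y. y \<in> U \<Longrightarrow> P y = x"
  shows "plot_deriv M P u \<xi> = tzero"
proof -
  have "plot_deriv M P u \<xi> = plot_deriv M (\<lambda>y. x) u \<xi>"
    by (rule plot_deriv_cong[OF assms])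
  then show ?thesis by (auto simp: plot_deriv_def tzero_def vderiv_def dderiv_def fun_eq_iff)
qed

lemma real_chart_param:
  assumes "y \<in> Rn 1"
  shows "inv_into UNIV (\<lambda>t i::nat. if i = 0 then t else (0::real)) y = y 0"
proof -
  from assms have y: "(\<lambda>t i::nat. if i = 0 then t else (0::real)) (y 0) = y" by (auto simp: Rn_iff fun_eq_iff)
  have "inj (\<lambda>t i::nat. if i = 0 then t else (0::real))"
  proof (rule injI)
    fix a b :: real
    assume "(\<lambda>i::nat. if i = 0 then a else 0) = (\<lambda>i. if i = 0 then b else 0)"
    from fun_cong[OF this, of 0] show "a = b" by simp
  qed
  from inv_f_f[OF this, of "y 0"] show ?thesis unfolding y .
qed

lemma real_chart_image: "(\<lambda>t i::nat. if i = 0 then t else (0::real)) ` UNIV = Rn 1"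
proof
  show "Rn 1 \<subseteq> (\<lambda>t i::nat. if i = 0 then t else (0::real)) ` UNIV"
  proof
    fix y assume "y \<in> Rn 1"
    then have "y = (\<lambda>t i::nat. if i = 0 then t else (0::real)) (y 0)" by (auto simp: Rn_iff fun_eq_iff)
    then show "y \<in> (\<lambda>t i::nat. if i = 0 then t else (0::real)) ` UNIV" by (rule image_eqI) simp
  qed
qed (auto simp: Rn_iff)

text \<open>The only chart of the line identifies it with \<open>Rn 1\<close>, so smooth curves
  become plots in one variable.\<close>

lemma smooth_map_real:
  "smooth_map real_mfd M \<gamma> \<longleftrightarrow> smooth_plot M 1 (Rn 1) (\<lambda>x. \<gamma> (x 0))"
proof -
  have "smooth_map real_mfd M \<gamma> \<longleftrightarrow>
      smooth_plot M 1 (Rn 1) (\<lambda>y. \<gamma> (inv_into UNIV (\<lambda>t i::nat. if i = 0 then t else (0::real)) y))"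
    by (simp add: smooth_map_def real_mfd_def real_chart_image)
  also have "\<dots> \<longleftrightarrow> smooth_plot M 1 (Rn 1) (\<lambda>x. \<gamma> (x 0))"
    by (rule iffI; erule smooth_plot_cong) (simp_all only: real_chart_param)
  finally show ?thesis .
qed

lemma curve_D_real_plot:
  assumes M: "smooth_manifold M" and P: "smooth_plot M 1 V (\<lambda>x. \<gamma> (x 0))"
    and t: "(\<lambda>i. if i = 0 then t else 0) \<in> V"
  shows "curve_D M \<gamma> t (plot_deriv M (\<lambda>x. \<gamma> (x 0)) (\<lambda>i. if i = 0 then t else 0) (basis_vec 0))"
  by (rule curve_D_plot(1)[where \<eta>="\<lambda>t i. if i = 0 then t else 0", OF M P t])
    (auto simp: Rn_iff basis_vec_def)

section \<open>Lie groups; uniqueness of one-parameter subgroups\<close>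

locale smooth_group =
  fixes G :: "'g monoid" and M :: "'g mfd"
  assumes LG: "lie_group G M"
begin

lemma mfd: "smooth_manifold M" and carrier_eq: "carrier G = mpoints M" and grp: "group G"
  using LG by (simp_all add: lie_group_def)

lemmas cc = smooth_manifoldD(2)[OF mfd]

sublocale group G by (rule grp)

abbreviation d where "d \<equiv> mdim M"
abbreviation c1 where "c1 \<equiv> some_chart M \<one>\<^bsub>G\<^esub>"
abbreviation e where "e \<equiv> snd c1 \<one>\<^bsub>G\<^esub>"
abbreviation O1 where "O1 \<equiv> snd c1 ` fst c1"
abbreviation p where "p \<equiv> param c1"

lemma c1_at: "c1 \<in> charts_at M \<one>\<^bsub>G\<^esub>"
  by (rule some_chart_at[OF cc]) (simp add: carrier_eq[symmetric])

lemmas c1D = charts_atD[OF c1_at]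
lemmas C1 = chart_coverD[OF cc c1D(1)]

lemma e_O1: "e \<in> O1" and p_e: "p e = \<one>\<^bsub>G\<^esub>"
  using c1D(2) C1(7) by simp_all

lemma p_carrier: "y \<in> O1 \<Longrightarrow> p y \<in> carrier G"
  unfolding carrier_eq by (rule C1(9)[OF C1(5)])

lemma p_plot: "smooth_plot M d O1 p" by (rule smooth_plot_param[OF mfd c1D(1)])

lemma plot_mult:
  assumes "smooth_plot M n U P" "smooth_plot M n U Q"
  shows "smooth_plot M n U (\<lambda>u. P u \<otimes>\<^bsub>G\<^esub> Q u)"
  using smooth_plot_map2[OF cc cc _ assms, of M "\<lambda>p. fst p \<otimes>\<^bsub>G\<^esub> snd p"] LG
  by (simp add: lie_group_def)

lemma plot_inv:
  assumes "smooth_plot M n U P"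
  shows "smooth_plot M n U (\<lambda>u. inv\<^bsub>G\<^esub> (P u))"
  using smooth_plot_map[OF cc _ assms, of M "\<lambda>g. inv\<^bsub>G\<^esub> g"] LG
  by (simp add: lie_group_def)

lemma plot_const: "openin (Euclidean_space n) U \<Longrightarrow> g \<in> carrier G \<Longrightarrow> smooth_plot M n U (\<lambda>u. g)"
  using smooth_plot_const[OF mfd] by (simp add: carrier_eq)

lemma times_plots:
  "smooth_plot M (d + d) (vec_times d d O1 O1) (\<lambda>w. p (vec_take d w))"
  "smooth_plot M (d + d) (vec_times d d O1 O1) (\<lambda>w. p (vec_drop d w))"
  by (rule smooth_plot_compose[OF p_plot vec_times_proj(1)[OF C1(3) C1(3)]])
    (rule smooth_plot_compose[OF p_plot vec_times_proj(2)[OF C1(3) C1(3)]])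

lemma times_openin: "openin (Euclidean_space (d + d)) (vec_times d d O1 O1)"
  by (rule vec_times_open[OF C1(3) C1(3)])

text \<open>The left logarithmic derivative of \<alpha> at t. Translating back by the inverse of
  \<alpha> t places the velocity in the fixed tangent space at the identity, so that constancy in t
  makes sense.\<close>

definition log_deriv :: "(real \<Rightarrow> 'g) \<Rightarrow> real \<Rightarrow> 'g tangent \<Rightarrow> bool" where
  "log_deriv \<alpha> t Z \<longleftrightarrow> curve_D M (\<lambda>s. inv\<^bsub>G\<^esub> (\<alpha> t) \<otimes>\<^bsub>G\<^esub> \<alpha> (t + s)) 0 Z"

text \<open>
  The velocity of \<open>x y\<^sup>-\<^sup>1\<close> at the identity vanishes in every diagonal direction, since \<open>x x\<^sup>-\<^sup>1\<close> is
  constant; this avoids computing the derivatives of multiplication and inversion.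
\<close>

lemma ratio_const:
  assumes I: "open I" "connected I" and st: "s \<in> I" "t \<in> I"
    and \<alpha>: "\<And>t. \<alpha> t \<in> carrier G" and \<beta>: "\<And>t. \<beta> t \<in> carrier G"
    and D: "\<And>t. t \<in> I \<Longrightarrow> log_deriv \<alpha> t Z" "\<And>t. t \<in> I \<Longrightarrow> log_deriv \<beta> t Z"
  shows "\<alpha> s \<otimes>\<^bsub>G\<^esub> inv\<^bsub>G\<^esub> (\<beta> s) = \<alpha> t \<otimes>\<^bsub>G\<^esub> inv\<^bsub>G\<^esub> (\<beta> t)"
proof (rule curve_D_zero_const[OF mfd I _ st])
  fix t assume t: "t \<in> I"
  let ?\<kappa>a = "\<lambda>s. inv\<^bsub>G\<^esub> (\<alpha> t) \<otimes>\<^bsub>G\<^esub> \<alpha> (t + s)" and ?\<kappa>b = "\<lambda>s. inv\<^bsub>G\<^esub> (\<beta> t) \<otimes>\<^bsub>G\<^esub> \<beta> (t + s)"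
  \<comment> \<open>On the two translated curves this takes the value \<alpha> (t + s) times the
    inverse of \<beta> (t + s), so its velocity at s = 0 is the one sought.\<close>
  let ?F = "\<lambda>x y. \<alpha> t \<otimes>\<^bsub>G\<^esub> (x \<otimes>\<^bsub>G\<^esub> inv\<^bsub>G\<^esub> y) \<otimes>\<^bsub>G\<^esub> inv\<^bsub>G\<^esub> (\<beta> t)"
  have one: "?\<kappa>a 0 = \<one>\<^bsub>G\<^esub>" "?\<kappa>b 0 = \<one>\<^bsub>G\<^esub>" using \<alpha> \<beta> by simp_all
  have ca: "c1 \<in> charts_at M (?\<kappa>a 0)" "c1 \<in> charts_at M (?\<kappa>b 0)" unfolding one by (rule c1_at)+
  let ?Q = "\<lambda>w. ?F (p (vec_take d w)) (p (vec_drop d w))"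
  have Q: "smooth_plot M (d + d) (vec_times d d O1 O1) ?Q"
    by (intro plot_mult plot_inv times_plots plot_const times_openin \<alpha> \<beta> inv_closed)
  note Da = D(1)[OF t, unfolded log_deriv_def] and Db = D(2)[OF t, unfolded log_deriv_def]
  have Zc: "Z c1 \<in> Rn d" using tangent_in_Rn[OF curve_D_tangent[OF Da] ca(1)] .
  have "curve_D M (\<lambda>s. ?F (?\<kappa>a s) (?\<kappa>b s)) 0 (plot_deriv M ?Q (vec_append d e e) (vec_append d (Z c1) (Z c1)))"
    using curve_D_map2[where F="?F", OF mfd mfd mfd Da ca(1) Db ca(2) Q] unfolding one .
  moreover have "plot_deriv M ?Q (vec_append d e e) (vec_append d (Z c1) (Z c1)) = tzero"
  proof -
    have diag: "euclid_smooth_map d O1 (d + d) (vec_times d d O1 O1) (\<lambda>y. vec_append d y y)"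
      by (rule vec_append_smooth[OF id_smooth[OF C1(3)] id_smooth[OF C1(3)]])
    have "plot_deriv M (\<lambda>y. ?Q (vec_append d y y)) e (Z c1) = plot_deriv M ?Q (vec_append d e e) (vderiv (\<lambda>y. vec_append d y y) e (Z c1))"
      by (rule plot_deriv_compose[OF cc Q diag e_O1 Zc])
    also have "vderiv (\<lambda>y. vec_append d y y) e (Z c1) = vec_append d (Z c1) (Z c1)"
      by (simp add: vderiv_append vderiv_id)
    finally have "plot_deriv M ?Q (vec_append d e e) (vec_append d (Z c1) (Z c1)) = plot_deriv M (\<lambda>y. ?Q (vec_append d y y)) e (Z c1)" ..
    also have "\<dots> = tzero"
    proof (rule plot_deriv_const[OF C1(3) e_O1 Zc])
      fix y assume y: "y \<in> O1"
      have "vec_take d (vec_append d y y) = y" "vec_drop d (vec_append d y y) = y"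
        using vec_take_append vec_drop_append openin_Rn_subset[OF C1(3) y] by blast+
      then show "?Q (vec_append d y y) = \<alpha> t \<otimes>\<^bsub>G\<^esub> inv\<^bsub>G\<^esub> (\<beta> t)"
        using p_carrier[OF y] \<alpha> \<beta> by (simp add: r_inv)
    qed
    finally show ?thesis .
  qed
  moreover have "?F (?\<kappa>a s) (?\<kappa>b s) = \<alpha> (t + s) \<otimes>\<^bsub>G\<^esub> inv\<^bsub>G\<^esub> (\<beta> (t + s))" for s
    using \<alpha> \<beta> by (simp add: inv_mult_group m_assoc[symmetric]) (simp add: m_assoc)
  ultimately have "curve_D M (\<lambda>s. \<alpha> (t + s) \<otimes>\<^bsub>G\<^esub> inv\<^bsub>G\<^esub> (\<beta> (t + s))) 0 tzero" by simp
  then show "curve_D M (\<lambda>s. \<alpha> s \<otimes>\<^bsub>G\<^esub> inv\<^bsub>G\<^esub> (\<beta> s)) t tzero"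
    by (rule curve_D_shift)
qed

lemma one_param_facts:
  assumes "one_param_subgroup G M \<gamma>"
  shows "\<gamma> t \<in> carrier G" "\<gamma> 0 = \<one>\<^bsub>G\<^esub>" "inv\<^bsub>G\<^esub> (\<gamma> t) \<otimes>\<^bsub>G\<^esub> \<gamma> (t + s) = \<gamma> s"
    "curve_D M \<gamma> 0 (velocity M \<gamma>)" "velocity M \<gamma> \<in> lie_algebra G M"
proof -
  have sm: "smooth_plot M 1 (Rn 1) (\<lambda>x. \<gamma> (x 0))" and hom: "\<And>s t. \<gamma> (s + t) = \<gamma> s \<otimes>\<^bsub>G\<^esub> \<gamma> t"
    using assms unfolding one_param_subgroup_def smooth_map_real by auto
  show 1: "\<gamma> t \<in> carrier G" for t
    using smooth_plotD(2)[OF sm, of "\<lambda>i. if i = 0 then t else 0"] by (simp add: carrier_eq Rn_iff)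
  show 0: "\<gamma> 0 = \<one>\<^bsub>G\<^esub>"
    using hom[of 0 0] 1[of 0] by (metis add_0 l_cancel_one')
  show "inv\<^bsub>G\<^esub> (\<gamma> t) \<otimes>\<^bsub>G\<^esub> \<gamma> (t + s) = \<gamma> s"
    unfolding hom using 1 by (simp add: m_assoc[symmetric])
  have "\<exists>v. curve_D M \<gamma> 0 v"
    using curve_D_real_plot[OF mfd sm, of 0] by (auto simp: Rn_iff)
  then show D: "curve_D M \<gamma> 0 (velocity M \<gamma>)" using curve_D_velocity[OF mfd] by metis
  show "velocity M \<gamma> \<in> lie_algebra G M"
    using curve_D_tangent[OF D] by (simp add: lie_algebra_def 0)
qed

text \<open>The logarithmic derivative of a one-parameter subgroup is constantly its velocity at 0.
  By \<open>ratio_const\<close> the quotient of two with equal velocities keeps its value at 0, the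
  identity.\<close>

lemma one_param_unique:
  assumes "one_param_subgroup G M \<alpha>" "one_param_subgroup G M \<beta>" "velocity M \<alpha> = velocity M \<beta>"
  shows "\<alpha> = \<beta>"
proof
  fix t
  note a = one_param_facts[OF assms(1)] and b = one_param_facts[OF assms(2)]
  have "\<alpha> t \<otimes>\<^bsub>G\<^esub> inv\<^bsub>G\<^esub> (\<beta> t) = \<alpha> 0 \<otimes>\<^bsub>G\<^esub> inv\<^bsub>G\<^esub> (\<beta> 0)"
    by (rule ratio_const[of UNIV _ _ \<alpha> \<beta> "velocity M \<alpha>"])
      (use a(1,3,4) b(1,3,4) assms(3) in \<open>auto simp: log_deriv_def\<close>)
  then have "\<alpha> t \<otimes>\<^bsub>G\<^esub> inv\<^bsub>G\<^esub> (\<beta> t) = \<one>\<^bsub>G\<^esub>" using a(2) b(2) by simp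
  then show "\<alpha> t = \<beta> t" using a(1) b(1) by (metis inv_closed inv_equality inv_inv)
qed

lemma curve_D_scale:
  assumes D: "curve_D M \<gamma> 0 v"
  shows "curve_D M (\<lambda>s. \<gamma> (r * s)) 0 (tscale r v)"
proof -
  from D obtain c where c: "c \<in> charts_at M (\<gamma> 0)" unfolding curve_D_def by blast
  note C = chart_coverD[OF cc charts_atD(1)[OF c]]
  have x: "\<gamma> 0 \<in> mpoints M" using C(9) charts_atD(2)[OF c] .
  have ev: "\<forall>\<^sub>F s in nhds 0. \<gamma> (r * s) \<in> fst c"
  proof -
    have "((\<lambda>s::real. r * s) \<longlongrightarrow> 0) (nhds 0)"
      by (auto intro!: tendsto_eq_intros simp: filterlim_ident)
    from eventually_compose_filterlim[OF curve_D_chart(1)[OF mfd D c] this] show ?thesis .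
  qed
  have "((\<lambda>s. snd c (\<gamma> (r * s)) i) has_real_derivative v c i * r) (at 0)" for i
  proof (rule DERIV_chain2[where f="\<lambda>s. snd c (\<gamma> s) i" and g="\<lambda>s. r * s"])
    show "((\<lambda>s. snd c (\<gamma> s) i) has_real_derivative v c i) (at (r * 0))"
      using curve_D_chart(2)[OF mfd D c] by simp
    show "((\<lambda>s. r * s) has_real_derivative r) (at 0)" by (auto intro!: derivative_eq_intros)
  qed
  moreover have "tscale r v \<in> tangent_space M (\<gamma> 0)"
  proof -
    \<comment> \<open>The summand with coefficient 0 only fits the two-vector form of
      \<open>tadd_tangent\<close>.\<close>
    have "tadd (tscale r v) (tscale 0 v) \<in> tangent_space M (\<gamma> 0)"
      by (intro tadd_tangent[OF mfd x] curve_D_tangent[OF D])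
    then show ?thesis by (simp add: tadd_def tscale_def)
  qed
  ultimately show ?thesis
    unfolding curve_D_def using c ev by (auto simp: tscale_def mult.commute)
qed

text \<open>Scaling time by t scales the velocity by t, and \<open>lie_exp\<close> evaluates at time
  1 the unique subgroup with that velocity.\<close>

lemma lie_exp_one_param:
  assumes \<gamma>: "one_param_subgroup G M \<gamma>"
  shows "lie_exp G M (tscale t (velocity M \<gamma>)) = \<gamma> t"
proof -
  note f = one_param_facts[OF \<gamma>]
  have sm: "smooth_plot M 1 (Rn 1) (\<lambda>x. \<gamma> (x 0))" and hom: "\<And>s t. \<gamma> (s + t) = \<gamma> s \<otimes>\<^bsub>G\<^esub> \<gamma> t"
    using \<gamma> unfolding one_param_subgroup_def smooth_map_real by auto
  define \<delta> where "\<delta> s = \<gamma> (t * s)" for s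
  have R: "openin (Euclidean_space 1) (Rn 1)" by simp
  have "euclid_smooth_map 1 (Rn 1) 1 (Rn 1) (\<lambda>x i. t * x i)"
    unfolding euclid_smooth_map_def
    by (auto simp: Rn_iff intro!: smooth_fun_mult smooth_fun_const smooth_fun_coord)
  from smooth_plot_compose[OF sm this] have "smooth_plot M 1 (Rn 1) (\<lambda>x. \<delta> (x 0))"
    by (simp add: \<delta>_def)
  then have 1: "one_param_subgroup G M \<delta>"
    unfolding one_param_subgroup_def smooth_map_real using hom by (simp add: \<delta>_def distrib_left)
  have 2: "velocity M \<delta> = tscale t (velocity M \<gamma>)"
    unfolding \<delta>_def by (rule curve_D_velocity[OF mfd curve_D_scale[OF f(4)]])
  have "(THE \<gamma>'. one_param_subgroup G M \<gamma>' \<and> velocity M \<gamma>' = tscale t (velocity M \<gamma>)) = \<delta>"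
    by (rule the_equality) (use 1 2 one_param_unique in auto)
  then show ?thesis by (simp add: lie_exp_def \<delta>_def)
qed

end

section \<open>Existence of one-parameter subgroups\<close>

lemma curve_D_cong:
  assumes ev: "\<forall>\<^sub>F s in nhds t. \<gamma> s = \<gamma>' s" and D: "curve_D M \<gamma> t v"
  shows "curve_D M \<gamma>' t v"
proof -
  have t: "\<gamma> t = \<gamma>' t" by (rule eventually_nhds_x_imp_x[OF ev])
  from D obtain c where c: "c \<in> charts_at M (\<gamma> t)" and v: "v \<in> tangent_space M (\<gamma> t)"
    and 1: "\<forall>\<^sub>F s in nhds t. \<gamma> s \<in> fst c"
    and der: "\<And>i. ((\<lambda>s. snd c (\<gamma> s) i) has_real_derivative v c i) (at t)"
    unfolding curve_D_def by blast
  have "\<forall>\<^sub>F s in nhds t. \<gamma>' s \<in> fst c" using 1 ev by eventually_elim simp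
  moreover have "((\<lambda>s. snd c (\<gamma>' s) i) has_real_derivative v c i) (at t)" for i
  proof -
    have "\<forall>\<^sub>F s in nhds t. snd c (\<gamma>' s) i = snd c (\<gamma> s) i" using ev by eventually_elim simp
    then show ?thesis using der[of i] by (simp add: DERIV_cong_ev[OF refl _ refl])
  qed
  ultimately show ?thesis unfolding curve_D_def t[symmetric] using c v by blast
qed

text \<open>\<Gamma> t is the n-th power of g (t / n), with n so large that t / n is in range.
  Passing to the common multiple n m shows that the choice of n does not matter, so s, t and s + t
  can share one n.\<close>

lemma (in group) local_hom_extend:
  fixes g :: "real \<Rightarrow> 'a"
  assumes \<delta>: "\<delta> > 0" and g: "\<And>t. g t \<in> carrier G"
    and hom: "\<And>s t. \<bar>s\<bar> < \<delta> \<Longrightarrow> \<bar>t\<bar> < \<delta> \<Longrightarrow> g (s + t) = g s \<otimes> g t"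
  obtains \<Gamma> where "\<And>t. \<Gamma> t \<in> carrier G" "\<And>s t. \<Gamma> (s + t) = \<Gamma> s \<otimes> \<Gamma> t" "\<And>t. \<bar>t\<bar> < \<delta> \<Longrightarrow> \<Gamma> t = g t"
proof -
  have g0: "g 0 = \<one>" using hom[of 0 0] g[of 0] \<delta> by simp
  have pow: "g t = g (t / n) [^] n" if t: "\<bar>t\<bar> < \<delta>" and n: "n > 0" for t and n :: nat
  proof -
    have "j \<le> n \<Longrightarrow> g (real j * t / n) = g (t / n) [^] j" for j
    proof (induction j)
      case 0
      then show ?case by (simp add: g0)
    next
      case (Suc j)
      have "real j * \<bar>t\<bar> \<le> real n * \<bar>t\<bar>" "1 * \<bar>t\<bar> \<le> real n * \<bar>t\<bar>"
        using Suc n by (intro mult_right_mono; simp)+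
      then have "\<bar>real j * t / n\<bar> \<le> \<bar>t\<bar>" "\<bar>t / n\<bar> \<le> \<bar>t\<bar>"
        using n by (simp_all add: abs_mult divide_le_eq mult.commute)
      then have "g (real j * t / n + t / n) = g (real j * t / n) \<otimes> g (t / n)"
        using t by (intro hom) linarith+
      moreover have "real (Suc j) * t / n = real j * t / n + t / n" by (simp add: add_divide_distrib algebra_simps)
      ultimately show ?case using Suc g by simp
    qed
    from this[of n] show ?thesis using n by simp
  qed
  define E where "E t n = g (t / real n) [^] n" for t and n :: nat
  have E_mult: "E t (n * m) = E t n" if "\<bar>t / n\<bar> < \<delta>" "n > 0" "m > 0" for t and n m :: nat
  proof -
    have "E t (n * m) = (g (t / n / m) [^] m) [^] n"
      using g by (simp add: E_def nat_pow_pow mult.commute)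
    also have "g (t / n / m) [^] m = g (t / n)" by (rule pow[OF that(1,3), symmetric])
    finally show ?thesis by (simp add: E_def)
  qed
  have E_eq: "E t n = E t m" if "\<bar>t / n\<bar> < \<delta>" "\<bar>t / m\<bar> < \<delta>" "n > 0" "m > 0" for t and n m :: nat
    using E_mult[OF that(1,3,4)] E_mult[OF that(2,4,3)] by (simp add: mult.commute)
  \<comment> \<open>The summand 1 brings the quotient strictly below \<delta> and makes the divisor
    positive.\<close>
  define N where "N t = nat \<lceil>\<bar>t\<bar> / \<delta>\<rceil> + 1" for t :: real
  have N: "N t > 0" "\<bar>s\<bar> \<le> t \<Longrightarrow> \<bar>s / N t\<bar> < \<delta>" for s t
  proof -
    show "N t > 0" by (simp add: N_def)
    assume s: "\<bar>s\<bar> \<le> t"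
    have "\<bar>t\<bar> / \<delta> < N t" unfolding N_def by linarith
    then have "t < \<delta> * N t" using \<delta> s by (simp add: field_simps)
    then show "\<bar>s / N t\<bar> < \<delta>" using s \<open>N t > 0\<close> by (simp add: field_simps)
  qed
  define \<Gamma> where "\<Gamma> t = E t (N \<bar>t\<bar>)" for t
  have \<Gamma>E: "\<Gamma> t = E t n" if "\<bar>t / n\<bar> < \<delta>" "n > 0" for t and n :: nat
    unfolding \<Gamma>_def by (rule E_eq[OF N(2) that(1) N(1) that(2)]) simp
  show thesis
  proof (rule that)
    show "\<Gamma> t \<in> carrier G" for t using g by (simp add: \<Gamma>_def E_def)
    show "\<Gamma> t = g t" if "\<bar>t\<bar> < \<delta>" for t using \<Gamma>E[of t 1] that g by (simp add: E_def)
    fix s t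
    define n where "n = N (\<bar>s\<bar> + \<bar>t\<bar>)"
    have n: "n > 0" "\<bar>s / n\<bar> < \<delta>" "\<bar>t / n\<bar> < \<delta>" "\<bar>(s + t) / n\<bar> < \<delta>"
      unfolding n_def by (rule N(1)) (rule N(2), linarith)+
    \<comment> \<open>Since s + t = t + s, the two small values commute, as the power of a product
      requires.\<close>
    have "g (s / n) \<otimes> g (t / n) = g (t / n) \<otimes> g (s / n)"
      using hom[OF n(2,3)] hom[OF n(3,2)] by (simp add: add.commute)
    then have "(g (s / n) \<otimes> g (t / n)) [^] n = g (s / n) [^] n \<otimes> g (t / n) [^] n"
      using g by (intro pow_mult_distrib) auto
    moreover have "g ((s + t) / n) = g (s / n) \<otimes> g (t / n)"
      using hom[OF n(2,3)] by (simp add: add_divide_distrib)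
    ultimately show "\<Gamma> (s + t) = \<Gamma> s \<otimes> \<Gamma> t"
      using \<Gamma>E n by (simp add: E_def)
  qed
qed

context smooth_group
begin

text \<open>In the chart at the identity, solve the equation of the left-invariant vector field
  whose value at e is \<zeta>. Left translations preserve this field, so the logarithmic derivative
  of the solution is constant.\<close>

lemma local_one_param:
  assumes \<zeta>: "\<zeta> \<in> Rn d"
  obtains \<epsilon> \<gamma> where "\<epsilon> > 0" "\<And>t. \<gamma> t \<in> carrier G" "\<gamma> 0 = \<one>\<^bsub>G\<^esub>"
    "smooth_plot M 1 {x \<in> Rn 1. \<bar>x 0\<bar> < \<epsilon>} (\<lambda>x. \<gamma> (x 0))"
    "\<And>t. \<bar>t\<bar> < \<epsilon> \<Longrightarrow> log_deriv \<gamma> t (plot_deriv M p e \<zeta>)"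
proof -
  let ?W = "vec_times d d O1 O1"
  let ?m = "\<lambda>w. p (vec_take d w) \<otimes>\<^bsub>G\<^esub> p (vec_drop d w)"
  \<comment> \<open>Multiplication can be read in the chart only where the product stays in its
    domain. Every pair (y, e) qualifies, so the field is defined on all of
    \<open>O1\<close>.\<close>
  let ?W' = "{w \<in> ?W. ?m w \<in> fst c1}"
  have m: "smooth_plot M (d + d) ?W ?m" by (intro plot_mult times_plots)
  note rep = smooth_plot_rep[OF cc m c1D(1)]
  define h where "h w = snd c1 (?m w)" for w
  have h: "euclid_smooth_map (d + d) ?W' d O1 h" unfolding h_def by (rule rep)
  have W': "openin (Euclidean_space (d + d)) ?W'" by (rule euclid_smooth_mapD(1)[OF h])
  have eR: "e \<in> Rn d" by (rule openin_Rn_subset[OF C1(3) e_O1])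
  have pr_j: "vec_take d (vec_append d y z) = y" "vec_drop d (vec_append d y z) = z" if "y \<in> O1" for y z
    using vec_take_append[OF openin_Rn_subset[OF C1(3) that]] vec_drop_append by simp_all
  have emb0: "euclid_smooth_map d O1 (d + d) ?W (\<lambda>y. vec_append d y e)"
    by (rule vec_append_smooth[OF id_smooth[OF C1(3)] const_smooth[OF C1(3) C1(3) e_O1]])
  have emb: "euclid_smooth_map d O1 (d + d) ?W' (\<lambda>y. vec_append d y e)"
  proof (rule euclid_smooth_map_restrict[OF emb0 C1(3) subset_refl W'])
    show "(\<lambda>y. vec_append d y e) ` O1 \<subseteq> ?W'"
    proof
      fix w assume "w \<in> (\<lambda>y. vec_append d y e) ` O1"
      then obtain y where y: "y \<in> O1" "w = vec_append d y e" by blast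
      then show "w \<in> ?W'"
        using euclid_smooth_mapD(5)[OF emb0 y(1)] pr_j[OF y(1), of e] C1(5)[OF y(1)] p_carrier[OF y(1)] p_e by simp
    qed
  qed
  define j\<zeta> where "j\<zeta> = vec_append d (\<lambda>i. 0) \<zeta>"
  have j\<zeta>: "j\<zeta> \<in> Rn (d + d)" unfolding j\<zeta>_def by (rule vec_append_Rn[OF \<zeta>])
  \<comment> \<open>The derivative of multiplication in the second factor at (y, e), in direction
    \<zeta>: the left-invariant field in coordinates.\<close>
  define f where "f i y = dderiv (\<lambda>w. h w i) (vec_append d y e) j\<zeta>" for i y
  have f_smooth: "smooth_fun d O1 (f i)" for i
    unfolding f_def
    by (rule euclid_smooth_map_smooth_fun[OF emb smooth_fun_dderiv[OF W' euclid_smooth_map_coord[OF h] j\<zeta>]])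
  obtain \<epsilon> y where \<epsilon>: "\<epsilon> > 0" and y: "y 0 = e" "\<And>t. y t \<in> O1"
    and yD: "\<And>t i. \<bar>t\<bar> < \<epsilon> \<Longrightarrow> i < d \<Longrightarrow> ((\<lambda>t. y t i) has_real_derivative f i (y t)) (at t)"
    and ysm: "\<And>i. smooth_fun 1 {x \<in> Rn 1. \<bar>x 0\<bar> < \<epsilon>} (\<lambda>x. y (x 0) i)"
    by (rule smooth_ode_local[where F=f, OF C1(3) f_smooth e_O1]) (rule that, assumption+)
  define \<gamma> where "\<gamma> t = p (y t)" for t
  let ?V = "{x \<in> Rn 1. \<bar>x 0\<bar> < \<epsilon>}"
  have V: "openin (Euclidean_space 1) ?V"
  using open_Rn_box[of "\<lambda>i. 0" 1 "\<epsilon>"] by (simp add: Rn_iff)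
  have "euclid_smooth_map 1 ?V d O1 (\<lambda>x. y (x 0))"
    unfolding euclid_smooth_map_def using V C1(3) y(2) ysm by blast
  from smooth_plot_compose[OF p_plot this]
  have sm: "smooth_plot M 1 ?V (\<lambda>x. \<gamma> (x 0))" by (simp add: \<gamma>_def)
  have log: "log_deriv \<gamma> t (plot_deriv M p e \<zeta>)" if t: "\<bar>t\<bar> < \<epsilon>" for t
  proof -
    define Y where "Y = y t"
    have Y: "Y \<in> O1" unfolding Y_def by (rule y(2))
    note pY = p_carrier[OF Y]
    let ?Pl = "\<lambda>x. inv\<^bsub>G\<^esub> (p Y) \<otimes>\<^bsub>G\<^esub> p x"
    have Pl: "smooth_plot M d O1 ?Pl"
      by (intro plot_mult plot_const p_plot inv_closed pY C1(3))
    \<comment> \<open>Left translation by \<open>p Y\<close> in coordinates; it carries \<zeta> at e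
      to the field at Y. Since \<open>?Pl\<close> undoes the translation, differentiating the
      composite of \<open>?Pl\<close> and \<open>?k\<close> shows that \<open>?Pl\<close> carries
      the field at Y back to the velocity of p at e.\<close>
    let ?k = "\<lambda>z. snd c1 (p Y \<otimes>\<^bsub>G\<^esub> p z)" and ?V = "{z \<in> O1. p Y \<otimes>\<^bsub>G\<^esub> p z \<in> fst c1}"
    have k: "euclid_smooth_map d ?V d O1 ?k"
      by (rule smooth_plot_rep[OF cc _ c1D(1)]) (intro plot_mult plot_const p_plot pY C1(3))
    note V = euclid_smooth_mapD(1)[OF k]
    have eV: "e \<in> ?V" using e_O1 p_e pY C1(5)[OF Y] by simp
    have ke: "?k e = Y" using p_e pY C1(6)[OF Y] by simp
    have embz0: "euclid_smooth_map d ?V (d + d) ?W (\<lambda>z. vec_append d Y z)"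
      by (rule vec_append_smooth[OF const_smooth[OF V C1(3) Y] euclid_smooth_map_inclusion[OF C1(3) V]]) auto
    have embz: "euclid_smooth_map d ?V (d + d) ?W' (\<lambda>z. vec_append d Y z)"
      by (rule euclid_smooth_map_restrict[OF embz0 V subset_refl W'])
        (use euclid_smooth_mapD(5)[OF embz0] pr_j[OF Y] in auto)
    have "vderiv (\<lambda>z. h (vec_append d Y z)) e \<zeta> = vderiv h (vec_append d Y e) (vderiv (\<lambda>z. vec_append d Y z) e \<zeta>)"
      by (rule vderiv_chain[OF embz h eV \<zeta>])
    also have "vderiv (\<lambda>z. vec_append d Y z) e \<zeta> = j\<zeta>"
      by (simp add: vderiv_append vderiv_const vderiv_id j\<zeta>_def)
    also have "vderiv h (vec_append d Y e) j\<zeta> = (\<lambda>i. f i Y)" by (simp add: vderiv_def f_def)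
    finally have vk: "vderiv ?k e \<zeta> = (\<lambda>i. f i Y)" by (simp add: h_def pr_j[OF Y])
    have fR: "(\<lambda>i. f i Y) \<in> Rn d" using vderiv_in_Rn[OF k eV \<zeta>] unfolding vk .
    have "plot_deriv M (\<lambda>z. ?Pl (?k z)) e \<zeta> = plot_deriv M ?Pl (?k e) (vderiv ?k e \<zeta>)"
      by (rule plot_deriv_compose[OF cc Pl k eV \<zeta>])
    moreover have "plot_deriv M (\<lambda>z. ?Pl (?k z)) e \<zeta> = plot_deriv M p e \<zeta>"
    proof (rule plot_deriv_cong[OF V eV \<zeta>])
      fix z assume z: "z \<in> ?V"
      then have "?Pl (?k z) = inv\<^bsub>G\<^esub> (p Y) \<otimes>\<^bsub>G\<^esub> (p Y \<otimes>\<^bsub>G\<^esub> p z)" using C1(7) by simp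
      also have "\<dots> = p z" using pY p_carrier z by (simp add: m_assoc[symmetric])
      finally show "?Pl (?k z) = p z" .
    qed
    ultimately have Z: "plot_deriv M ?Pl Y (\<lambda>i. f i Y) = plot_deriv M p e \<zeta>" unfolding vk ke by simp
    have "curve_D M (\<lambda>s. ?Pl (y (t + s))) 0 (plot_deriv M ?Pl (y (t + 0)) (\<lambda>i. f i Y))"
    proof (rule curve_D_plot(1)[where \<eta>="\<lambda>s. y (t + s)", OF mfd Pl])
      show "y (t + 0) \<in> O1" by (rule y(2))
      show "\<forall>\<^sub>F s in nhds 0. y (t + s) \<in> Rn d"
        using openin_Rn_subset[OF C1(3) y(2)] by (intro always_eventually) blast
      show "((\<lambda>s. y (t + s) i) has_real_derivative f i Y) (at 0)" if "i < d" for i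
        using yD[OF t that] DERIV_shift[of "\<lambda>s. y s i" "f i Y" 0 t] by (simp add: Y_def add.commute)
    qed (use fR in auto)
    then show ?thesis unfolding log_deriv_def using Z by (simp add: \<gamma>_def Y_def)
  qed
  show thesis
    by (rule that[OF \<epsilon> _ _ sm log]) (use y p_e p_carrier in \<open>simp_all add: \<gamma>_def\<close>)
qed

text \<open>The local solution is multiplicative near 0 because shifting its time by s leaves the
  logarithmic derivative unchanged. \<open>local_hom_extend\<close> makes it global, and smoothness
  anywhere reduces by translation to smoothness near 0.\<close>

lemma one_param_exists:
  assumes Z: "Z \<in> lie_algebra G M"
  obtains \<gamma> where "one_param_subgroup G M \<gamma>" "velocity M \<gamma> = Z"
proof -
  have Zt: "Z \<in> tangent_space M \<one>\<^bsub>G\<^esub>" using Z by (simp add: lie_algebra_def)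
  define \<zeta> where "\<zeta> = Z c1"
  have \<zeta>: "\<zeta> \<in> Rn d" unfolding \<zeta>_def by (rule tangent_in_Rn[OF Zt c1_at])
  have ZP: "plot_deriv M p e \<zeta> = Z" unfolding \<zeta>_def by (rule tangent_rep[OF cc Zt c1_at, symmetric])
  obtain \<epsilon> g where \<epsilon>: "\<epsilon> > 0" and g: "\<And>t. g t \<in> carrier G" "g 0 = \<one>\<^bsub>G\<^esub>"
    and sm: "smooth_plot M 1 {x \<in> Rn 1. \<bar>x 0\<bar> < \<epsilon>} (\<lambda>x. g (x 0))"
    and log: "\<And>t. \<bar>t\<bar> < \<epsilon> \<Longrightarrow> log_deriv g t Z"
    using local_one_param[OF \<zeta>] unfolding ZP by blast
  \<comment> \<open>Half the interval, so that s + r stays in it when both summands are below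
    \<delta> in absolute value.\<close>
  define \<delta> where "\<delta> = \<epsilon> / 2"
  have \<delta>: "\<delta> > 0" "\<delta> < \<epsilon>" using \<epsilon> by (simp_all add: \<delta>_def)
  have hom: "g (s + t) = g s \<otimes>\<^bsub>G\<^esub> g t" if s: "\<bar>s\<bar> < \<delta>" and t: "\<bar>t\<bar> < \<delta>" for s t
  proof -
    have I: "{-\<delta><..<\<delta>} = {r. \<bar>r\<bar> < \<delta>}" by auto
    have "g (s + t) \<otimes>\<^bsub>G\<^esub> inv\<^bsub>G\<^esub> (g t) = g (s + 0) \<otimes>\<^bsub>G\<^esub> inv\<^bsub>G\<^esub> (g 0)"
    proof (rule ratio_const[of "{-\<delta><..<\<delta>}" t 0 "\<lambda>r. g (s + r)" g Z])
      show "log_deriv (\<lambda>r. g (s + r)) r Z" if "r \<in> {-\<delta><..<\<delta>}" for r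
      proof -
        have "\<bar>s + r\<bar> < \<epsilon>" using that s by (auto simp: \<delta>_def)
        from log[OF this] show ?thesis by (simp add: log_deriv_def add.assoc)
      qed
      show "log_deriv g r Z" if "r \<in> {-\<delta><..<\<delta>}" for r
        by (rule log) (use that \<delta> in auto)
    qed (use t \<delta> g in auto)
    then have "g (s + t) \<otimes>\<^bsub>G\<^esub> inv\<^bsub>G\<^esub> (g t) = g s" using g by simp
    then show ?thesis using g(1) by (metis inv_closed inv_inv m_closed inv_solve_right)
  qed
  obtain \<Gamma> where \<Gamma>: "\<And>t. \<Gamma> t \<in> carrier G" "\<And>s t. \<Gamma> (s + t) = \<Gamma> s \<otimes>\<^bsub>G\<^esub> \<Gamma> t"
    "\<And>t. \<bar>t\<bar> < \<delta> \<Longrightarrow> \<Gamma> t = g t"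
    using local_hom_extend[of \<delta> g] \<delta>(1) g(1) hom by blast
  have "smooth_plot M 1 (Rn 1) (\<lambda>x. \<Gamma> (x 0))"
  proof (rule smooth_plot_local)
    show "openin (Euclidean_space 1) (Rn 1)" by simp
    fix u assume u: "u \<in> Rn 1"
    \<comment> \<open>Shift of the parameter: for x near u, \<Gamma> (x 0) is \<Gamma> (u 0) times g
      at the small difference x 0 - u 0.\<close>
    let ?T = "\<lambda>x i. if i = (0::nat) then x 0 - u 0 else (0::real)"
    have R: "openin (Euclidean_space 1) (Rn 1)" by simp
    have "smooth_fun 1 (Rn 1) (\<lambda>x. x 0 + (- u 0))"
      by (intro smooth_fun_add smooth_fun_coord smooth_fun_const R)
    then have T: "euclid_smooth_map 1 (Rn 1) 1 (Rn 1) ?T"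
      unfolding euclid_smooth_map_def by (auto simp: Rn_iff)
    let ?B = "{x \<in> Rn 1. \<bar>x 0\<bar> < \<epsilon>}"
    let ?V = "{x \<in> Rn 1. ?T x \<in> ?B}"
    note B = smooth_plotD(1)[OF sm]
    have V: "openin (Euclidean_space 1) ?V" by (rule euclid_smooth_map_vimage[OF T B])
    have T': "euclid_smooth_map 1 ?V 1 ?B ?T"
      by (rule euclid_smooth_map_restrict[OF T V _ B]) auto
    have "openin (Euclidean_space 1) {x \<in> Rn 1. \<bar>x 0\<bar> < \<delta>}"
    using open_Rn_box[of "\<lambda>i. 0" 1 "\<delta>"] by (simp add: Rn_iff)
    from euclid_smooth_map_vimage[OF T this]
    have V': "openin (Euclidean_space 1) {x \<in> Rn 1. ?T x \<in> {x \<in> Rn 1. \<bar>x 0\<bar> < \<delta>}}" (is "openin _ ?V'") .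
    have V'V: "?V' \<subseteq> ?V" using \<delta>(2) by auto
    have "smooth_plot M 1 ?V (\<lambda>x. g (?T x 0))" by (rule smooth_plot_compose[OF sm T'])
    from plot_mult[OF plot_const[OF V' \<Gamma>(1)[of "u 0"]] smooth_plot_subset[OF this V' V'V]]
    have "smooth_plot M 1 ?V' (\<lambda>x. \<Gamma> (u 0) \<otimes>\<^bsub>G\<^esub> g (?T x 0))" .
    then have "smooth_plot M 1 ?V' (\<lambda>x. \<Gamma> (x 0))"
    proof (rule smooth_plot_cong)
      fix x assume "x \<in> ?V'"
      then have "g (?T x 0) = \<Gamma> (x 0 - u 0)" using \<Gamma>(3) by simp
      then show "\<Gamma> (u 0) \<otimes>\<^bsub>G\<^esub> g (?T x 0) = \<Gamma> (x 0)" using \<Gamma>(2)[of "u 0" "x 0 - u 0"] by simp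
    qed
    moreover have "u \<in> ?V'" using u \<delta>(1) by (auto simp: Rn_iff)
    ultimately show "\<exists>V. u \<in> V \<and> V \<subseteq> Rn 1 \<and> smooth_plot M 1 V (\<lambda>x. \<Gamma> (x 0))"
      by (intro exI[of _ ?V']) auto
  qed
  then have op: "one_param_subgroup G M \<Gamma>"
    unfolding one_param_subgroup_def smooth_map_real using \<Gamma>(2) by blast
  have "curve_D M g 0 Z"
    using log[of 0] \<epsilon> g by (simp add: log_deriv_def)
  moreover have "\<forall>\<^sub>F s in nhds 0. g s = \<Gamma> s"
    using eventually_nhds_in_open[of "{-\<delta><..<\<delta>}" 0] \<delta>(1) \<Gamma>(3) by (auto elim!: eventually_mono)
  ultimately have "curve_D M \<Gamma> 0 Z" by (rule curve_D_cong[rotated])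
  from that[OF op curve_D_velocity[OF mfd this]] show thesis .
qed

lemma exp_curve:
  assumes "Z \<in> lie_algebra G M"
  obtains \<gamma> where "one_param_subgroup G M \<gamma>" "curve_D M \<gamma> 0 Z" "\<And>t. lie_exp G M (tscale t Z) = \<gamma> t"
proof -
  obtain \<gamma> where \<gamma>: "one_param_subgroup G M \<gamma>" "velocity M \<gamma> = Z" by (rule one_param_exists[OF assms])
  show thesis
    using that[OF \<gamma>(1)] one_param_facts(4)[OF \<gamma>(1)] lie_exp_one_param[OF \<gamma>(1)] unfolding \<gamma>(2) .
qed

end

section \<open>Generic continuity of sections\<close>

lemma smooth_plot_vimage_open:
  assumes M: "smooth_manifold M" and P: "smooth_plot M n U P" and O': "openin (mtop M) N"
  shows "openin (Euclidean_space n) {u \<in> U. P u \<in> N}"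
  unfolding openin_subopen[of _ "{u \<in> U. P u \<in> N}"]
proof
  fix u assume u: "u \<in> {u \<in> U. P u \<in> N}"
  note cc = smooth_manifoldD(2)[OF M]
  obtain c where c: "c \<in> charts_at M (P u)" using charts_at_ex[OF cc smooth_plotD(2)[OF P, of u]] u by blast
  note cD = charts_atD[OF c]
  note C = chart_coverD[OF cc cD(1)]
  let ?W = "snd c ` (fst c \<inter> N)" and ?V = "{u \<in> U. P u \<in> fst c}"
  have "openin (Euclidean_space n) {v \<in> ?V. snd c (P v) \<in> ?W}" (is "openin _ ?T")
    by (rule euclid_smooth_map_vimage[OF smooth_plot_rep[OF cc P cD(1)] smooth_manifoldD(3)[OF M cD(1) O']])
  moreover have "u \<in> ?T" using u cD(2) by auto
  moreover have "?T \<subseteq> {u \<in> U. P u \<in> N}"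
    using inj_onD[OF C(2)] by auto
  ultimately show "\<exists>T. openin (Euclidean_space n) T \<and> u \<in> T \<and> T \<subseteq> {u \<in> U. P u \<in> N}"
    by (intro exI conjI)
qed

lemma smooth_plot_continuous:
  assumes M: "smooth_manifold M" and P: "smooth_plot M n U P"
  shows "continuous_map (subtopology (Euclidean_space n) U) (mtop M) P"
  unfolding continuous_map_def
proof (intro conjI allI impI)
  note PD = smooth_plotD[OF P]
  have t: "topspace (subtopology (Euclidean_space n) U) = U"
    using openin_subset[OF PD(1)] by auto
  show "P \<in> topspace (subtopology (Euclidean_space n) U) \<rightarrow> mpoints M" unfolding t using PD(2) by blast
  fix N assume "openin (mtop M) N"
  from smooth_plot_vimage_open[OF M P this]
  show "openin (subtopology (Euclidean_space n) U) {x \<in> topspace (subtopology (Euclidean_space n) U). P x \<in> N}"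
    unfolding t openin_open_subtopology[OF PD(1)] by auto
qed

lemma smooth_map_continuous:
  assumes M: "chart_cover M" and N: "smooth_manifold N" and F: "smooth_map M N F"
  shows "continuous_map (mtop M) (mtop N) F"
  unfolding continuous_map_def
proof (intro conjI allI impI)
  have chart: "\<exists>c\<in>matlas M. x \<in> fst c \<and> F x = F (param c (snd c x)) \<and>
      smooth_plot N (mdim M) (snd c ` fst c) (\<lambda>y. F (param c y))" if x: "x \<in> mpoints M" for x
  proof -
    obtain c where c: "c \<in> charts_at M x" using charts_at_ex[OF M x] by blast
    have "smooth_plot N (mdim M) (snd c ` fst c) (\<lambda>y. F (param c y))"
      using F charts_atD(1)[OF c] unfolding smooth_map_def by blast
    moreover have "F x = F (param c (snd c x))"
      by (simp add: chart_coverD(7)[OF M charts_atD(1)[OF c] charts_atD(2)[OF c]])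
    ultimately show ?thesis using charts_atD[OF c] by (intro bexI[of _ c] conjI)
  qed
  show "F \<in> mpoints M \<rightarrow> mpoints N"
  proof
    fix x assume "x \<in> mpoints M"
    from chart[OF this] obtain c where c: "x \<in> fst c" "F x = F (param c (snd c x))"
      "smooth_plot N (mdim M) (snd c ` fst c) (\<lambda>y. F (param c y))" by blast
    show "F x \<in> mpoints N" unfolding c(2) by (rule smooth_plotD(2)[OF c(3)]) (use c(1) in simp)
  qed
  fix V assume V: "openin (mtop N) V"
  show "openin (mtop M) {x \<in> mpoints M. F x \<in> V}"
    unfolding openin_subopen[of _ "{x \<in> mpoints M. F x \<in> V}"]
  proof
    fix x assume x: "x \<in> {x \<in> mpoints M. F x \<in> V}"
    then obtain c where cm: "c \<in> matlas M" and c: "x \<in> fst c"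
      and P: "smooth_plot N (mdim M) (snd c ` fst c) (\<lambda>y. F (param c y))" using chart by blast
    note C = chart_coverD[OF M cm]
    let ?W = "{y \<in> snd c ` fst c. F (param c y) \<in> V}" let ?T = "{x \<in> fst c. snd c x \<in> ?W}"
    have "openin (mtop M) ?T"
      by (rule chart_vimage_open[OF M cm smooth_plot_vimage_open[OF N P V]])
    moreover have "x \<in> ?T" using x c C(7) by simp
    moreover have "?T \<subseteq> {x \<in> mpoints M. F x \<in> V}"
    proof
      fix z assume "z \<in> ?T"
      then have "z \<in> fst c" "F (param c (snd c z)) \<in> V" by simp_all
      then show "z \<in> {x \<in> mpoints M. F x \<in> V}" using C(7)[of z] C(9)[of z] by simp
    qed
    ultimately show "\<exists>T. openin (mtop M) T \<and> x \<in> T \<and> T \<subseteq> {x \<in> mpoints M. F x \<in> V}"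
      by (intro exI conjI)
  qed
qed

text \<open>The family consists of the compact ones among the closures of the members of a countable
  base. A closed box in a chart, inside the given neighbourhood, is compact and hence closed in a
  Hausdorff space, so a small base member has its closure inside the box.\<close>

lemma manifold_compact_family:
  assumes M: "smooth_manifold M"
  obtains \<K> where "countable \<K>" "\<And>K. K \<in> \<K> \<Longrightarrow> compactin (mtop M) K"
    "\<And>x N. openin (mtop M) N \<Longrightarrow> x \<in> N \<Longrightarrow> \<exists>K\<in>\<K>. x \<in> K \<and> K \<subseteq> N"
proof -
  note cc = smooth_manifoldD(2)[OF M]
  have "\<exists>\<B>. countable \<B> \<and> (\<forall>B\<in>\<B>. openin (mtop M) B) \<and>
          (\<forall>U x. openin (mtop M) U \<and> x \<in> U \<longrightarrow> (\<exists>B\<in>\<B>. x \<in> B \<and> B \<subseteq> U))"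
    using M unfolding smooth_manifold_def by (elim conjE)
  then obtain \<B> where \<B>: "countable \<B>" "\<And>B. B \<in> \<B> \<Longrightarrow> openin (mtop M) B"
    "\<And>U x. openin (mtop M) U \<Longrightarrow> x \<in> U \<Longrightarrow> \<exists>B\<in>\<B>. x \<in> B \<and> B \<subseteq> U"
    by metis
  define \<K> where "\<K> = (\<lambda>B. mtop M closure_of B) ` {B \<in> \<B>. compactin (mtop M) (mtop M closure_of B)}"
  show thesis
  proof (rule that)
    show "countable \<K>" unfolding \<K>_def using \<B>(1) by (intro countable_image) auto
    show "compactin (mtop M) K" if "K \<in> \<K>" for K using that unfolding \<K>_def by auto
    fix x N assume N: "openin (mtop M) N" and x: "x \<in> N"
    have "x \<in> mpoints M" using openin_subset[OF N] x by auto
    then obtain c where c: "c \<in> charts_at M x" using charts_at_ex[OF cc] by blast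
    note cD = charts_atD[OF c]
    note C = chart_coverD[OF cc cD(1)]
    let ?W = "snd c ` (fst c \<inter> N)"
    have W: "openin (Euclidean_space (mdim M)) ?W" by (rule smooth_manifoldD(3)[OF M cD(1) N])
    have xW: "snd c x \<in> ?W" using x cD(2) by auto
    obtain \<delta> where \<delta>: "\<delta> > 0"
      "\<And>y. y \<in> Rn (mdim M) \<Longrightarrow> (\<And>i. i < mdim M \<Longrightarrow> \<bar>y i - snd c x i\<bar> < \<delta>) \<Longrightarrow> y \<in> ?W"
      using openin_Rn_box[OF W xW] by blast
    \<comment> \<open>Half the radius leaves room for a closed box inside \<open>?W\<close>; the
      open box R is the neighbourhood of x into which a base member has to fit.\<close>
    define Q where "Q = {y \<in> Rn (mdim M). \<forall>i<mdim M. \<bar>y i - snd c x i\<bar> \<le> \<delta> / 2}"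
    define R where "R = {y \<in> Rn (mdim M). \<forall>i<mdim M. \<bar>y i - snd c x i\<bar> < \<delta> / 2}"
    have QW: "Q \<subseteq> ?W"
    proof
      fix y assume "y \<in> Q"
      then have "y \<in> Rn (mdim M)" "\<And>i. i < mdim M \<Longrightarrow> \<bar>y i - snd c x i\<bar> \<le> \<delta> / 2" by (auto simp: Q_def)
      then show "y \<in> ?W" using \<delta>(1) by (intro \<delta>(2)) force+
    qed
    have "compact Q" unfolding Q_def by (rule compact_Rn_box)
    moreover have "Q \<subseteq> Rn (mdim M)" by (auto simp: Q_def)
    ultimately have "compactin (Euclidean_space (mdim M)) Q"
      unfolding Euclidean_space_eu compactin_subtopology by (auto simp: Rn_iff)
    then have "compactin (subtopology (Euclidean_space (mdim M)) (snd c ` fst c)) Q"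
      unfolding compactin_subtopology using QW by auto
    from image_compactin[OF this smooth_plot_continuous[OF M smooth_plot_param[OF M cD(1)]]]
    have K0: "compactin (mtop M) (param c ` Q)" .
    have K0N: "param c ` Q \<subseteq> N"
    proof
      fix z assume "z \<in> param c ` Q"
      then obtain y where "y \<in> Q" "z = param c y" by blast
      then obtain w where "w \<in> fst c" "w \<in> N" "z = param c (snd c w)" using QW by blast
      then show "z \<in> N" using C(7) by simp
    qed
    have xR: "snd c x \<in> Rn (mdim M)" by (rule C(10)[OF cD(2)])
    have "openin (mtop M) {z \<in> fst c. snd c z \<in> R}"
      unfolding R_def by (rule chart_vimage_open[OF cc cD(1) open_Rn_box[OF xR]])
    moreover have "x \<in> {z \<in> fst c. snd c z \<in> R}" using cD(2) xR \<delta>(1) by (simp add: R_def)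
    ultimately obtain B where B: "B \<in> \<B>" "x \<in> B" "B \<subseteq> {z \<in> fst c. snd c z \<in> R}"
      using \<B>(3) by blast
    have "B \<subseteq> param c ` Q"
    proof
      fix z assume "z \<in> B"
      then have z: "z \<in> fst c" "snd c z \<in> R" using B(3) by auto
      have "z = param c (snd c z)" using C(7)[OF z(1)] by simp
      moreover have "snd c z \<in> Q" using z(2) by (auto simp: Q_def R_def)
      ultimately show "z \<in> param c ` Q" by (rule image_eqI)
    qed
    then have cl: "mtop M closure_of B \<subseteq> param c ` Q"
      by (rule closure_of_minimal) (rule compactin_imp_closedin[OF smooth_manifoldD(1)[OF M] K0])
    then have "compactin (mtop M) (mtop M closure_of B)"
      by (intro closed_compactin[OF K0] closedin_closure_of)
    then have "mtop M closure_of B \<in> \<K>" unfolding \<K>_def using B(1) by blast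
    moreover have "x \<in> mtop M closure_of B"
      using closure_of_subset[OF openin_subset[OF \<B>(2)[OF B(1)]]] B(2) by blast
    ultimately show "\<exists>K\<in>\<K>. x \<in> K \<and> K \<subseteq> N" using cl K0N by blast
  qed
qed

text \<open>The tube lemma: projection along a compact factor is a closed map.\<close>

lemma closedin_projection:
  assumes S: "closedin (prod_topology T Y) S" and K: "compactin Y K"
  shows "closedin T {u \<in> topspace T. \<exists>g\<in>K. (u, g) \<in> S}"
proof -
  have "compact_space (subtopology Y K)" by (rule compact_space_subtopology[OF K])
  then have "closed_map (prod_topology T (subtopology Y K)) T fst"
    by (rule Abstract_Topological_Spaces.closed_map_fst)
  moreover have "closedin (prod_topology T (subtopology Y K)) (S \<inter> (topspace T \<times> K))"
  proof -
    have "prod_topology T (subtopology Y K) = subtopology (prod_topology T Y) (topspace T \<times> K)"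
      using prod_topology_subtopology(2)[of T Y K] by simp
    then show ?thesis using S by (simp add: closedin_subtopology) blast
  qed
  ultimately have "closedin T (fst ` (S \<inter> (topspace T \<times> K)))" by (simp add: closed_map_def)
  moreover have "fst ` (S \<inter> (topspace T \<times> K)) = {u \<in> topspace T. \<exists>g\<in>K. (u, g) \<in> S}" by force
  ultimately show ?thesis by simp
qed

text \<open>
  The projections of \<open>S \<inter> (T \<times> K)\<close> are closed and cover \<open>T\<close>, so by Baire's theorem a generic \<open>u\<close> is
  interior to each projection that contains it. Nothing is required of the fibres near \<open>u\<close>: that
  \<open>g0\<close> is the only solution in \<open>K\<close> over \<open>u\<close> itself keeps nearby solutions close to \<open>g0\<close>.
\<close>

lemma generic_continuous_section:
  assumes T: "completely_metrizable_space T" and Y: "Hausdorff_space Y"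
    and \<K>: "countable \<K>" "\<And>K. K \<in> \<K> \<Longrightarrow> compactin Y K"
    and S: "closedin (prod_topology T Y) S"
    and iso: "\<And>u. u \<in> topspace T \<Longrightarrow> \<exists>K\<in>\<K>. \<exists>g0\<in>K. (u, g0) \<in> S \<and> (\<forall>g\<in>K. (u, g) \<in> S \<longrightarrow> g = g0)"
    and V: "openin T V" "V \<noteq> {}"
  obtains u g0 where "u \<in> V" "(u, g0) \<in> S"
    "\<And>N. openin Y N \<Longrightarrow> g0 \<in> N \<Longrightarrow> \<exists>W. openin T W \<and> u \<in> W \<and> (\<forall>u'\<in>W. \<exists>g\<in>N. (u', g) \<in> S)"
proof -
  define A where "A K = {u \<in> topspace T. \<exists>g\<in>K. (u, g) \<in> S}" for K
  \<comment> \<open>What the closed set \<open>A K\<close> has beyond its interior: closed with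
    empty interior, so countably many such sets cannot cover V.\<close>
  define B where "B K = A K - T interior_of (A K)" for K
  have clA: "closedin T (A K)" if "compactin Y K" for K
    unfolding A_def by (rule closedin_projection[OF S that])
  have "T interior_of \<Union>(B ` \<K>) = {}"
  proof (rule Baire_category_alt)
    show "completely_metrizable_space T \<or> locally_compact_space T \<and> regular_space T" using T ..
    show "countable (B ` \<K>)" using \<K>(1) by (rule countable_image)
    fix Z assume "Z \<in> B ` \<K>"
    then obtain K where K: "K \<in> \<K>" "Z = B K" by blast
    have "closedin T (B K)" unfolding B_def by (intro closedin_diff clA \<K>(2) K(1)) simp
    moreover have "T interior_of (B K) = {}"
    proof -
      have "T interior_of (B K) \<subseteq> B K" by (rule interior_of_subset)
      moreover have "T interior_of (B K) \<subseteq> T interior_of (A K)"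
        by (rule interior_of_mono) (auto simp: B_def)
      ultimately show ?thesis by (auto simp: B_def)
    qed
    ultimately show "closedin T Z \<and> T interior_of Z = {}" using K(2) by simp
  qed
  then have "\<not> V \<subseteq> \<Union>(B ` \<K>)" using V interior_of_maximal[of V "\<Union>(B ` \<K>)" T] by auto
  then obtain u where u: "u \<in> V" "\<And>K. K \<in> \<K> \<Longrightarrow> u \<notin> B K" by blast
  have uT: "u \<in> topspace T" using V(1) u(1) openin_subset by blast
  obtain K g0 where K: "K \<in> \<K>" "g0 \<in> K" "(u, g0) \<in> S" and uniq: "\<And>g. g \<in> K \<Longrightarrow> (u, g) \<in> S \<Longrightarrow> g = g0"
    using iso[OF uT] by blast
  have uA: "u \<in> T interior_of (A K)" using u(2)[OF K(1)] uT K by (auto simp: B_def A_def)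
  show thesis
  proof (rule that[OF u(1) K(3)])
    fix N assume N: "openin Y N" "g0 \<in> N"
    have KN: "compactin Y ((topspace Y - N) \<inter> K)"
      by (rule closed_Int_compactin[OF _ \<K>(2)[OF K(1)]]) (use N in auto)
    \<comment> \<open>Over \<open>?W\<close> a solution in K still exists, and it lies in N: the
      points with a solution in K outside N form a closed set, which misses u because g0 is the only
      solution in K over u.\<close>
    let ?W = "T interior_of (A K) - A ((topspace Y - N) \<inter> K)"
    have "openin T ?W" by (intro openin_diff clA[OF KN]) simp
    moreover have "u \<in> ?W" using uA uniq N(2) by (auto simp: A_def)
    moreover have "\<exists>g\<in>N. (u', g) \<in> S" if u': "u' \<in> ?W" for u'
    proof -
      have "u' \<in> A K" using u' interior_of_subset[of T "A K"] by auto
      then obtain g where g: "g \<in> K" "(u', g) \<in> S" "u' \<in> topspace T" by (auto simp: A_def)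
      have "g \<in> topspace Y" using compactin_subset_topspace[OF \<K>(2)[OF K(1)]] g(1) by auto
      then have "g \<in> N" using u' g by (auto simp: A_def)
      then show ?thesis using g(2) by blast
    qed
    ultimately show "\<exists>W. openin T W \<and> u \<in> W \<and> (\<forall>u'\<in>W. \<exists>g\<in>N. (u', g) \<in> S)"
      by (intro exI[of _ ?W] conjI ballI)
  qed
qed

section \<open>Infinitesimal action\<close>

text \<open>
  Replaces the implicit function theorem: it yields isolated stabilizers, and difference quotients
  of a section that is only known to be continuous at one point.
\<close>

lemma limit_direction:
  assumes W: "openin (Euclidean_space N) W" and H: "\<And>i. smooth_fun N W (H i)" and w0: "w0 \<in> W"
    and H0: "\<And>i. H i w0 = 0"
    and acc: "\<And>\<delta>. \<delta> > 0 \<Longrightarrow> \<exists>w\<in>Rn N. w \<noteq> w0 \<and> (\<forall>j<N. \<bar>w j - w0 j\<bar> < \<delta>) \<and> (\<forall>i. H i w = 0)"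
  obtains \<xi> where "\<xi> \<in> Rn N" "\<xi> \<noteq> (\<lambda>i. 0)" "\<And>i. dderiv (H i) w0 \<xi> = 0"
proof -
  have w0R: "w0 \<in> Rn N" by (rule openin_Rn_subset[OF W w0])
  have "\<forall>k. \<exists>w\<in>Rn N. w \<noteq> w0 \<and> (\<forall>j<N. \<bar>w j - w0 j\<bar> < inverse (real (Suc k))) \<and> (\<forall>i. H i w = 0)"
    by (intro allI acc) simp
  then obtain w where w: "\<And>k. w k \<in> Rn N" "\<And>k. w k \<noteq> w0"
    "\<And>k j. j < N \<Longrightarrow> \<bar>w k j - w0 j\<bar> < inverse (real (Suc k))" "\<And>k i. H i (w k) = 0"
    by metis
  define r where "r k = (\<Sum>j<N. \<bar>w k j - w0 j\<bar>)" for k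
  have r: "r k > 0" for k
  proof -
    have "\<exists>j<N. w k j \<noteq> w0 j"
    proof (rule ccontr)
      assume "\<not> (\<exists>j<N. w k j \<noteq> w0 j)"
      then have "w k j = w0 j" for j using w(1)[of k] w0R by (cases "j < N") (auto simp: Rn_iff)
      then show False using w(2)[of k] by auto
    qed
    then show ?thesis unfolding r_def by (auto intro!: sum_pos2)
  qed
  \<comment> \<open>The normalized differences lie in a compact cube and have absolute coordinate
    sum 1. A limit keeps this sum and is therefore nonzero.\<close>
  define x where "x k = (\<lambda>j. (w k j - w0 j) / r k)" for k
  have xR: "x k \<in> Rn N" for k using w(1)[of k] w0R by (simp add: x_def Rn_iff)
  have xsum: "(\<Sum>j<N. \<bar>x k j\<bar>) = 1" for k
    using r[of k] by (simp add: x_def r_def abs_divide sum_divide_distrib[symmetric])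
  define B where "B = {y \<in> Rn N. \<forall>j<N. \<bar>y j - 0\<bar> \<le> 1}"
  have xB: "x k \<in> B" for k
  proof -
    have "\<bar>x k j\<bar> \<le> 1" if "j < N" for j
      using member_le_sum[of j "{..<N}" "\<lambda>j. \<bar>x k j\<bar>"] xsum[of k] that by simp
    then show ?thesis using xR[of k] by (simp add: B_def)
  qed
  have "seq_compact B" unfolding B_def
    by (rule compact_imp_seq_compact) (rule compact_Rn_box[of N "\<lambda>i. 0"])
  then obtain \<xi> \<phi> where \<xi>: "\<xi> \<in> B" and \<phi>: "strict_mono \<phi>" and lim: "(x \<circ> \<phi>) \<longlonglongrightarrow> \<xi>"
    using xB unfolding seq_compact_def by metis
  have limj: "(\<lambda>k. x (\<phi> k) j) \<longlonglongrightarrow> \<xi> j" for j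
  proof -
    have "isCont (\<lambda>y::vec. y j) \<xi>"
      using continuous_on_coord[of UNIV j] unfolding continuous_on_eq_continuous_at[OF open_UNIV] by blast
    from isCont_tendsto_compose[OF this lim] show ?thesis by (simp add: comp_def)
  qed
  have "(\<lambda>k. \<Sum>j<N. \<bar>x (\<phi> k) j\<bar>) \<longlonglongrightarrow> (\<Sum>j<N. \<bar>\<xi> j\<bar>)" by (intro tendsto_intros limj)
  then have \<xi>1: "(\<Sum>j<N. \<bar>\<xi> j\<bar>) = 1" by (simp add: xsum LIMSEQ_const_iff)
  have D: "dderiv (H i) w0 \<xi> = 0" for i
  proof -
    let ?p = "\<lambda>j. dderiv (H i) w0 (basis_vec j)"
    \<comment> \<open>H vanishes both at w k and at w0, so the linear part of the increment is of
      smaller order than r k.\<close>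
    have "(\<lambda>k. \<Sum>j<N. ?p j * x k j) \<longlonglongrightarrow> 0"
    proof (rule LIMSEQ_I)
      fix \<epsilon> :: real assume "\<epsilon> > 0"
      then have e2: "\<epsilon> / 2 > 0" by simp
      obtain \<delta> where \<delta>: "\<delta> > 0" "\<And>y. y \<in> Rn N \<Longrightarrow> (\<And>j. j < N \<Longrightarrow> \<bar>y j - w0 j\<bar> < \<delta>) \<Longrightarrow>
         y \<in> W \<and> \<bar>H i y - H i w0 - (\<Sum>j<N. ?p j * (y j - w0 j))\<bar> \<le> \<epsilon> / 2 * (\<Sum>j<N. \<bar>y j - w0 j\<bar>)"
        using Ck1_total_derivative[OF W smooth_fun_Ck[OF H[of i], of "Suc 0"] w0 e2] by blast
      obtain n0 where n0: "inverse (real (Suc n0)) < \<delta>" using reals_Archimedean[OF \<delta>(1)] by blast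
      show "\<exists>no. \<forall>k\<ge>no. norm ((\<Sum>j<N. ?p j * x k j) - 0) < \<epsilon>"
      proof (intro exI[of _ n0] allI impI)
        fix k assume k: "k \<ge> n0"
        have "inverse (real (Suc k)) \<le> inverse (real (Suc n0))" using k by (simp add: le_imp_inverse_le)
        then have "\<bar>w k j - w0 j\<bar> < \<delta>" if "j < N" for j using w(3)[OF that, of k] n0 by linarith
        from \<delta>(2)[OF w(1)[of k] this]
        have "\<bar>\<Sum>j<N. ?p j * (w k j - w0 j)\<bar> \<le> \<epsilon> / 2 * r k" by (simp add: w(4) H0 r_def)
        moreover have "(\<Sum>j<N. ?p j * x k j) = (\<Sum>j<N. ?p j * (w k j - w0 j)) / r k"
          by (simp add: x_def sum_divide_distrib)
        ultimately have "\<bar>\<Sum>j<N. ?p j * x k j\<bar> \<le> \<epsilon> / 2"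
          using r[of k] by (simp add: abs_divide pos_divide_le_eq)
        then show "norm ((\<Sum>j<N. ?p j * x k j) - 0) < \<epsilon>" using \<open>\<epsilon> > 0\<close> by simp
      qed
    qed
    from LIMSEQ_subseq_LIMSEQ[OF this \<phi>] have 1: "(\<lambda>k. \<Sum>j<N. ?p j * x (\<phi> k) j) \<longlonglongrightarrow> 0" by (simp add: comp_def)
    have 2: "(\<lambda>k. \<Sum>j<N. ?p j * x (\<phi> k) j) \<longlonglongrightarrow> (\<Sum>j<N. ?p j * \<xi> j)" by (intro tendsto_intros limj)
    have "\<xi> \<in> Rn N" using \<xi> by (simp add: B_def)
    from Ck1_dderiv(2)[OF W smooth_fun_Ck[OF H] w0 this] LIMSEQ_unique[OF 1 2] show ?thesis by simp
  qed
  show thesis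
  proof (rule that[OF _ _ D])
    show "\<xi> \<in> Rn N" using \<xi> by (simp add: B_def)
    show "\<xi> \<noteq> (\<lambda>i. 0)" using \<xi>1 by auto
  qed
qed

lemma smooth_mapI:
  assumes "smooth_manifold M" "\<And>n U P. smooth_plot M n U P \<Longrightarrow> smooth_plot N n U (\<lambda>u. F (P u))"
  shows "smooth_map M N F"
  unfolding smooth_map_def using assms(2)[OF smooth_plot_param[OF assms(1)]] by blast

lemma plot_deriv_zero: "plot_deriv M P u (\<lambda>i. 0) = tzero"
  by (auto simp: plot_deriv_def tzero_def vderiv_def dderiv_def fun_eq_iff)

locale smooth_group_action = smooth_group G M for G :: "'g monoid" and M :: "'g mfd" +
  fixes X :: "'x mfd" and a :: "'g \<Rightarrow> 'x \<Rightarrow> 'x"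
  assumes X: "smooth_manifold X" and act: "smooth_action G M X a"
begin

lemmas ccX = smooth_manifoldD(2)[OF X]

sublocale group_action G "mpoints X" a
  using act by (simp add: smooth_action_def)

lemma act_plot:
  assumes "smooth_plot M n U g" "smooth_plot X n U P"
  shows "smooth_plot X n U (\<lambda>u. a (g u) (P u))"
  using smooth_plot_map2[OF cc ccX _ assms, of X "\<lambda>p. a (fst p) (snd p)"] act
  by (simp add: smooth_action_def)

lemma act_closed: "g \<in> carrier G \<Longrightarrow> x \<in> mpoints X \<Longrightarrow> a g x \<in> mpoints X"
  by (rule element_image[where g=g]) auto

lemma act_one: "x \<in> mpoints X \<Longrightarrow> a \<one>\<^bsub>G\<^esub> x = x"
  using id_eq_one by (metis restrict_apply')

lemma act_mult: "x \<in> mpoints X \<Longrightarrow> g \<in> carrier G \<Longrightarrow> h \<in> carrier G \<Longrightarrow> a (g \<otimes>\<^bsub>G\<^esub> h) x = a g (a h x)"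
  by (rule composition_rule)

lemma act_const_plot: "smooth_plot X n U P \<Longrightarrow> g \<in> carrier G \<Longrightarrow> smooth_plot X n U (\<lambda>u. a g (P u))"
  by (intro act_plot plot_const smooth_plotD(1))

lemma orbit_plot: "x \<in> mpoints X \<Longrightarrow> smooth_plot X d O1 (\<lambda>z. a (p z) x)"
  by (intro act_plot p_plot smooth_plot_const[OF X C1(3)])

lemma inf_gen_curve:
  assumes Z: "Z \<in> lie_algebra G M" and x: "x \<in> mpoints X"
    and \<gamma>: "one_param_subgroup G M \<gamma>" "curve_D M \<gamma> 0 Z"
  shows "curve_D X (\<lambda>s. a (\<gamma> s) x) 0 (plot_deriv X (\<lambda>z. a (p z) x) e (Z c1))"
proof -
  have 0: "\<gamma> 0 = \<one>\<^bsub>G\<^esub>" by (rule one_param_facts(2)[OF \<gamma>(1)])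
  have "c1 \<in> charts_at M (\<gamma> 0)" unfolding 0 by (rule c1_at)
  from curve_D_map[where F="\<lambda>g. a g x", OF mfd X \<gamma>(2) this orbit_plot[OF x]] show ?thesis
    unfolding 0 .
qed

text \<open>Trades \<open>lie_exp\<close> for the derivative of the orbit map at e, which is linear
  in Z and accessible to the calculus of plots.\<close>

lemma inf_gen_eq:
  assumes Z: "Z \<in> lie_algebra G M" and x: "x \<in> mpoints X"
  shows "inf_gen G M X a Z x = plot_deriv X (\<lambda>z. a (p z) x) e (Z c1)"
proof -
  obtain \<gamma> where \<gamma>: "one_param_subgroup G M \<gamma>" "curve_D M \<gamma> 0 Z" "\<And>t. lie_exp G M (tscale t Z) = \<gamma> t"
    by (rule exp_curve[OF Z]) (rule that, assumption+)
  show ?thesis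
    unfolding inf_gen_def \<gamma>(3) by (rule curve_D_velocity[OF X inf_gen_curve[OF Z x \<gamma>(1,2)]])
qed

lemma lie_vector:
  assumes "\<zeta> \<in> Rn d"
  shows "plot_deriv M p e \<zeta> \<in> lie_algebra G M" "plot_deriv M p e \<zeta> c1 = \<zeta>"
  unfolding lie_algebra_def by (rule param_deriv_at[OF mfd c1_at assms])+

text \<open>If the generator of Z vanishes at x, the homomorphism property propagates this: the
  curve obtained by letting \<gamma> t act on x has zero velocity at every time. It is constant, so
  Z lies in \<open>stabilizer_algebra\<close>, which is zero.\<close>

lemma orbit_deriv_inj:
  assumes x: "x \<in> mpoints X" and free: "stabilizer_algebra G M a x = {tzero}"
    and \<zeta>: "\<zeta> \<in> Rn d" and 0: "plot_deriv X (\<lambda>z. a (p z) x) e \<zeta> = tzero"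
  shows "\<zeta> = (\<lambda>i. 0)"
proof -
  define Z where "Z = plot_deriv M p e \<zeta>"
  have Z: "Z \<in> lie_algebra G M" "Z c1 = \<zeta>" unfolding Z_def by (rule lie_vector[OF \<zeta>])+
  obtain \<gamma> where \<gamma>: "one_param_subgroup G M \<gamma>" "curve_D M \<gamma> 0 Z" "\<And>t. lie_exp G M (tscale t Z) = \<gamma> t"
    by (rule exp_curve[OF Z(1)]) (rule that, assumption+)
  have hom: "\<gamma> (s + t) = \<gamma> s \<otimes>\<^bsub>G\<^esub> \<gamma> t" for s t using \<gamma>(1) unfolding one_param_subgroup_def by blast
  note f = one_param_facts[OF \<gamma>(1)]
  have D0: "curve_D X (\<lambda>s. a (\<gamma> s) x) 0 tzero"
    using inf_gen_curve[OF Z(1) x \<gamma>(1,2)] unfolding Z(2) 0 .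
  have stab: "a (\<gamma> t) x = x" for t
  proof -
    have "a (\<gamma> t) x = a (\<gamma> 0) x"
    proof (rule curve_D_zero_const[OF X open_UNIV connected_UNIV, of "\<lambda>s. a (\<gamma> s) x"])
      fix t
      obtain c where c: "c \<in> charts_at X (a (\<gamma> 0) x)"
        using charts_at_ex[OF ccX act_closed[OF f(1) x]] by blast
      have "curve_D X (\<lambda>s. a (\<gamma> t) (a (\<gamma> s) x)) 0 (plot_deriv X (\<lambda>y. a (\<gamma> t) (param c y)) (snd c (a (\<gamma> 0) x)) (tzero c))"
        by (rule curve_D_map[where F="a (\<gamma> t)", OF X X D0 c])
          (intro act_const_plot smooth_plot_param[OF X charts_atD(1)[OF c]] f(1))
      moreover have "tzero c = (\<lambda>i. 0)" by (simp add: tzero_def)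
      ultimately have "curve_D X (\<lambda>s. a (\<gamma> (t + s)) x) 0 tzero"
        by (simp add: plot_deriv_zero hom act_mult[OF x f(1) f(1)])
      then show "curve_D X (\<lambda>s. a (\<gamma> s) x) t tzero" by (rule curve_D_shift)
    qed simp_all
    then show ?thesis using f(2) act_one[OF x] by simp
  qed
  have "Z \<in> stabilizer_algebra G M a x"
    unfolding stabilizer_algebra_def stabilizer_def using Z(1) \<gamma>(3) stab f(1) by simp
  then have "Z = tzero" using free by simp
  then show ?thesis using Z(2) by (simp add: tzero_def)
qed

end

section \<open>Isolated stabilizers and the comparison of two plots\<close>

lemma dderiv_add:
  assumes "openin (Euclidean_space n) U" "smooth_fun n U f" "smooth_fun n U g" "x \<in> U" "v \<in> Rn n"
  shows "dderiv (\<lambda>y. f y + s * g y) x v = dderiv f x v + s * dderiv g x v"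
proof -
  have "((\<lambda>t. f (\<lambda>i. x i + t * v i) + s * g (\<lambda>i. x i + t * v i)) has_real_derivative
      dderiv f x v + s * dderiv g x v) (at 0)"
    by (intro DERIV_add DERIV_cmult smooth_fun_line_DERIV[OF assms(1,2,4,5)] smooth_fun_line_DERIV[OF assms(1,3,4,5)])
  from DERIV_imp_deriv[OF this] show ?thesis by (simp add: dderiv_def)
qed

text \<open>The zero vector arises as the velocity of a constant plot with 0-dimensional
  domain.\<close>

lemma tzero_tangent: "smooth_manifold M \<Longrightarrow> x \<in> mpoints M \<Longrightarrow> tzero \<in> tangent_space M x"
proof -
  assume M: "smooth_manifold M" and x: "x \<in> mpoints M"
  have "smooth_plot M 0 (Rn 0) (\<lambda>u. x)" by (rule smooth_plot_const[OF M _ x]) simp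
  from plot_deriv_tangent[OF M this, of "\<lambda>i. 0" "\<lambda>i. 0"] show ?thesis
    by (simp add: plot_deriv_zero Rn_iff)
qed

context smooth_group_action
begin

text \<open>A box around the identity in the chart \<open>c1\<close>; its coordinates are the
  unknowns that enter \<open>limit_direction\<close>.\<close>

definition unit_nbhd :: "real \<Rightarrow> 'g set" where
  "unit_nbhd \<delta> = {k \<in> fst c1. snd c1 k \<in> {y \<in> Rn d. \<forall>j<d. \<bar>y j - e j\<bar> < \<delta>}}"

lemma unit_nbhd_open: "openin (mtop M) (unit_nbhd \<delta>)"
  unfolding unit_nbhd_def
  by (rule chart_vimage_open[OF cc c1D(1) open_Rn_box[OF C1(10)[OF c1D(2)]]])

lemma one_unit_nbhd: "\<delta> > 0 \<Longrightarrow> \<one>\<^bsub>G\<^esub> \<in> unit_nbhd \<delta>"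
  using c1D(2) C1(10)[OF c1D(2)] by (simp add: unit_nbhd_def)

lemma unit_nbhdD:
  assumes "k \<in> unit_nbhd \<delta>"
  shows "snd c1 k \<in> O1" "p (snd c1 k) = k" "j < d \<Longrightarrow> \<bar>snd c1 k j - e j\<bar> < \<delta>" "k \<in> carrier G"
  using assms C1(7,8,9) unfolding unit_nbhd_def carrier_eq by auto

text \<open>Right translates, because in g = k g0 the small factor k acts after g0 has carried P u
  to Q u.\<close>

lemma translated_nbhd:
  assumes g0: "g0 \<in> carrier G" and \<delta>: "\<delta> > 0"
  shows "openin (mtop M) {g \<in> mpoints M. g \<otimes>\<^bsub>G\<^esub> inv\<^bsub>G\<^esub> g0 \<in> unit_nbhd \<delta>}" (is "openin _ ?N")
    and "g0 \<in> {g \<in> mpoints M. g \<otimes>\<^bsub>G\<^esub> inv\<^bsub>G\<^esub> g0 \<in> unit_nbhd \<delta>}"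
proof -
  have "smooth_map M M (\<lambda>g. g \<otimes>\<^bsub>G\<^esub> inv\<^bsub>G\<^esub> g0)"
    by (rule smooth_mapI[OF mfd]) (intro plot_mult plot_const inv_closed g0 smooth_plotD(1))
  from openin_continuous_map_preimage[OF smooth_map_continuous[OF cc mfd this] unit_nbhd_open]
  show "openin (mtop M) ?N" .
  show "g0 \<in> ?N" using g0 one_unit_nbhd[OF \<delta>] by (simp add: carrier_eq[symmetric])
qed

text \<open>Stabilizer elements accumulating at the identity would have a limit direction in the
  kernel of the derivative of the orbit map, which is trivial by
  \<open>orbit_deriv_inj\<close>.\<close>

lemma stabilizer_isolated:
  assumes x: "x \<in> mpoints X" and free: "stabilizer_algebra G M a x = {tzero}"
  obtains \<delta> where "\<delta> > 0" "\<And>k. k \<in> unit_nbhd \<delta> \<Longrightarrow> a k x = x \<Longrightarrow> k = \<one>\<^bsub>G\<^esub>"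
proof (rule ccontr)
  note conc = that
  assume no: "\<not> thesis"
  have ex: "\<exists>k\<in>unit_nbhd \<delta>. a k x = x \<and> k \<noteq> \<one>\<^bsub>G\<^esub>" if "\<delta> > 0" for \<delta>
    using conc[OF that] no by blast
  obtain cx where cx: "cx \<in> charts_at X x" using charts_at_ex[OF ccX x] by blast
  note cxD = charts_atD[OF cx]
  let ?O = "\<lambda>z. a (p z) x"
  note orb = orbit_plot[OF x]
  let ?W = "{z \<in> O1. ?O z \<in> fst cx}"
  note W = smooth_plotD(3)[OF orb cxD(1)]
  have Oe: "?O e = x" using p_e act_one[OF x] by simp
  have eW: "e \<in> ?W" using e_O1 cxD(2) unfolding mem_Collect_eq Oe by blast
  have sm: "smooth_fun d ?W (\<lambda>z. snd cx (?O z) i)" for i by (rule smooth_plotD(4)[OF orb cxD(1)])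
  define H where "H i z = snd cx (?O z) i + (-1) * snd cx x i" for i z
  have H_sm: "smooth_fun d ?W (H i)" for i
    unfolding H_def by (intro smooth_fun_add smooth_fun_mult smooth_fun_const sm W)
  have H0: "H i e = 0" for i unfolding H_def Oe by simp
  have acc: "\<exists>w\<in>Rn d. w \<noteq> e \<and> (\<forall>j<d. \<bar>w j - e j\<bar> < \<delta>) \<and> (\<forall>i. H i w = 0)" if \<delta>: "\<delta> > 0" for \<delta>
  proof -
    obtain k where k: "k \<in> unit_nbhd \<delta>" "a k x = x" "k \<noteq> \<one>\<^bsub>G\<^esub>" using ex[OF \<delta>] by blast
    note kD = unit_nbhdD[OF k(1)]
    have "snd c1 k \<noteq> e" using k(3) kD(2) p_e by metis
    then show ?thesis
      using openin_Rn_subset[OF C1(3) kD(1)] kD(2,3) k(2)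
      by (intro bexI[of _ "snd c1 k"] conjI) (auto simp: H_def)
  qed
  obtain \<xi> where \<xi>: "\<xi> \<in> Rn d" "\<xi> \<noteq> (\<lambda>i. 0)" "\<And>i. dderiv (H i) e \<xi> = 0"
    by (rule limit_direction[where H=H, OF W H_sm eW H0 acc]) (assumption, rule that, assumption+)
  have "dderiv (\<lambda>z. snd cx (?O z) i) e \<xi> = 0" for i
    using dderiv_add[OF W sm[of i] smooth_fun_const[OF W, of "snd cx x i"] eW \<xi>(1), of "-1"] \<xi>(3)[of i]
    by (simp add: H_def dderiv_def)
  then have "plot_deriv X ?O e \<xi> cx = tzero cx"
    using cx by (simp add: plot_deriv_def Oe vderiv_def tzero_def)
  then have "plot_deriv X ?O e \<xi> = tzero"
    using tangent_eqI[OF ccX _ tzero_tangent[OF X x] cx] plot_deriv_tangent[OF X orb e_O1 \<xi>(1)] Oe by simp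
  from orbit_deriv_inj[OF x free \<xi>(1) this] \<xi>(2) show False by simp
qed

text \<open>
  Solutions \<open>(z, t)\<close> of \<open>p z \<cdot> P1 (u + t v) = Q (u + t v)\<close> with \<open>t \<noteq> 0\<close> accumulate at \<open>(e, 0)\<close>. A limit
  direction \<open>(\<zeta>, \<tau>)\<close> has \<open>\<tau> \<noteq> 0\<close>, because the derivative of the orbit map is injective.
\<close>

lemma tangent_decomposition:
  assumes P: "smooth_plot X n U P" and Q: "smooth_plot X n U Q" and u: "u \<in> U"
    and g0: "g0 \<in> carrier G" "a g0 (P u) = Q u"
    and free: "stabilizer_algebra G M a (Q u) = {tzero}"
    and sect: "\<And>N. openin (mtop M) N \<Longrightarrow> g0 \<in> N \<Longrightarrow>
      \<exists>W. openin (Euclidean_space n) W \<and> u \<in> W \<and> W \<subseteq> U \<and> (\<forall>u'\<in>W. \<exists>g\<in>N. a g (P u') = Q u')"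
    and v: "v \<in> Rn n"
  obtains Z where "Z \<in> lie_algebra G M"
    "plot_deriv X Q u v = tadd (plot_deriv X (\<lambda>y. a g0 (P y)) u v) (inf_gen G M X a Z (Q u))"
proof -
  define x where "x = Q u"
  have x: "x \<in> mpoints X" unfolding x_def by (rule smooth_plotD(2)[OF Q u])
  define P1 where "P1 y = a g0 (P y)" for y
  have P1: "smooth_plot X n U P1" unfolding P1_def by (rule act_const_plot[OF P g0(1)])
  have P1u: "P1 u = x" using g0(2) by (simp add: P1_def x_def)
  obtain cx where cx: "cx \<in> charts_at X x" using charts_at_ex[OF ccX x] by blast
  note cxD = charts_atD[OF cx]
  have R1: "openin (Euclidean_space 1) (Rn 1)" by simp
  have U: "openin (Euclidean_space n) U" by (rule smooth_plotD(1)[OF P])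
  have uR: "u \<in> Rn n" by (rule openin_Rn_subset[OF U u])
  \<comment> \<open>The line through u in direction v, with its parameter in \<open>Rn 1\<close> so
    that plots can be composed with it.\<close>
  define l where "l s = (\<lambda>i. u i + s 0 * v i)" for s :: vec
  have l0: "euclid_smooth_map 1 (Rn 1) n (Rn n) l"
    unfolding euclid_smooth_map_def l_def using uR v
    by (auto simp: Rn_iff intro!: smooth_fun_add smooth_fun_mult smooth_fun_const smooth_fun_coord)
  define U1 where "U1 = {s \<in> Rn 1. l s \<in> U}"
  have U1: "openin (Euclidean_space 1) U1" unfolding U1_def by (rule euclid_smooth_map_vimage[OF l0 U])
  have l: "euclid_smooth_map 1 U1 n U l"
    by (rule euclid_smooth_map_restrict[OF l0 U1 _ U]) (auto simp: U1_def)
  let ?o = "\<lambda>i::nat. 0::real"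
  have lo: "l ?o = u" by (simp add: l_def)
  have oU1: "?o \<in> U1" using u lo by (simp add: U1_def Rn_iff)
  have b0: "basis_vec 0 \<in> Rn 1" by (rule basis_vec_Rn) simp
  have vl: "vderiv l s \<sigma> = (\<lambda>i. \<sigma> 0 * v i)" for s \<sigma>
  proof
    fix i
    have "((\<lambda>t. u i + (s 0 + t * \<sigma> 0) * v i) has_real_derivative \<sigma> 0 * v i) (at 0)"
      by (auto intro!: derivative_eq_intros)
    then show "vderiv l s \<sigma> i = \<sigma> 0 * v i" unfolding vderiv_def dderiv_def l_def by (rule DERIV_imp_deriv)
  qed
  let ?B = "vec_times d 1 O1 U1"
  have B: "openin (Euclidean_space (d + 1)) ?B" by (rule vec_times_open[OF C1(3) U1])
  note pr = vec_times_proj[OF C1(3) U1]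
  \<comment> \<open>The unknown w is a pair (z, s). \<open>A\<close> lets the group element
    \<open>p z\<close> act on the translated plot and \<open>D\<close> is the target, so A w = D w
    is the equation to be linearized at \<open>w0\<close>.\<close>
  define A where "A w = a (p (vec_take d w)) (P1 (l (vec_drop d w)))" for w
  define D where "D w = Q (l (vec_drop d w))" for w
  have A: "smooth_plot X (d + 1) ?B A"
    unfolding A_def
    by (rule act_plot[OF smooth_plot_compose[OF p_plot pr(1)]
          smooth_plot_compose[OF smooth_plot_compose[OF P1 l] pr(2)]])
  have D: "smooth_plot X (d + 1) ?B D"
    unfolding D_def by (rule smooth_plot_compose[OF smooth_plot_compose[OF Q l] pr(2)])
  define w0 where "w0 = vec_append d e ?o"
  have eR: "e \<in> Rn d" by (rule openin_Rn_subset[OF C1(3) e_O1])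
  have w0: "w0 \<in> ?B" unfolding w0_def by (rule vec_append_times[OF C1(3) U1 e_O1 oU1])
  have prw: "vec_take d w0 = e" "vec_drop d w0 = ?o" unfolding w0_def by (rule vec_take_append[OF eR]) (rule vec_drop_append)
  have Aw: "A w0 = x" using P1u lo p_e act_one[OF x] by (simp add: A_def prw)
  have Dw: "D w0 = x" using lo by (simp add: D_def prw x_def)
  let ?W = "{w \<in> ?B. A w \<in> fst cx} \<inter> {w \<in> ?B. D w \<in> fst cx}"
  have W: "openin (Euclidean_space (d + 1)) ?W"
    by (intro openin_Int smooth_plotD(3)[OF A cxD(1)] smooth_plotD(3)[OF D cxD(1)])
  have w0W: "w0 \<in> ?W" using w0 Aw Dw cxD(2) by simp
  have smA: "smooth_fun (d + 1) ?W (\<lambda>w. snd cx (A w) i)" and smD: "smooth_fun (d + 1) ?W (\<lambda>w. snd cx (D w) i)" for i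
    by (rule smooth_fun_subset[OF smooth_plotD(4)[OF A cxD(1)]], blast)
      (rule smooth_fun_subset[OF smooth_plotD(4)[OF D cxD(1)]], blast)
  define H where "H i w = snd cx (A w) i + (-1) * snd cx (D w) i" for i w
  have H_sm: "smooth_fun (d + 1) ?W (H i)" for i
    unfolding H_def by (intro smooth_fun_add smooth_fun_mult smooth_fun_const smA smD W)
  have H0: "H i w0 = 0" for i by (simp add: H_def Aw Dw)
  have acc: "\<exists>w\<in>Rn (d + 1). w \<noteq> w0 \<and> (\<forall>j<d + 1. \<bar>w j - w0 j\<bar> < \<delta>) \<and> (\<forall>i. H i w = 0)" if \<delta>: "\<delta> > 0" for \<delta>
  proof -
    note N = translated_nbhd[OF g0(1) \<delta>]
    obtain W' where W': "openin (Euclidean_space n) W'" "u \<in> W'" "W' \<subseteq> U"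
      "\<And>u'. u' \<in> W' \<Longrightarrow> \<exists>g\<in>{g \<in> mpoints M. g \<otimes>\<^bsub>G\<^esub> inv\<^bsub>G\<^esub> g0 \<in> unit_nbhd \<delta>}. a g (P u') = Q u'"
      using sect[OF N] by blast
    have "\<forall>\<^sub>F t in at 0. (\<lambda>i. u i + t * v i) \<in> W'"
      using openin_Rn_line[OF W'(1,2) v] by (simp add: eventually_nhds_conv_at)
    then obtain \<eta> where \<eta>: "\<eta> > 0" "\<And>t. t \<noteq> 0 \<Longrightarrow> \<bar>t\<bar> < \<eta> \<Longrightarrow> (\<lambda>i. u i + t * v i) \<in> W'"
      unfolding eventually_at by (auto simp: dist_real_def)
    \<comment> \<open>That t is nonzero already makes the new solution differ from
      \<open>w0\<close>, even if the group element k is the identity.\<close>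
    define t where "t = min \<eta> \<delta> / 2"
    have t: "t \<noteq> 0" "\<bar>t\<bar> < \<eta>" "\<bar>t\<bar> < \<delta>" using \<eta>(1) \<delta> by (auto simp: t_def min_def)
    define s where "s = (\<lambda>i::nat. if i = 0 then t else 0)"
    have sR: "s \<in> Rn 1" by (simp add: s_def Rn_iff)
    have ls: "l s \<in> W'" using \<eta>(2)[OF t(1,2)] by (simp add: l_def s_def)
    then obtain g where g: "g \<in> carrier G" "g \<otimes>\<^bsub>G\<^esub> inv\<^bsub>G\<^esub> g0 \<in> unit_nbhd \<delta>" "a g (P (l s)) = Q (l s)"
      using W'(4)[OF ls] by (auto simp: carrier_eq)
    define k where "k = g \<otimes>\<^bsub>G\<^esub> inv\<^bsub>G\<^esub> g0"
    note kD = unit_nbhdD[OF g(2), folded k_def]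
    have Pl: "P (l s) \<in> mpoints X" by (rule smooth_plotD(2)[OF P]) (use ls W'(3) in blast)
    have "a k (P1 (l s)) = a (k \<otimes>\<^bsub>G\<^esub> g0) (P (l s))"
      unfolding P1_def by (rule act_mult[OF Pl kD(4) g0(1), symmetric])
    also have "k \<otimes>\<^bsub>G\<^esub> g0 = g" using g(1) g0(1) by (simp add: k_def m_assoc)
    finally have ak: "a k (P1 (l s)) = Q (l s)" using g(3) by simp
    define w where "w = vec_append d (snd c1 k) s"
    have prw': "vec_take d w = snd c1 k" "vec_drop d w = s"
      unfolding w_def by (rule vec_take_append[OF openin_Rn_subset[OF C1(3) kD(1)]]) (rule vec_drop_append)
    have "A w = D w" using ak kD(2) by (simp add: A_def D_def prw')
    then have "H i w = 0" for i by (simp add: H_def)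
    moreover have "w \<noteq> w0"
    proof
      assume "w = w0"
      then have "s = ?o" using prw'(2) prw(2) by simp
      from fun_cong[OF this, of 0] show False using t(1) by (simp add: s_def)
    qed
    moreover have "\<bar>w j - w0 j\<bar> < \<delta>" if "j < d + 1" for j
      using that kD(3)[of j] t(3) \<delta> by (auto simp: w_def w0_def vec_append_def s_def)
    moreover have "w \<in> Rn (d + 1)" unfolding w_def by (rule vec_append_Rn[OF sR])
    ultimately show ?thesis by (intro bexI[of _ w] conjI allI impI)
  qed
  obtain \<xi> where \<xi>: "\<xi> \<in> Rn (d + 1)" "\<xi> \<noteq> ?o" "\<And>i. dderiv (H i) w0 \<xi> = 0"
    by (rule limit_direction[where H=H, OF W H_sm w0W H0 acc]) (assumption, rule that, assumption+)
  have "dderiv (\<lambda>w. snd cx (A w) i) w0 \<xi> = dderiv (\<lambda>w. snd cx (D w) i) w0 \<xi>" for i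
    using dderiv_add[OF W smA smD w0W \<xi>(1), of i "-1" i] \<xi>(3)[of i] unfolding H_def by simp
  then have "plot_deriv X A w0 \<xi> cx = plot_deriv X D w0 \<xi> cx"
    by (simp add: plot_deriv_def Aw Dw vderiv_def)
  moreover have "plot_deriv X A w0 \<xi> \<in> tangent_space X x" "plot_deriv X D w0 \<xi> \<in> tangent_space X x"
    using plot_deriv_tangent[OF X A w0 \<xi>(1)] plot_deriv_tangent[OF X D w0 \<xi>(1)] by (simp_all add: Aw Dw)
  ultimately have AD: "plot_deriv X A w0 \<xi> = plot_deriv X D w0 \<xi>"
    using tangent_eqI[OF ccX _ _ cx] by blast
  define \<zeta> \<tau> where "\<zeta> = vec_take d \<xi>" and "\<tau> = \<xi> d"
  have \<zeta>: "\<zeta> \<in> Rn d" by (simp add: \<zeta>_def vec_take_def Rn_iff)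
  let ?j1 = "vec_append d \<zeta> ?o" and ?j2 = "vec_append d ?o (basis_vec 0)"
  have j1: "?j1 \<in> Rn (d + 1)" and j2: "?j2 \<in> Rn (d + 1)" by (rule vec_append_Rn, simp add: Rn_iff) (rule vec_append_Rn[OF b0])
  \<comment> \<open>The limit direction splits into the group part (\<zeta>, 0) and \<tau> times the
    line direction (0, 1). Along these \<open>A\<close> has derivatives \<open>L \<zeta>\<close> and
    that of \<open>P1\<close> in direction v.\<close>
  have \<xi>_eq: "\<xi> = (\<lambda>j. 1 * ?j1 j + \<tau> * ?j2 j)"
  proof
    fix j
    show "\<xi> j = 1 * ?j1 j + \<tau> * ?j2 j"
      using \<xi>(1) by (auto simp: vec_append_def \<zeta>_def \<tau>_def vec_take_def basis_vec_def Rn_iff)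
  qed
  define L where "L \<zeta> = plot_deriv X (\<lambda>z. a (p z) x) e \<zeta>" for \<zeta>
  have A1: "plot_deriv X A w0 ?j1 = L \<zeta>"
  proof -
    have emb: "euclid_smooth_map d O1 (d + 1) ?B (\<lambda>z. vec_append d z ?o)"
      by (rule vec_append_smooth[OF id_smooth[OF C1(3)] const_smooth[OF C1(3) U1 oU1]])
    have "plot_deriv X (\<lambda>z. A (vec_append d z ?o)) e \<zeta> = plot_deriv X A w0 (vderiv (\<lambda>z. vec_append d z ?o) e \<zeta>)"
      unfolding w0_def by (rule plot_deriv_compose[OF ccX A emb e_O1 \<zeta>])
    also have "vderiv (\<lambda>z. vec_append d z ?o) e \<zeta> = ?j1" by (simp add: vderiv_append vderiv_id vderiv_const)
    finally have "plot_deriv X A w0 ?j1 = plot_deriv X (\<lambda>z. A (vec_append d z ?o)) e \<zeta>" ..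
    also have "\<dots> = L \<zeta>" unfolding L_def
    proof (rule plot_deriv_cong[OF C1(3) e_O1 \<zeta>])
      fix z assume "z \<in> O1"
      then have "vec_take d (vec_append d z ?o) = z" by (rule vec_take_append[OF openin_Rn_subset[OF C1(3)]])
      then show "A (vec_append d z ?o) = a (p z) x" by (simp add: A_def vec_drop_append lo P1u)
    qed
    finally show ?thesis .
  qed
  have A2: "plot_deriv X A w0 ?j2 = plot_deriv X P1 u v"
  proof -
    have emb: "euclid_smooth_map 1 U1 (d + 1) ?B (\<lambda>s. vec_append d e s)"
      by (rule vec_append_smooth[OF const_smooth[OF U1 C1(3) e_O1] id_smooth[OF U1]])
    have "plot_deriv X (\<lambda>s. A (vec_append d e s)) ?o (basis_vec 0) = plot_deriv X A w0 (vderiv (\<lambda>s. vec_append d e s) ?o (basis_vec 0))"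
      unfolding w0_def by (rule plot_deriv_compose[OF ccX A emb oU1 b0])
    also have "vderiv (\<lambda>s. vec_append d e s) ?o (basis_vec 0) = ?j2" by (simp add: vderiv_append vderiv_id vderiv_const)
    finally have "plot_deriv X A w0 ?j2 = plot_deriv X (\<lambda>s. A (vec_append d e s)) ?o (basis_vec 0)" ..
    also have "\<dots> = plot_deriv X (\<lambda>s. P1 (l s)) ?o (basis_vec 0)"
    proof (rule plot_deriv_cong[OF U1 oU1 b0])
      fix s assume "s \<in> U1"
      then have "P1 (l s) \<in> mpoints X" by (intro smooth_plotD(2)[OF P1]) (simp add: U1_def)
      then show "A (vec_append d e s) = P1 (l s)" using act_one by (simp add: A_def vec_take_append[OF eR] vec_drop_append p_e)
    qed
    also have "\<dots> = plot_deriv X P1 (l ?o) (vderiv l ?o (basis_vec 0))"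
      by (rule plot_deriv_compose[OF ccX P1 l oU1 b0])
    also have "\<dots> = plot_deriv X P1 u v" by (simp add: lo vl basis_vec_def)
    finally show ?thesis .
  qed
  have D1: "plot_deriv X D w0 \<xi> = tscale \<tau> (plot_deriv X Q u v)"
  proof -
    have "plot_deriv X D w0 \<xi> = plot_deriv X Q (l (vec_drop d w0)) (vderiv (\<lambda>w. l (vec_drop d w)) w0 \<xi>)"
      unfolding D_def by (rule plot_deriv_compose[OF ccX Q euclid_smooth_map_compose[OF pr(2) l] w0 \<xi>(1)])
    also have "vderiv (\<lambda>w. l (vec_drop d w)) w0 \<xi> = vderiv l (vec_drop d w0) (vderiv (vec_drop d) w0 \<xi>)"
      by (rule vderiv_chain[OF pr(2) l w0 \<xi>(1)])
    also have "vderiv (vec_drop d) w0 \<xi> = vec_drop d \<xi>"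
      using vderiv_id[of w0 \<xi>] by (simp add: vderiv_def vec_drop_def fun_eq_iff)
    also have "vderiv l (vec_drop d w0) (vec_drop d \<xi>) = (\<lambda>i. \<tau> * v i + 0 * v i)" unfolding vl by (simp add: vec_drop_def \<tau>_def)
    also have "plot_deriv X Q (l (vec_drop d w0)) \<dots> = tadd (tscale \<tau> (plot_deriv X Q u v)) (tscale 0 (plot_deriv X Q u v))"
      unfolding prw lo by (rule plot_deriv_linear[OF ccX Q u v v])
    finally show ?thesis by (simp add: tadd_def tscale_def)
  qed
  have "plot_deriv X A w0 \<xi> = tadd (tscale 1 (L \<zeta>)) (tscale \<tau> (plot_deriv X P1 u v))"
    unfolding \<xi>_eq plot_deriv_linear[OF ccX A w0 j1 j2] A1 A2 ..
  then have sum_eq: "tadd (tscale 1 (L \<zeta>)) (tscale \<tau> (plot_deriv X P1 u v)) = tscale \<tau> (plot_deriv X Q u v)"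
    using AD D1 by simp
  have main: "L \<zeta> c i + \<tau> * plot_deriv X P1 u v c i = \<tau> * plot_deriv X Q u v c i" for c i
    using fun_cong[OF fun_cong[OF sum_eq, of c], of i] by (simp add: tadd_def tscale_def)
  have \<tau>: "\<tau> \<noteq> 0"
  proof
    assume "\<tau> = 0"
    then have "L \<zeta> = tzero" using main by (auto simp: tzero_def fun_eq_iff)
    then have "\<zeta> = ?o" unfolding L_def using orbit_deriv_inj[OF x free[folded x_def] \<zeta>] by simp
    with \<open>\<tau> = 0\<close> have "\<xi> = ?o" using \<xi>_eq by (auto simp: vec_append_def fun_eq_iff)
    then show False using \<xi>(2) by simp
  qed
  \<comment> \<open>Division by \<tau> solves for the derivative of Q; the summand with factor 0
    fits the shape of \<open>plot_deriv_linear\<close>.\<close>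
  define \<kappa> where "\<kappa> = (\<lambda>j. (1 / \<tau>) * \<zeta> j + 0 * \<zeta> j)"
  have \<kappa>: "\<kappa> \<in> Rn d" using \<zeta> by (simp add: \<kappa>_def Rn_iff)
  have L\<kappa>: "L \<kappa> = tadd (tscale (1 / \<tau>) (L \<zeta>)) (tscale 0 (L \<zeta>))"
    unfolding L_def \<kappa>_def by (rule plot_deriv_linear[OF ccX orbit_plot[OF x] e_O1 \<zeta> \<zeta>])
  define Z where "Z = plot_deriv M p e \<kappa>"
  have Z: "Z \<in> lie_algebra G M" "Z c1 = \<kappa>" unfolding Z_def by (rule lie_vector[OF \<kappa>])+
  have "plot_deriv X Q u v = tadd (plot_deriv X P1 u v) (L \<kappa>)"
  proof (intro ext)
    fix c i
    have "L \<zeta> c i / \<tau> = plot_deriv X Q u v c i - plot_deriv X P1 u v c i"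
      using main[of c i] \<tau> by (simp add: field_simps)
    then show "plot_deriv X Q u v c i = tadd (plot_deriv X P1 u v) (L \<kappa>) c i"
      by (simp add: tadd_def L\<kappa> tscale_def)
  qed
  also have "L \<kappa> = inf_gen G M X a Z x" unfolding inf_gen_eq[OF Z(1) x] Z(2) L_def ..
  finally show thesis
    unfolding x_def P1_def using that[OF Z(1)] by blast
qed

end

section \<open>Reduction\<close>

context smooth_group_action
begin

lemma act_smooth_map: "g \<in> carrier G \<Longrightarrow> smooth_map X X (a g)"
  by (rule smooth_mapI[OF X]) (rule act_const_plot)

text \<open>The set where two continuous maps into the Hausdorff space X agree. Closedness is what
  the compact projections in Baire's argument require.\<close>

lemma section_closed:
  assumes P: "smooth_plot X n U P" and Q: "smooth_plot X n U Q"
  shows "closedin (prod_topology (subtopology (Euclidean_space n) U) (mtop M))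
    {w \<in> U \<times> carrier G. a (snd w) (P (fst w)) = Q (fst w)}"
proof -
  let ?T = "subtopology (Euclidean_space n) U"
  have t: "topspace (prod_topology ?T (mtop M)) = U \<times> carrier G"
    using openin_subset[OF smooth_plotD(1)[OF P]] by (auto simp: carrier_eq)
  have "continuous_map (mtop (prod_mfd M X)) (mtop X) (\<lambda>p. a (fst p) (snd p))"
    by (rule smooth_map_continuous[OF chart_cover_prod[OF cc ccX] X]) (use act in \<open>simp add: smooth_action_def\<close>)
  then have ca: "continuous_map (prod_topology (mtop M) (mtop X)) (mtop X) (\<lambda>p. a (fst p) (snd p))"
    by (simp add: prod_mfd_def)
  have cf: "continuous_map (prod_topology ?T (mtop M)) (mtop X) (\<lambda>w. R (fst w))" if "smooth_plot X n U R" for R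
    using continuous_map_compose[OF continuous_map_fst smooth_plot_continuous[OF X that]] by (simp add: comp_def)
  have "continuous_map (prod_topology ?T (mtop M)) (prod_topology (mtop M) (mtop X)) (\<lambda>w. (snd w, P (fst w)))"
    by (intro continuous_map_pairedI continuous_map_snd cf P)
  from continuous_map_compose[OF this ca]
  have "continuous_map (prod_topology ?T (mtop M)) (mtop X) (\<lambda>w. a (snd w) (P (fst w)))"
    by (simp add: comp_def)
  from closedin_continuous_maps_eq[OF smooth_manifoldD(1)[OF X] this cf[OF Q]]
  show ?thesis unfolding t .
qed

text \<open>Applies \<open>generic_continuous_section\<close> to the set of all solutions g over U.
  Since V is arbitrary, the good points are dense in U.\<close>

lemma generic_section:
  assumes P: "smooth_plot X n U P" and Q: "smooth_plot X n U Q"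
    and orb: "\<And>u. u \<in> U \<Longrightarrow> \<exists>g\<in>carrier G. a g (P u) = Q u"
    and free: "\<And>u. u \<in> U \<Longrightarrow> stabilizer_algebra G M a (Q u) = {tzero}"
    and V: "openin (Euclidean_space n) V" "V \<subseteq> U" "V \<noteq> {}"
  obtains u g0 where "u \<in> V" "g0 \<in> carrier G" "a g0 (P u) = Q u"
    "\<And>N. openin (mtop M) N \<Longrightarrow> g0 \<in> N \<Longrightarrow>
      \<exists>W. openin (Euclidean_space n) W \<and> u \<in> W \<and> W \<subseteq> U \<and> (\<forall>u'\<in>W. \<exists>g\<in>N. a g (P u') = Q u')"
proof -
  let ?T = "subtopology (Euclidean_space n) U"
  let ?S = "{w \<in> U \<times> carrier G. a (snd w) (P (fst w)) = Q (fst w)}"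
  have U: "openin (Euclidean_space n) U" by (rule smooth_plotD(1)[OF P])
  have t: "topspace ?T = U" using openin_subset[OF U] by auto
  obtain \<K> where \<K>: "countable \<K>" "\<And>K. K \<in> \<K> \<Longrightarrow> compactin (mtop M) K"
    "\<And>x N. openin (mtop M) N \<Longrightarrow> x \<in> N \<Longrightarrow> \<exists>K\<in>\<K>. x \<in> K \<and> K \<subseteq> N"
    by (rule manifold_compact_family[OF mfd]) (rule that, assumption+)
  have iso: "\<exists>K\<in>\<K>. \<exists>g0\<in>K. (u, g0) \<in> ?S \<and> (\<forall>g\<in>K. (u, g) \<in> ?S \<longrightarrow> g = g0)" if "u \<in> topspace ?T" for u
  proof -
    have u: "u \<in> U" using that t by simp
    obtain g0 where g0: "g0 \<in> carrier G" "a g0 (P u) = Q u" using orb[OF u] by blast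
    have Pu: "P u \<in> mpoints X" and Qu: "Q u \<in> mpoints X" using smooth_plotD(2) P Q u by blast+
    obtain \<delta> where \<delta>: "\<delta> > 0" "\<And>k. k \<in> unit_nbhd \<delta> \<Longrightarrow> a k (Q u) = Q u \<Longrightarrow> k = \<one>\<^bsub>G\<^esub>"
      by (rule stabilizer_isolated[OF Qu free[OF u]]) (rule that, assumption+)
    obtain K where K: "K \<in> \<K>" "g0 \<in> K" "K \<subseteq> {g \<in> mpoints M. g \<otimes>\<^bsub>G\<^esub> inv\<^bsub>G\<^esub> g0 \<in> unit_nbhd \<delta>}"
      using \<K>(3)[OF translated_nbhd[OF g0(1) \<delta>(1)]] by blast
    have uniq: "g = g0" if g: "g \<in> K" "(u, g) \<in> ?S" for g
    proof -
      have gc: "g \<in> carrier G" and gP: "a g (P u) = Q u" using g(2) by auto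
      have kn: "g \<otimes>\<^bsub>G\<^esub> inv\<^bsub>G\<^esub> g0 \<in> unit_nbhd \<delta>" using K(3) g(1) by blast
      \<comment> \<open>Two solutions over u differ by an element of the stabilizer of Q u, which is
        trivial when both lie in the small set K.\<close>
      have "a (g \<otimes>\<^bsub>G\<^esub> inv\<^bsub>G\<^esub> g0) (a g0 (P u)) = a (g \<otimes>\<^bsub>G\<^esub> inv\<^bsub>G\<^esub> g0 \<otimes>\<^bsub>G\<^esub> g0) (P u)"
        by (rule act_mult[OF Pu unit_nbhdD(4)[OF kn] g0(1), symmetric])
      also have "g \<otimes>\<^bsub>G\<^esub> inv\<^bsub>G\<^esub> g0 \<otimes>\<^bsub>G\<^esub> g0 = g" using gc g0(1) by (simp add: m_assoc)
      finally have "g \<otimes>\<^bsub>G\<^esub> inv\<^bsub>G\<^esub> g0 = \<one>\<^bsub>G\<^esub>" by (intro \<delta>(2) kn) (simp add: g0(2) gP)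
      then show ?thesis using gc g0(1) by (metis inv_closed inv_equality inv_inv)
    qed
    have mem: "(u, g0) \<in> ?S" using g0 u by simp
    show ?thesis
    proof (intro bexI conjI ballI impI)
      show "g = g0" if "g \<in> K" "(u, g) \<in> ?S" for g using that by (rule uniq)
    qed (rule mem K(1,2))+
  qed
  have VT: "openin ?T V" using V(1,2) openin_open_subtopology[OF U] by blast
  obtain u g0 where u: "u \<in> V" and g0: "(u, g0) \<in> ?S"
    and sect: "\<And>N. openin (mtop M) N \<Longrightarrow> g0 \<in> N \<Longrightarrow> \<exists>W. openin ?T W \<and> u \<in> W \<and> (\<forall>u'\<in>W. \<exists>g\<in>N. (u', g) \<in> ?S)"
    by (rule generic_continuous_section[OF completely_metrizable_space_openin[OF completely_metrizable_Euclidean_space U]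
          smooth_manifoldD(1)[OF mfd] \<K>(1,2) section_closed[OF P Q] iso VT V(3)])
      (assumption, assumption, rule that, assumption+)
  show thesis
  proof (rule that[OF u])
    show "g0 \<in> carrier G" "a g0 (P u) = Q u" using g0 by auto
    fix N assume N: "openin (mtop M) N" "g0 \<in> N"
    obtain W where W: "openin ?T W" "u \<in> W" "\<And>u'. u' \<in> W \<Longrightarrow> \<exists>g\<in>N. (u', g) \<in> ?S" using sect[OF N] by blast
    have "openin (Euclidean_space n) W" "W \<subseteq> U" using W(1) openin_open_subtopology[OF U] by blast+
    moreover have "\<forall>u'\<in>W. \<exists>g\<in>N. a g (P u') = Q u'" using W(3) by fastforce
    ultimately show "\<exists>W. openin (Euclidean_space n) W \<and> u \<in> W \<and> W \<subseteq> U \<and> (\<forall>u'\<in>W. \<exists>g\<in>N. a g (P u') = Q u')"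
      using W(2) by blast
  qed
qed

text \<open>The two coefficients on vs are continuous in u, so they differ on an open set. If it
  were nonempty it would contain a good point, where \<open>local\<close> forces equality.\<close>

lemma pullback_eq_by_density:
  assumes \<omega>: "mform X k \<omega>" and P: "smooth_plot X n U P" and Q: "smooth_plot X n U Q"
    and orb: "\<And>u. u \<in> U \<Longrightarrow> \<exists>g\<in>carrier G. a g (P u) = Q u"
    and free: "\<And>u. u \<in> U \<Longrightarrow> stabilizer_algebra G M a (Q u) = {tzero}"
    and vs: "vs \<in> vecs n k"
    and local: "\<And>u g. u \<in> U \<Longrightarrow> g \<in> carrier G \<Longrightarrow> a g (P u) = Q u \<Longrightarrow>
      (\<And>v. v \<in> Rn n \<Longrightarrow> \<exists>Z\<in>lie_algebra G M.
        plot_deriv X Q u v = tadd (plot_deriv X (\<lambda>y. a g (P y)) u v) (inf_gen G M X a Z (Q u))) \<Longrightarrow>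
      plot_pullback X P \<omega> u vs = plot_pullback X Q \<omega> u vs"
    and u0: "u0 \<in> U"
  shows "plot_pullback X P \<omega> u0 vs = plot_pullback X Q \<omega> u0 vs"
proof (rule ccontr)
  assume neq: "plot_pullback X P \<omega> u0 vs \<noteq> plot_pullback X Q \<omega> u0 vs"
  have U: "openin (Euclidean_space n) U" by (rule smooth_plotD(1)[OF P])
  define f where "f u = plot_pullback X P \<omega> u vs + (-1) * plot_pullback X Q \<omega> u vs" for u
  have "smooth_fun n U f"
    unfolding f_def
    by (intro smooth_fun_add smooth_fun_mult smooth_fun_const U euclid_formD(2)[OF plot_pullback_form[OF X \<omega> P] vs]
        euclid_formD(2)[OF plot_pullback_form[OF X \<omega> Q] vs])
  then have "openin (top_of_set U) (U \<inter> f -` (- {0}))"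
    by (intro continuous_openin_preimage_gen smooth_fun_continuous[of n]) auto
  then have V: "openin (Euclidean_space n) (U \<inter> f -` (- {0}))" by (rule openin_Rn_trans[OF U])
  have ne: "U \<inter> f -` (- {0}) \<noteq> {}" using u0 neq by (auto simp: f_def)
  obtain u g where u: "u \<in> U \<inter> f -` (- {0})" and g: "g \<in> carrier G" "a g (P u) = Q u"
    and sect: "\<And>N. openin (mtop M) N \<Longrightarrow> g \<in> N \<Longrightarrow>
      \<exists>W. openin (Euclidean_space n) W \<and> u \<in> W \<and> W \<subseteq> U \<and> (\<forall>u'\<in>W. \<exists>g\<in>N. a g (P u') = Q u')"
    by (rule generic_section[OF P Q orb free V Int_lower1 ne]) (assumption, assumption, rule that, assumption+)
  have uU: "u \<in> U" using u by simp
  have "plot_pullback X P \<omega> u vs = plot_pullback X Q \<omega> u vs"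
  proof (rule local[OF uU g])
    fix v assume v: "v \<in> Rn n"
    show "\<exists>Z\<in>lie_algebra G M.
        plot_deriv X Q u v = tadd (plot_deriv X (\<lambda>y. a g (P y)) u v) (inf_gen G M X a Z (Q u))"
      by (rule tangent_decomposition[OF P Q uU g free[OF uU] sect v]) (assumption, assumption, rule bexI, assumption+)
  qed
  then show False using u by (simp add: f_def)
qed

lemma inf_gen_tangent:
  assumes "Z \<in> lie_algebra G M" "x \<in> mpoints X"
  shows "inf_gen G M X a Z x \<in> tangent_space X x"
proof -
  have "Z c1 \<in> Rn d" using tangent_in_Rn[OF _ c1_at] assms(1) by (simp add: lie_algebra_def)
  from plot_deriv_tangent[OF X orbit_plot[OF assms(2)] e_O1 this] show ?thesis
    unfolding inf_gen_eq[OF assms] using p_e act_one[OF assms(2)] by simp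
qed

text \<open>Invariance is stated with \<open>tangent_map\<close>; \<open>tangent_map_plot\<close>
  turns it into a statement about the translated plot.\<close>

lemma pullback_translate:
  assumes inv: "invariant_form G X a k \<omega>" and P: "smooth_plot X n U P" and g: "g \<in> carrier G"
    and u: "u \<in> U" and vs: "vs \<in> vecs n k"
  shows "plot_pullback X (\<lambda>y. a g (P y)) \<omega> u vs = plot_pullback X P \<omega> u vs"
proof -
  let ?vs = "map (plot_deriv X P u) vs"
  have v: "v \<in> Rn n" if "v \<in> set vs" for v using vs that by (auto simp: vecs_def)
  have "map (tangent_map X X (a g) (P u)) ?vs = map (plot_deriv X (\<lambda>y. a g (P y)) u) vs"
    unfolding map_map comp_def
    by (rule map_cong[OF refl]) (rule tangent_map_plot[OF X ccX act_smooth_map[OF g] P u v])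
  moreover have "length ?vs = k" "set ?vs \<subseteq> tangent_space X (P u)"
    using vs plot_deriv_tangent[OF X P u v] by (auto simp: vecs_def)
  then have "\<omega> (a g (P u)) (map (tangent_map X X (a g) (P u)) ?vs) = \<omega> (P u) ?vs"
    using inv g smooth_plotD(2)[OF P u] unfolding invariant_form_def by blast
  ultimately show ?thesis by (simp only: plot_pullback_def)
qed

lemma orbit_eq_ex:
  assumes "orbit G a x = orbit G a y" "y \<in> mpoints X"
  shows "\<exists>g\<in>carrier G. a g x = y"
proof -
  have "y \<in> orbit G a y" unfolding orbit_def using act_one[OF assms(2)] one_closed by force
  then have "y \<in> orbit G a x" unfolding assms(1) .
  then show ?thesis unfolding orbit_def by blast
qed

text \<open>Vanishing of \<Phi> x is known on the Lie algebra only, and \<open>Ad_star\<close>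
  evaluates it at a conjugated vector; this keeps that vector in the Lie algebra.\<close>

lemma Ad_lie_algebra:
  assumes g: "g \<in> carrier G" and Z: "Z \<in> lie_algebra G M"
  shows "Ad G M g Z \<in> lie_algebra G M"
proof -
  let ?C = "\<lambda>y. g \<otimes>\<^bsub>G\<^esub> p y \<otimes>\<^bsub>G\<^esub> inv\<^bsub>G\<^esub> g"
  have "smooth_plot M d O1 ?C" by (intro plot_mult plot_const p_plot inv_closed g C1(3))
  moreover have "Z c1 \<in> Rn d" using tangent_in_Rn[OF _ c1_at] Z by (simp add: lie_algebra_def)
  ultimately have "plot_deriv M ?C e (Z c1) \<in> tangent_space M (?C e)"
    by (rule plot_deriv_tangent[OF mfd _ e_O1])
  moreover have "?C e = \<one>\<^bsub>G\<^esub>" using p_e g by simp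
  ultimately show ?thesis unfolding Ad_def tangent_map_def Let_def lie_algebra_def by simp
qed

text \<open>Leaves only linear algebra at one point to the two reductions: the velocities of Q are
  those of the translated P plus infinitesimal generators.\<close>

lemma reduced_form_criterion:
  assumes \<omega>: "mform X k \<omega>" and free: "locally_free_on G M a C"
    and local: "\<And>n U P Q u g vs. smooth_plot X n U P \<Longrightarrow> P ` U \<subseteq> C \<Longrightarrow> smooth_plot X n U Q \<Longrightarrow> Q ` U \<subseteq> C \<Longrightarrow>
      u \<in> U \<Longrightarrow> g \<in> carrier G \<Longrightarrow> a g (P u) = Q u \<Longrightarrow> vs \<in> vecs n k \<Longrightarrow>
      (\<And>v. v \<in> Rn n \<Longrightarrow> \<exists>Z\<in>lie_algebra G M.
        plot_deriv X Q u v = tadd (plot_deriv X (\<lambda>y. a g (P y)) u v) (inf_gen G M X a Z (Q u))) \<Longrightarrow>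
      plot_pullback X P \<omega> u vs = plot_pullback X Q \<omega> u vs"
  shows "carries_reduced_form G X a C k \<omega>"
proof (rule carries_reduced_formI[OF X \<omega>])
  fix n U P Q u vs
  assume P: "smooth_plot X n U P" "P ` U \<subseteq> C" and Q: "smooth_plot X n U Q" "Q ` U \<subseteq> C"
    and orb: "\<And>u. u \<in> U \<Longrightarrow> orbit G a (P u) = orbit G a (Q u)" and u: "u \<in> U" and vs: "vs \<in> vecs n k"
  show "plot_pullback X P \<omega> u vs = plot_pullback X Q \<omega> u vs"
  proof (rule pullback_eq_by_density[OF \<omega> P(1) Q(1) _ _ vs local[OF P Q _ _ _ vs] u])
    show "\<exists>g\<in>carrier G. a g (P u) = Q u" if "u \<in> U" for u
      by (rule orbit_eq_ex[OF orb[OF that] smooth_plotD(2)[OF Q(1) that]])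
    show "stabilizer_algebra G M a (Q u) = {tzero}" if "u \<in> U" for u
      using free Q(2) that unfolding locally_free_on_def by blast
  qed
qed

end

text \<open>On a velocity of Q, \<theta> takes its value on the translated velocity of P plus a
  value of the moment map, which is 0 on C. Invariance then removes the translation.\<close>

lemma contact_reduction:
  assumes "lie_group G M" and \<theta>: "prequantum_space G M Y b \<theta>"
    and free: "locally_free_on G M b (zero_level G M Y (contact_moment G M Y b \<theta>))"
  shows "carries_reduced_form G Y b (zero_level G M Y (contact_moment G M Y b \<theta>)) 1 \<theta>"
proof -
  have Y: "smooth_manifold Y" and act: "smooth_action G M Y b"
    and form: "mform Y 1 \<theta>" and inv: "invariant_form G Y b 1 \<theta>"
    using \<theta> unfolding prequantum_space_def contact_form_def by blast+
  interpret smooth_group_action G M Y b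
    by (intro smooth_group_action.intro smooth_group.intro smooth_group_action_axioms.intro assms(1) Y act)
  let ?C = "zero_level G M Y (contact_moment G M Y b \<theta>)"
  have C: "x \<in> ?C \<Longrightarrow> Z \<in> lie_algebra G M \<Longrightarrow> \<theta> x [inf_gen G M Y b Z x] = 0" for x Z
    by (simp add: zero_level_def contact_moment_def)
  show ?thesis
  proof (rule reduced_form_criterion[OF form free])
    fix n U P Q u g vs
    assume P: "smooth_plot Y n U P" "P ` U \<subseteq> ?C" and Q: "smooth_plot Y n U Q" "Q ` U \<subseteq> ?C"
      and u: "u \<in> U" and g: "g \<in> carrier G" "b g (P u) = Q u" and vs: "vs \<in> vecs n 1"
      and dec: "\<And>v. v \<in> Rn n \<Longrightarrow> \<exists>Z\<in>lie_algebra G M.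
        plot_deriv Y Q u v = tadd (plot_deriv Y (\<lambda>y. b g (P y)) u v) (inf_gen G M Y b Z (Q u))"
    obtain v where v: "vs = [v]" "v \<in> Rn n"
      using vs by (auto simp: vecs_def length_Suc_conv)
    obtain Z where Z: "Z \<in> lie_algebra G M"
      "plot_deriv Y Q u v = tadd (plot_deriv Y (\<lambda>y. b g (P y)) u v) (inf_gen G M Y b Z (Q u))"
      using dec[OF v(2)] by blast
    have Qu: "Q u \<in> mpoints Y" by (rule smooth_plotD(2)[OF Q(1) u])
    have A: "plot_deriv Y (\<lambda>y. b g (P y)) u v \<in> tangent_space Y (Q u)" (is "?A \<in> _")
      using plot_deriv_tangent[OF Y act_const_plot[OF P(1) g(1)] u v(2)] by (simp add: g(2))
    have "plot_pullback Y Q \<theta> u vs = \<theta> (Q u) [tadd ?A (inf_gen G M Y b Z (Q u))]"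
      by (simp add: plot_pullback_def v(1) Z(2))
    also have "\<dots> = \<theta> (Q u) [?A] + \<theta> (Q u) [inf_gen G M Y b Z (Q u)]"
      using mform_add(1)[OF Y form Qu, of "[?A]" 0 ?A "inf_gen G M Y b Z (Q u)"] A inf_gen_tangent[OF Z(1) Qu] by simp
    also have "\<theta> (Q u) [inf_gen G M Y b Z (Q u)] = 0" by (rule C[OF _ Z(1)]) (use Q(2) u in blast)
    also have "\<theta> (Q u) [?A] = plot_pullback Y (\<lambda>y. b g (P y)) \<theta> u vs"
      by (simp add: plot_pullback_def v(1) g(2))
    also have "\<dots> = plot_pullback Y P \<theta> u vs" by (rule pullback_translate[OF inv P(1) g(1) u vs])
    finally show "plot_pullback Y P \<theta> u vs = plot_pullback Y Q \<theta> u vs" by simp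
  qed
qed

text \<open>Expanding \<omega> on two decomposed velocities, every term with a generator vanishes:
  the moment map identity turns it into a derivative of \<Phi> along a plot on which \<Phi> is
  0.\<close>

lemma hamiltonian_reduction:
  assumes "lie_group G M" and ham: "hamiltonian_space G M X a \<omega> \<Phi>"
    and free: "locally_free_on G M a (zero_level G M X \<Phi>)"
  shows "carries_reduced_form G X a (zero_level G M X \<Phi>) 2 \<omega>"
proof -
  have X: "smooth_manifold X" and act: "smooth_action G M X a"
    and form: "mform X 2 \<omega>" and inv: "invariant_form G X a 2 \<omega>" and mom: "moment_map G M X a \<omega> \<Phi>"
    using ham unfolding hamiltonian_space_def symplectic_form_def by blast+
  interpret smooth_group_action G M X a
    by (intro smooth_group_action.intro smooth_group.intro smooth_group_action_axioms.intro assms(1) X act)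
  let ?C = "zero_level G M X \<Phi>"
  have \<Phi>0: "\<Phi> x Z = 0" if "x \<in> ?C" "Z \<in> lie_algebra G M" for x Z
    using that by (simp add: zero_level_def)
  \<comment> \<open>\<open>horiz\<close> will be applied to the translated plot, which therefore has
    to stay in C; equivariance of \<Phi> provides this.\<close>
  have inv_C: "a g x \<in> ?C" if g: "g \<in> carrier G" and x: "x \<in> ?C" for g x
  proof -
    have xX: "x \<in> mpoints X" using x by (simp add: zero_level_def)
    have "\<Phi> (a g x) Z = 0" if Z: "Z \<in> lie_algebra G M" for Z
    proof -
      have "\<Phi> (a g x) Z = Ad_star G M g (\<Phi> x) Z"
        using mom g xX Z unfolding moment_map_def by blast
      then show ?thesis using \<Phi>0[OF x Ad_lie_algebra[OF inv_closed[OF g] Z]] by (simp add: Ad_star_def)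
    qed
    then show ?thesis using act_closed[OF g xX] by (simp add: zero_level_def)
  qed
  have horiz: "\<omega> (R u) [inf_gen G M X a Z (R u), plot_deriv X R u v] = 0"
    if R: "smooth_plot X n U R" "R ` U \<subseteq> ?C" and u: "u \<in> U" and v: "v \<in> Rn n" and Z: "Z \<in> lie_algebra G M"
    for R n U u v Z
  proof -
    have Ru: "R u \<in> mpoints X" by (rule smooth_plotD(2)[OF R(1) u])
    \<comment> \<open>The chart is \<open>some_chart\<close> because \<open>mext\<close> is computed
      in it.\<close>
    define c where "c = some_chart X (R u)"
    have c: "c \<in> charts_at X (R u)" unfolding c_def by (rule some_chart_at[OF ccX Ru])
    note cD = charts_atD[OF c]
    note C = chart_coverD[OF ccX cD(1)]
    let ?h = "\<lambda>y. \<Phi> (param c y) Z"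
    have "euclid_form (mdim X) 0 (snd c ` fst c) (plot_pullback X (param c) (\<lambda>x _. \<Phi> x Z))"
      using mom Z cD(1) unfolding moment_map_def mform_def by blast
    \<comment> \<open>On the empty list a smooth 0-form is a smooth function.\<close>
    from euclid_formD(2)[OF this, of "[]"] have h: "smooth_fun (mdim X) (snd c ` fst c) ?h"
      by (simp add: vecs_def plot_pullback_def)
    note rep = smooth_plot_rep[OF ccX R(1) cD(1)]
    let ?V = "{u \<in> U. R u \<in> fst c}"
    have uV: "u \<in> ?V" using u cD(2) by simp
    have "\<omega> (R u) [inf_gen G M X a Z (R u), plot_deriv X R u v]
        = - mext X (\<lambda>y _. \<Phi> y Z) (R u) [plot_deriv X R u v]"
      using mom Z Ru plot_deriv_tangent[OF X R(1) u v] unfolding moment_map_def by blast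
    also have "mext X (\<lambda>y _. \<Phi> y Z) (R u) [plot_deriv X R u v]
        = dderiv ?h (snd c (R u)) (vderiv (\<lambda>y. snd c (R y)) u v)"
      unfolding mext_def Let_def c_def[symmetric] ext_deriv_def
      by (simp add: plot_pullback_def plot_deriv_at[where P=R and u=u, OF c])
    also have "\<dots> = dderiv (\<lambda>y. ?h (snd c (R y))) u v"
      by (rule dderiv_chain[OF rep h uV v, symmetric])
    also have "\<dots> = dderiv (\<lambda>y. 0) u v"
    proof (rule dderiv_cong[OF euclid_smooth_mapD(1)[OF rep] uV v])
      fix y assume "y \<in> ?V"
      then have "param c (snd c (R y)) = R y" "R y \<in> ?C" using C(7) R(2) by auto
      then show "?h (snd c (R y)) = 0" using \<Phi>0[OF _ Z] by simp
    qed
    finally show ?thesis by (simp add: dderiv_def)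
  qed
  show ?thesis
  proof (rule reduced_form_criterion[OF form free])
    fix n U P Q u g vs
    assume P: "smooth_plot X n U P" "P ` U \<subseteq> ?C" and Q: "smooth_plot X n U Q" "Q ` U \<subseteq> ?C"
      and u: "u \<in> U" and g: "g \<in> carrier G" "a g (P u) = Q u" and vs: "vs \<in> vecs n 2"
      and dec: "\<And>v. v \<in> Rn n \<Longrightarrow> \<exists>Z\<in>lie_algebra G M.
        plot_deriv X Q u v = tadd (plot_deriv X (\<lambda>y. a g (P y)) u v) (inf_gen G M X a Z (Q u))"
    define P1 where "P1 y = a g (P y)" for y
    have P1: "smooth_plot X n U P1" "P1 ` U \<subseteq> ?C" and P1u: "P1 u = Q u"
      unfolding P1_def using act_const_plot[OF P(1) g(1)] inv_C[OF g(1)] P(2) g(2) by auto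
    have Qu: "Q u \<in> mpoints X" by (rule smooth_plotD(2)[OF Q(1) u])
    obtain v w where vw: "vs = [v, w]" "v \<in> Rn n" "w \<in> Rn n"
      using vs by (auto simp: vecs_def length_Suc_conv numeral_2_eq_2)
    let ?A = "plot_deriv X P1 u v" and ?B = "plot_deriv X P1 u w" and ?Q = "plot_deriv X Q u"
    obtain Z where Z: "Z \<in> lie_algebra G M" "?Q v = tadd ?A (inf_gen G M X a Z (Q u))"
      using dec[OF vw(2)] unfolding P1_def by blast
    obtain W where W: "W \<in> lie_algebra G M" "?Q w = tadd ?B (inf_gen G M X a W (Q u))"
      using dec[OF vw(3)] unfolding P1_def by blast
    let ?z = "inf_gen G M X a Z (Q u)" and ?y = "inf_gen G M X a W (Q u)"
    have tA: "?A \<in> tangent_space X (Q u)" and tB: "?B \<in> tangent_space X (Q u)"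
      using plot_deriv_tangent[OF X P1(1) u] vw P1u by metis+
    have tQ: "?Q w \<in> tangent_space X (Q u)" by (rule plot_deriv_tangent[OF X Q(1) u vw(3)])
    have tz: "?z \<in> tangent_space X (Q u)" and ty: "?y \<in> tangent_space X (Q u)"
      using inf_gen_tangent[OF _ Qu] Z W by blast+
    note add = mform_add(1)[OF X form Qu]
    have alt: "\<omega> (Q u) [r, r] = 0" if "r \<in> tangent_space X (Q u)" for r
      using mform_add(2)[OF X form Qu, of "[r, r]" 0 r r 1] that by simp
    have "tadd ?A ?y \<in> tangent_space X (Q u)"
      using tadd_tangent[OF X Qu tA ty, of 1 1] by (simp add: tscale_def)
    \<comment> \<open>Polarization: \<omega> vanishes on the pair of twice the vector
      \<open>tadd ?A ?y\<close>, which gives antisymmetry and lets the generator stand in either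
      slot.\<close>
    from alt[OF this] have "\<omega> (Q u) [?A, ?y] + \<omega> (Q u) [?y, ?A] = 0"
      using add[of "[?A, tadd ?A ?y]" 0 ?A ?y] add[of "[?A, ?A]" 1 ?A ?y] add[of "[?y, ?A]" 1 ?A ?y]
        tA ty \<open>tadd ?A ?y \<in> _\<close> alt[OF tA] alt[OF ty] by simp
    moreover have "\<omega> (Q u) [?y, ?A] = 0" using horiz[OF P1 u vw(2) W(1)] by (simp add: P1u)
    ultimately have Ay: "\<omega> (Q u) [?A, ?y] = 0" by simp
    have "plot_pullback X Q \<omega> u vs = \<omega> (Q u) [tadd ?A ?z, ?Q w]"
      unfolding plot_pullback_def vw(1) by (simp only: list.map Z(2))
    \<comment> \<open>Only the first slot is expanded here. With \<open>?Q w\<close> intact,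
      \<open>horiz\<close> for Q removes one generator; the other is left paired with
      \<open>?A\<close>, where \<open>Ay\<close> applies.\<close>
    also have "\<dots> = \<omega> (Q u) [?A, ?Q w] + \<omega> (Q u) [?z, ?Q w]"
      using add[of "[?A, ?Q w]" 0 ?A ?z] tA tz tQ by simp
    also have "\<omega> (Q u) [?z, ?Q w] = 0" by (rule horiz[OF Q u vw(3) Z(1)])
    also have "\<omega> (Q u) [?A, ?Q w] = \<omega> (Q u) [?A, tadd ?B ?y]" by (simp only: W(2))
    also have "\<dots> = \<omega> (Q u) [?A, ?B] + \<omega> (Q u) [?A, ?y]"
      using add[of "[?A, ?B]" 1 ?B ?y] tA tB ty by simp
    also have "\<dots> = plot_pullback X P1 \<omega> u vs" unfolding Ay by (simp add: plot_pullback_def vw(1) P1u)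
    also have "\<dots> = plot_pullback X P \<omega> u vs"
      unfolding P1_def by (rule pullback_translate[OF inv P(1) g(1) u vs])
    finally show "plot_pullback X P \<omega> u vs = plot_pullback X Q \<omega> u vs" by simp
  qed
qed

theorem theorem7p1:
  fixes G :: "'g monoid" and M :: "'g mfd"
  assumes "lie_group G M" and "connected_space (mtop M)"
  shows
    "(\<forall>(X :: 'x mfd) a \<omega> \<Phi>.
        hamiltonian_space G M X a \<omega> \<Phi> \<and> locally_free_on G M a (zero_level G M X \<Phi>) \<longrightarrow>
        carries_reduced_form G X a (zero_level G M X \<Phi>) 2 \<omega>) \<and>
     (\<forall>(Y :: 'y mfd) b \<theta>.
        prequantum_space G M Y b \<theta> \<and>
        locally_free_on G M b (zero_level G M Y (contact_moment G M Y b \<theta>)) \<longrightarrow>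
        carries_reduced_form G Y b (zero_level G M Y (contact_moment G M Y b \<theta>)) 1 \<theta>)"
  using hamiltonian_reduction[OF assms(1)] contact_reduction[OF assms(1)] by blast

end
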